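(* Let $X$ be a zero-dimensional metric space with derived set $X'$. The following assertions are equivalent: (1) the space $C_k(X,2)$ is Ascoli; (2) the space $C_k(X,2)$ is a $k_{\mathbb{R}}$-space; (3) one of the following conditions holds: (3a) $X$ is locally compact; (3b) $X$ is not locally compact but $X'$ is compact. Moreover, in case (3a), $C_k(X,2)$ is (topologically isomorphic to) the product of a family of Polish abelian groups; and in case (3b), the open subgroup $$H:=\{f\in C_k(X,2): f|_{X'}\equiv 0\}$$ of $C_k(X,2)$ is a $k$-space and is topologically isomorphic to the direct sum $\bigoplus_{n\in\mathbb{N}}2^{\kappa_n}$ endowed with the box topology for some sequence $(\kappa_n)_{n\in\mathbb{N}}$ of cardinal numbers.
   Context: Zero-dimensional means having a base of clopen sets. The derived set $X'$ is the set of all non-isolated points of $X$. $2=\{0,1\}=\mathbb{Z}(2)$ is the two-element discrete group, and $2^{\kappa}$ is the compact group $\mathbb{Z}(2)^\kappa$ with the product topology. $C_k(X,2)$ is the set of continuous functions $X\to 2$ with the compact-open topology, a topological abelian group under pointwise operations. $C_k(Z):=C_k(Z,\mathbb{R})$ is the space of continuous real functions on $Z$ with the compact-open topology. A space $Z$ is a $k$-space if for each non-closed $A\subset Z$ there is a compact $K\subset Z$ such that $A\cap K$ is not closed in $K$; a $k_{\mathbb{R}}$-space if a real-valued function $f$ on $Z$ is continuous if and only if $f|_K$ is continuous for every compact $K\subset Z$. A regular Hausdorff space $Z$ is an Ascoli space if each compact subset $\mathcal{K}$ of $C_k(Z)$ is evenly continuous, i.e. the evaluation map $Z\times\mathcal{K}\to\mathbb{R}$,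 $(z,f)\mapsto f(z)$, is jointly continuous. For topological groups $G_n$ ($n\in\mathbb{N}$), $\bigoplus_{n}G_n$ is the subgroup of $\prod_n G_n$ of all $(g_n)$ with $g_n=e_n$ for all but finitely many $n$. The box topology on $\prod_n G_n$ is the group topology with neighborhood base at the identity given by the sets $\prod_n U_n$, $U_n$ an open neighborhood of the identity of $G_n$; $\bigoplus_n G_n$ carries the subspace topology. *)

theory Defs
  imports "HOL-Analysis.Analysis" "HOL-Algebra.Product_Groups"
begin

section \<open>Topological spaces\<close>

definition zero_dimensional_space :: "'a topology \<Rightarrow> bool" where
  "zero_dimensional_space X \<longleftrightarrow>
     (\<exists>\<B>. (\<forall>U\<in>\<B>. openin X U \<and> closedin X U) \<and>
          openin X = arbitrary union_of (\<lambda>U. U \<in> \<B>))"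

abbreviation derived_space_set :: "'a topology \<Rightarrow> 'a set" where
  "derived_space_set X \<equiv> X derived_set_of (topspace X)"

text \<open>Functions on a space are made extensional outside the space, so that two elements
  of the function space are equal exactly if they agree on the space.\<close>

definition continuous_functions :: "'a topology \<Rightarrow> 'b topology \<Rightarrow> ('a \<Rightarrow> 'b) set" where
  "continuous_functions X Y = {f \<in> extensional (topspace X). continuous_map X Y f}"

definition compact_open_topology :: "'a topology \<Rightarrow> 'b topology \<Rightarrow> ('a \<Rightarrow> 'b) topology" where
  "compact_open_topology X Y =
     topology_generated_by
       {{f \<in> continuous_functions X Y. f ` K \<subseteq> U} | K U. compactin X K \<and> openin Y U}"

lemma topspace_compact_open_topology [simp]:
  "topspace (compact_open_topology X Y) = continuous_functions X Y"
proof -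
  have "{f \<in> continuous_functions X Y. f ` {} \<subseteq> {}}
      \<in> {{f \<in> continuous_functions X Y. f ` K \<subseteq> U} | K U. compactin X K \<and> openin Y U}"
    by blast
  then show ?thesis
    unfolding compact_open_topology_def topology_generated_by_topspace by auto
qed

definition kR_space :: "'a topology \<Rightarrow> bool" where
  "kR_space Z \<longleftrightarrow>
     (\<forall>f :: 'a \<Rightarrow> real.
        continuous_map Z euclideanreal f \<longleftrightarrow>
        (\<forall>K. compactin Z K \<longrightarrow> continuous_map (subtopology Z K) euclideanreal f))"

definition evenly_continuous :: "'a topology \<Rightarrow> ('a \<Rightarrow> real) set \<Rightarrow> bool" where
  "evenly_continuous Z \<K> \<longleftrightarrow>
     continuous_map
       (prod_topology Z (subtopology (compact_open_topology Z euclideanreal) \<K>))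
       euclideanreal (\<lambda>(z, f). f z)"

definition Ascoli_space :: "'a topology \<Rightarrow> bool" where
  "Ascoli_space Z \<longleftrightarrow>
     regular_space Z \<and> Hausdorff_space Z \<and>
     (\<forall>\<K>. compactin (compact_open_topology Z euclideanreal) \<K> \<longrightarrow> evenly_continuous Z \<K>)"

section \<open>Topological groups\<close>

definition topological_group :: "('g, 'm) monoid_scheme \<Rightarrow> 'g topology \<Rightarrow> bool" where
  "topological_group G T \<longleftrightarrow>
     group G \<and> topspace T = carrier G \<and>
     continuous_map (prod_topology T T) T (\<lambda>(x, y). x \<otimes>\<^bsub>G\<^esub> y) \<and>
     continuous_map T T (\<lambda>x. inv\<^bsub>G\<^esub> x)"

definition Polish_abelian_group :: "('g, 'm) monoid_scheme \<Rightarrow> 'g topology \<Rightarrow> bool" where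
  "Polish_abelian_group G T \<longleftrightarrow>
     topological_group G T \<and> comm_group G \<and>
     separable_space T \<and> completely_metrizable_space T"

definition topologically_isomorphic ::
  "('g, 'm) monoid_scheme \<Rightarrow> 'g topology \<Rightarrow> ('h, 'n) monoid_scheme \<Rightarrow> 'h topology \<Rightarrow> bool" where
  "topologically_isomorphic G S H T \<longleftrightarrow> (\<exists>\<phi>. \<phi> \<in> iso G H \<and> homeomorphic_map S T \<phi>)"

text \<open>The group topology on a full product whose neighbourhood base at the identity consists
  of the boxes formed from open neighbourhoods of the identities: a set is open iff with each
  of its points it contains a translate of such a box.\<close>

definition box_group_topology ::
  "'i set \<Rightarrow> ('i \<Rightarrow> ('g, 'm) monoid_scheme) \<Rightarrow> ('i \<Rightarrow> 'g topology) \<Rightarrow> ('i \<Rightarrow> 'g) topology" where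
  "box_group_topology I G T =
     topology (\<lambda>W. W \<subseteq> carrier (product_group I G) \<and>
       (\<forall>g\<in>W. \<exists>U. (\<forall>i\<in>I. openin (T i) (U i) \<and> \<one>\<^bsub>G i\<^esub> \<in> U i) \<and>
                  g <#\<^bsub>product_group I G\<^esub> (\<Pi>\<^sub>E i\<in>I. U i) \<subseteq> W))"

lemma openin_box_group_topology:
  "openin (box_group_topology I G T) W \<longleftrightarrow>
     W \<subseteq> carrier (product_group I G) \<and>
     (\<forall>g\<in>W. \<exists>U. (\<forall>i\<in>I. openin (T i) (U i) \<and> \<one>\<^bsub>G i\<^esub> \<in> U i) \<and>
                g <#\<^bsub>product_group I G\<^esub> (\<Pi>\<^sub>E i\<in>I. U i) \<subseteq> W)"
proof -
  let ?N = "\<lambda>U. \<forall>i\<in>I. openin (T i) (U i) \<and> \<one>\<^bsub>G i\<^esub> \<in> U i"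
  let ?c = "\<lambda>g U. g <#\<^bsub>product_group I G\<^esub> (\<Pi>\<^sub>E i\<in>I. U i)"
  let ?L = "\<lambda>W. W \<subseteq> carrier (product_group I G) \<and> (\<forall>g\<in>W. \<exists>U. ?N U \<and> ?c g U \<subseteq> W)"
  have "istopology ?L"
    unfolding istopology_def
  proof (intro conjI allI impI ballI)
    fix V W assume V: "?L V" and W: "?L W"
    then show "V \<inter> W \<subseteq> carrier (product_group I G)" by blast
    fix g assume "g \<in> V \<inter> W"
    with V W obtain A B where "?N A" "?c g A \<subseteq> V" "?N B" "?c g B \<subseteq> W"
      by (metis IntD1 IntD2)
    moreover from this have "?N (\<lambda>i. A i \<inter> B i)" by auto
    moreover have "?c g (\<lambda>i. A i \<inter> B i) \<subseteq> ?c g A \<inter> ?c g B"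
      by (auto simp: l_coset_def PiE_iff)
    ultimately show "\<exists>U. ?N U \<and> ?c g U \<subseteq> V \<inter> W"
      by (intro exI[of _ "\<lambda>i. A i \<inter> B i"]) blast
  next
    fix \<W> assume *: "\<forall>W\<in>\<W>. ?L W"
    then show "\<Union>\<W> \<subseteq> carrier (product_group I G)" by blast
    fix g assume "g \<in> \<Union>\<W>"
    with * obtain W U where "W \<in> \<W>" "?N U" "?c g U \<subseteq> W" by (metis UnionE)
    then show "\<exists>U. ?N U \<and> ?c g U \<subseteq> \<Union>\<W>" by blast
  qed
  then show ?thesis
    by (simp add: box_group_topology_def topology_inverse')
qed

lemma openin_box_group_topology_PiE:
  assumes "\<And>i. i \<in> I \<Longrightarrow> topological_group (G i) (T i)"
    and "\<And>i. i \<in> I \<Longrightarrow> openin (T i) (V i)"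
  shows "openin (box_group_topology I G T) (\<Pi>\<^sub>E i\<in>I. V i)"
  unfolding openin_box_group_topology
proof (intro conjI ballI)
  have top: "topspace (T i) = carrier (G i)" and grp: "group (G i)"
    if "i \<in> I" for i using assms(1)[OF that] by (auto simp: topological_group_def)
  show "(\<Pi>\<^sub>E i\<in>I. V i) \<subseteq> carrier (product_group I G)"
    using assms(2) top openin_subset by (fastforce simp: PiE_iff)
  fix g assume g: "g \<in> (\<Pi>\<^sub>E i\<in>I. V i)"
  have gi: "g i \<in> V i" "g i \<in> topspace (T i)" if "i \<in> I" for i
    using g assms(2)[OF that] openin_subset that by (fastforce simp: PiE_iff)+
  define U where "U i = {x \<in> topspace (T i). g i \<otimes>\<^bsub>G i\<^esub> x \<in> V i}" for i
  have "openin (T i) (U i)" if i: "i \<in> I" for i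
  proof -
    have c: "continuous_map (prod_topology (T i) (T i)) (T i) (\<lambda>(x, y). x \<otimes>\<^bsub>G i\<^esub> y)"
      using assms(1)[OF i] by (simp add: topological_group_def)
    have "continuous_map (T i) (prod_topology (T i) (T i)) (\<lambda>x. (g i, x))"
      using gi[OF i] by (simp add: continuous_map_pairedI)
    from continuous_map_compose[OF this c]
    have "continuous_map (T i) (T i) (\<lambda>x. g i \<otimes>\<^bsub>G i\<^esub> x)"
      by (simp add: o_def)
    then show ?thesis
      unfolding U_def using assms(2)[OF i] by (rule openin_continuous_map_preimage)
  qed
  moreover have "\<one>\<^bsub>G i\<^esub> \<in> U i" if "i \<in> I" for i
    using gi[OF that] grp[OF that] top[OF that] unfolding U_def
    by (simp add: group.is_monoid)
  moreover have "g <#\<^bsub>product_group I G\<^esub> (\<Pi>\<^sub>E i\<in>I. U i) \<subseteq> (\<Pi>\<^sub>E i\<in>I. V i)"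
    by (auto simp: l_coset_def U_def PiE_iff product_group_def)
  ultimately show "\<exists>U. (\<forall>i\<in>I. openin (T i) (U i) \<and> \<one>\<^bsub>G i\<^esub> \<in> U i) \<and>
      g <#\<^bsub>product_group I G\<^esub> (\<Pi>\<^sub>E i\<in>I. U i) \<subseteq> (\<Pi>\<^sub>E i\<in>I. V i)"
    by blast
qed

definition box_sum_topology ::
  "'i set \<Rightarrow> ('i \<Rightarrow> ('g, 'm) monoid_scheme) \<Rightarrow> ('i \<Rightarrow> 'g topology) \<Rightarrow> ('i \<Rightarrow> 'g) topology" where
  "box_sum_topology I G T = subtopology (box_group_topology I G T) (carrier (sum_group I G))"

section \<open>The groups built from the two-element group\<close>

abbreviation Z2 :: "int monoid" where
  "Z2 \<equiv> integer_mod_group 2"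

abbreviation Z2_topology :: "int topology" where
  "Z2_topology \<equiv> discrete_topology (carrier Z2)"

definition Ck2_group :: "'a topology \<Rightarrow> ('a \<Rightarrow> int) monoid" where
  "Ck2_group X =
     \<lparr>carrier = continuous_functions X Z2_topology,
      monoid.mult = (\<lambda>f g. \<lambda>x\<in>topspace X. f x \<otimes>\<^bsub>Z2\<^esub> g x),
      one = (\<lambda>x\<in>topspace X. \<one>\<^bsub>Z2\<^esub>)\<rparr>"

definition Ck2_topology :: "'a topology \<Rightarrow> ('a \<Rightarrow> int) topology" where
  "Ck2_topology X = compact_open_topology X Z2_topology"

definition Ck2_vanishing :: "'a topology \<Rightarrow> ('a \<Rightarrow> int) set" where
  "Ck2_vanishing X = {f \<in> carrier (Ck2_group X). \<forall>x \<in> derived_space_set X. f x = \<one>\<^bsub>Z2\<^esub>}"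

text \<open>A cardinal number is, as in the library, a well-order \<open>\<kappa>\<close> with \<open>Card_order \<kappa>\<close>;
  the corresponding power is indexed by its field.\<close>

definition Z2_power_group :: "'k rel \<Rightarrow> ('k \<Rightarrow> int) monoid" where
  "Z2_power_group \<kappa> = product_group (Field \<kappa>) (\<lambda>_. Z2)"

definition Z2_power_topology :: "'k rel \<Rightarrow> ('k \<Rightarrow> int) topology" where
  "Z2_power_topology \<kappa> = product_topology (\<lambda>_. Z2_topology) (Field \<kappa>)"

end

(* The basic neighbourhoods of f in C_k(X,2) are the sets of all g agreeing with f on a compact set.

   If X is locally compact, chains of steps that are short compared to the radius of compact balls
   split X into sigma-compact clopen classes, hence into compact open pieces K. So C_k(X,2) is the
   product of the countable discrete groups C_k(K,2), and every product of discrete spaces is a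
   k_R-space.

   If X' is compact, let A_n be the 1/n-neighbourhood of X'. Functions that agree on X' agree on some
   A_n, and a compact set is X' plus finitely many isolated points in each shell A_n - A_(n+1); so H
   is the box sum of the powers of Z(2) over the shells. The sets of functions agreeing with a given
   one on A_n are compact, and the tube lemma applied along n shows that C_k(X,2) is a k-space.

   A k_R-space is Ascoli, since a compact set of functions gives a supremum of oscillations
   that is continuous on compact sets. Finally, if neither condition holds, a metric fan at a point
   without compact neighbourhood and a discrete sequence of convergent sequences give a family of
   clopen sets in C_k(X,2), finitely many of them meeting each compact set, with points in them
   accumulating at 0; this contradicts the Ascoli property. *)
theory Submission
  imports Defs
begin

section \<open>The topology of two-valued functions\<close>

text \<open>In the locally compact case \<open>X\<close> may be non-separable, while making a clopen
  cover disjoint by subtracting predecessors keeps the pieces open only if each has finitely many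
  predecessors. The chains cut \<open>X\<close> into clopen classes that are covered by sequences of
  compact sets: all one-step neighbours of a compact set lie in another compact set.

  A product of uncountably many infinite discrete spaces is not a k-space, so there the real
  k-property has to be proved directly. With compact \<open>X'\<close> the k-property holds for the
  whole group and passes to \<open>H\<close>, which is closed.

  Elements of the direct sum have finite support because a function that vanishes on
  \<open>X'\<close> vanishes on some \<open>A n\<close>; the topology is the box topology because a
  compact set may contain points of every shell.

  The obstruction needs two indices. A neighbourhood of 0 is entered by choosing \<open>n\<close>
  large and then \<open>k\<close> large depending on \<open>n\<close>, whereas eventual constancy of
  a compact set of functions along convergent sequences leaves only finitely many pairs
  \<open>(n, k)\<close>.\<close>

abbreviation CF2 :: "'a topology \<Rightarrow> ('a \<Rightarrow> int) set" where
  "CF2 X \<equiv> continuous_functions X Z2_topology"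

text \<open>For compact \<open>K\<close> these are the basic neighbourhoods. Later \<open>K\<close>
  is also an open set \<open>A n\<close> around the derived set; then \<open>agree X f K\<close> is
  a compact set of functions.\<close>

definition agree :: "'a topology \<Rightarrow> ('a \<Rightarrow> int) \<Rightarrow> 'a set \<Rightarrow> ('a \<Rightarrow> int) set" where
  "agree X f K = {g \<in> CF2 X. \<forall>x\<in>K. g x = f x}"

lemma carrier_Z2: "carrier Z2 = {0, 1}"
  by (auto simp: carrier_integer_mod_group)

lemma topspace_Ck2 [simp]: "topspace (Ck2_topology X) = CF2 X"
  by (simp add: Ck2_topology_def)

text \<open>Continuity into a discrete space is local constancy, stated pointwise so that functions
  glued from pieces can be checked near each point.\<close>

lemma CF2_iff:
  "f \<in> CF2 X \<longleftrightarrow> f \<in> extensional (topspace X) \<and> (\<forall>x\<in>topspace X. f x \<in> {0, 1}) \<and>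
     (\<forall>x\<in>topspace X. \<exists>U. openin X U \<and> x \<in> U \<and> U \<subseteq> {y. f y = f x})" (is "?L \<longleftrightarrow> ?R")
proof
  assume f: ?L
  then have c: "continuous_map X Z2_topology f" by (simp add: continuous_functions_def)
  have 01: "f x \<in> {0,1}" if "x \<in> topspace X" for x
    using c that by (auto simp: continuous_map_def carrier_Z2)
  have "\<exists>U. openin X U \<and> x \<in> U \<and> U \<subseteq> {y. f y = f x}" if "x \<in> topspace X" for x
  proof (intro exI conjI)
    show "openin X {y \<in> topspace X. f y \<in> {f x}}"
      using c 01[OF that] by (intro openin_continuous_map_preimage[OF c]) (auto simp: carrier_Z2)
  qed (use that in auto)
  with f 01 show ?R by (auto simp: continuous_functions_def)
next
  assume R: ?R
  have "openin X {x \<in> topspace X. f x \<in> U}" for U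
  proof (subst openin_subopen, clarify)
    fix x assume x: "x \<in> topspace X" "f x \<in> U"
    then obtain V where V: "openin X V" "x \<in> V" "V \<subseteq> {y. f y = f x}"
      using R[THEN conjunct2, THEN conjunct2] by meson
    with x openin_subset[OF V(1)]
    show "\<exists>T. openin X T \<and> x \<in> T \<and> T \<subseteq> {x \<in> topspace X. f x \<in> U}"
      by (intro exI[of _ V]) auto
  qed
  with R show ?L
    by (auto simp: continuous_functions_def continuous_map_def carrier_Z2)
qed

lemma CF2_01: "f \<in> CF2 X \<Longrightarrow> x \<in> topspace X \<Longrightarrow> f x \<in> {0, 1}"
  by (simp add: CF2_iff)

lemma CF2_local:
  "f \<in> CF2 X \<Longrightarrow> x \<in> topspace X \<Longrightarrow> \<exists>U. openin X U \<and> x \<in> U \<and> U \<subseteq> {y. f y = f x}"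
  by (simp add: CF2_iff)

lemma CF2I:
  assumes "f \<in> extensional (topspace X)" "\<And>x. x \<in> topspace X \<Longrightarrow> f x \<in> {0, 1}"
    "\<And>x. x \<in> topspace X \<Longrightarrow> \<exists>U. openin X U \<and> x \<in> U \<and> U \<subseteq> {y. f y = f x}"
  shows "f \<in> CF2 X"
  using assms by (simp add: CF2_iff)

lemma CF2_ext: "f \<in> CF2 X \<Longrightarrow> g \<in> CF2 X \<Longrightarrow> (\<And>x. x \<in> topspace X \<Longrightarrow> f x = g x) \<Longrightarrow> f = g"
  unfolding CF2_iff using extensionalityI by blast

lemma openin_CF2_eq:
  assumes "f \<in> CF2 X" "g \<in> CF2 X"
  shows "openin X {x \<in> topspace X. f x = g x}"
proof (subst openin_subopen, clarify)
  fix x assume x: "x \<in> topspace X" "f x = g x"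
  obtain U V where "openin X U" "x \<in> U" "U \<subseteq> {y. f y = f x}" "openin X V" "x \<in> V" "V \<subseteq> {y. g y = g x}"
    using assms x by (metis CF2_local)
  moreover have "U \<inter> V \<subseteq> {x \<in> topspace X. f x = g x}"
  proof
    fix y assume y: "y \<in> U \<inter> V"
    with calculation have "f y = f x" "g y = g x" by auto
    with y calculation openin_subset[of X U] x show "y \<in> {x \<in> topspace X. f x = g x}" by auto
  qed
  ultimately show "\<exists>T. openin X T \<and> x \<in> T \<and> T \<subseteq> {x \<in> topspace X. f x = g x}"
    by blast
qed

lemma openin_CF2_val:
  assumes "f \<in> CF2 X" shows "openin X {x \<in> topspace X. f x = c}"
proof (subst openin_subopen, clarify)
  fix x assume x: "x \<in> topspace X" "c = f x"
  with assms obtain V where V: "openin X V" "x \<in> V" "V \<subseteq> {y. f y = f x}" by (metis CF2_local)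
  with x openin_subset[OF V(1)]
  show "\<exists>T. openin X T \<and> x \<in> T \<and> T \<subseteq> {y \<in> topspace X. f y = f x}"
    by (intro exI[of _ V]) auto
qed

lemma closedin_CF2_val:
  assumes "f \<in> CF2 X" shows "closedin X {x \<in> topspace X. f x = c}"
proof -
  have "topspace X - {x \<in> topspace X. f x = c} = \<Union>{{x \<in> topspace X. f x = b} |b. b \<noteq> c}" by auto
  also have "openin X \<dots>" using openin_CF2_val[OF assms] by blast
  finally show ?thesis by (auto simp: closedin_def)
qed

lemma indicator_in_CF2:
  assumes "openin X U" "closedin X U"
  shows "(\<lambda>x\<in>topspace X. of_bool (x \<in> U)) \<in> CF2 X"
proof -
  define f :: "'a \<Rightarrow> int" where "f = (\<lambda>x\<in>topspace X. of_bool (x \<in> U))"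
  have f: "f x = of_bool (x \<in> U)" if "x \<in> topspace X" for x
    using that by (simp add: f_def)
  have "f \<in> CF2 X"
  proof (rule CF2I)
    show "f \<in> extensional (topspace X)" unfolding f_def by (rule restrict_extensional)
    fix x assume x: "x \<in> topspace X"
    then show "f x \<in> {0, 1}" by (simp add: f)
    show "\<exists>V. openin X V \<and> x \<in> V \<and> V \<subseteq> {y. f y = f x}"
    proof (cases "x \<in> U")
      case True
      then show ?thesis using assms openin_subset[of X U] x by (intro exI[of _ U]) (auto simp: f)
    next
      case False
      then show ?thesis using assms x
        by (intro exI[of _ "topspace X - U"]) (auto simp: closedin_def f)
    qed
  qed
  then show ?thesis by (simp only: f_def)
qed

text \<open>The fibres of \<open>f\<close> are clopen, so they split \<open>K\<close> into two
  compact parts. On each part, agreement with \<open>f\<close> is a single subbasic condition with a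
  singleton as target.\<close>

lemma openin_Ck2_agree:
  assumes "f \<in> CF2 X" "compactin X K"
  shows "openin (Ck2_topology X) (agree X f K)"
proof -
  have *: "openin (Ck2_topology X) {g \<in> CF2 X. g ` (K \<inter> {x \<in> topspace X. f x = c}) \<subseteq> {c}}"
    if "c \<in> {0, 1}" for c
    unfolding Ck2_topology_def compact_open_topology_def
  proof (rule topology_generated_by_Basis, rule CollectI, intro exI conjI)
    show "{g \<in> CF2 X. g ` (K \<inter> {x \<in> topspace X. f x = c}) \<subseteq> {c}} =
      {g \<in> CF2 X. g ` (K \<inter> {x \<in> topspace X. f x = c}) \<subseteq> {c}}" ..
    show "compactin X (K \<inter> {x \<in> topspace X. f x = c})"
      using assms closedin_CF2_val by (metis compact_Int_closedin)
    show "openin Z2_topology {c}" using that by (auto simp: carrier_Z2)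
  qed
  have "agree X f K = {g \<in> CF2 X. g ` (K \<inter> {x \<in> topspace X. f x = 0}) \<subseteq> {0}}
      \<inter> {g \<in> CF2 X. g ` (K \<inter> {x \<in> topspace X. f x = 1}) \<subseteq> {1}}" (is "?L = ?R")
  proof (rule Set.set_eqI)
    fix g
    have "\<forall>x\<in>K. x \<in> topspace X \<and> (f x = 0 \<or> f x = 1)"
      using assms compactin_subset_topspace CF2_01 by fastforce
    then show "g \<in> ?L \<longleftrightarrow> g \<in> ?R"
      by (auto simp: agree_def image_subset_iff)
  qed
  then show ?thesis using openin_Int[OF *[of 0] *[of 1]] by simp
qed

text \<open>A subbasic condition on \<open>K\<close> depends only on the values on \<open>K\<close>,
  and finite intersections of conditions correspond to unions of compact sets. Later arguments reach
  the compact-open topology through this criterion.\<close>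

lemma openin_Ck2:
  "openin (Ck2_topology X) W \<longleftrightarrow>
     W \<subseteq> CF2 X \<and> (\<forall>f\<in>W. \<exists>K. compactin X K \<and> agree X f K \<subseteq> W)" (is "?L \<longleftrightarrow> ?R")
proof
  assume L: ?L
  then have "generate_topology_on
     {{f \<in> CF2 X. f ` K \<subseteq> U} | K U. compactin X K \<and> openin Z2_topology U} W"
    by (simp add: Ck2_topology_def compact_open_topology_def openin_topology_generated_by)
  then have "\<forall>f\<in>W. \<exists>K. compactin X K \<and> agree X f K \<subseteq> W"
  proof induction
    case (Int a b)
    show ?case
    proof
      fix f assume "f \<in> a \<inter> b"
      with Int obtain K L where "compactin X K" "agree X f K \<subseteq> a" "compactin X L" "agree X f L \<subseteq> b"
        by (metis IntD1 IntD2)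
      then show "\<exists>K. compactin X K \<and> agree X f K \<subseteq> a \<inter> b"
        by (intro exI[of _ "K \<union> L"]) (auto simp: agree_def compactin_Un)
    qed
  next
    case (UN \<K>)
    then show ?case by (meson UnionE Union_upper order_trans)
  next
    case (Basis s)
    then obtain K U where "s = {f \<in> CF2 X. f ` K \<subseteq> U}" "compactin X K" by blast
    then show ?case by (intro ballI exI[of _ K]) (auto simp: agree_def)
  qed auto
  with L openin_subset[OF L] show ?R by simp
next
  assume R: ?R
  show ?L
  proof (subst openin_subopen, clarify)
    fix f assume "f \<in> W"
    with R obtain K where "compactin X K" "agree X f K \<subseteq> W" by blast
    moreover have "f \<in> agree X f K" using R \<open>f \<in> W\<close> by (auto simp: agree_def)
    ultimately show "\<exists>T. openin (Ck2_topology X) T \<and> f \<in> T \<and> T \<subseteq> W"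
      using openin_Ck2_agree R \<open>f \<in> W\<close> by blast
  qed
qed

text \<open>Disagreement shows at a single point \<open>x\<close>, and \<open>{x}\<close> is
  compact.\<close>

lemma closedin_Ck2_agree:
  assumes "K \<subseteq> topspace X"
  shows "closedin (Ck2_topology X) (agree X f K)"
proof -
  have "openin (Ck2_topology X) (CF2 X - agree X f K)"
    unfolding openin_Ck2
  proof (intro conjI ballI)
    fix g assume "g \<in> CF2 X - agree X f K"
    then obtain x where "x \<in> K" "g x \<noteq> f x" by (auto simp: agree_def)
    then show "\<exists>L. compactin X L \<and> agree X g L \<subseteq> CF2 X - agree X f K"
      using assms by (intro exI[of _ "{x}"]) (auto simp: agree_def)
  qed auto
  then show ?thesis by (auto simp: closedin_def agree_def)
qed

lemma Hausdorff_Ck2: "Hausdorff_space (Ck2_topology X)"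
  unfolding Hausdorff_space_def
proof clarsimp
  fix f g assume fg: "f \<in> CF2 X" "g \<in> CF2 X" "f \<noteq> g"
  then obtain x where x: "x \<in> topspace X" "f x \<noteq> g x" using CF2_ext by metis
  show "\<exists>U. openin (Ck2_topology X) U \<and> (\<exists>V. openin (Ck2_topology X) V \<and> f \<in> U \<and> g \<in> V \<and> disjnt U V)"
    using fg x by (intro exI[of _ "agree X f {x}"] exI[of _ "agree X g {x}"] conjI openin_Ck2_agree)
      (auto simp: agree_def disjnt_def)
qed

lemma regular_Ck2: "regular_space (Ck2_topology X)"
  unfolding neighbourhood_base_of_closedin[symmetric] neighbourhood_base_of
proof (intro allI impI, elim conjE)
  fix W f assume "openin (Ck2_topology X) W" "f \<in> W"
  then obtain K where K: "compactin X K" "agree X f K \<subseteq> W" and f: "f \<in> CF2 X"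
    unfolding openin_Ck2 by blast
  then show "\<exists>U V. openin (Ck2_topology X) U \<and> closedin (Ck2_topology X) V \<and> f \<in> U \<and> U \<subseteq> V \<and> V \<subseteq> W"
    by (intro exI[of _ "agree X f K"] conjI openin_Ck2_agree closedin_Ck2_agree compactin_subset_topspace)
       (auto simp: agree_def)
qed

section \<open>k-spaces, real k-spaces and Ascoli spaces\<close>

lemma continuous_map_real_iff:
  "continuous_map X euclideanreal f \<longleftrightarrow>
     (\<forall>x\<in>topspace X. \<forall>e>0. \<exists>U. openin X U \<and> x \<in> U \<and> (\<forall>y\<in>U. \<bar>f y - f x\<bar> < e))"
  using Met_TC.continuous_map_to_metric[of X f]
  by (simp add: dist_real_def abs_minus_commute)

text \<open>On each compact \<open>L\<close> the functions in \<open>\<K>\<close> are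
  equicontinuous, which makes the supremum of their deviations from the values at \<open>z0\<close>
  continuous on \<open>L\<close>. The real k-property turns this into continuity on
  \<open>Z\<close>, and at \<open>z0\<close> it says that \<open>\<K>\<close> is equicontinuous
  there.\<close>

lemma kR_imp_Ascoli:
  assumes reg: "regular_space Z" and haus: "Hausdorff_space Z" and kR: "kR_space Z"
  shows "Ascoli_space Z"
  unfolding Ascoli_space_def
proof (intro conjI reg haus allI impI)
  fix \<K> :: "('a \<Rightarrow> real) set"
  let ?T = "compact_open_topology Z euclideanreal"
  let ?C = "continuous_functions Z euclideanreal"
  assume comp: "compactin ?T \<K>"
  then have \<K>: "\<K> \<subseteq> ?C" using compactin_subset_topspace by fastforce
  have sub: "openin ?T {g \<in> ?C. g ` K \<subseteq> U}" if "compactin Z K" "open U" for K and U :: "real set"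
    unfolding compact_open_topology_def using that
    by (intro topology_generated_by_Basis) auto
  have jc: "\<exists>U V. openin Z U \<and> openin ?T V \<and> z \<in> U \<and> f \<in> V \<and> (\<forall>z'\<in>U \<inter> L. \<forall>g\<in>V. \<bar>g z' - f z\<bar> < e)"
    if L: "compactin Z L" and z: "z \<in> topspace Z" and f: "f \<in> \<K>" and e: "e > 0" for L z f and e :: real
  proof -
    have f': "f \<in> ?C" and c: "continuous_map Z euclideanreal f"
      using f \<K> by (auto simp: continuous_functions_def)
    obtain O' where O': "openin Z O'" "z \<in> O'" "\<forall>y\<in>O'. \<bar>f y - f z\<bar> < e"
      using c z e unfolding continuous_map_real_iff by blast
    \<comment> \<open>Regularity puts a closed \<open>C\<close> inside \<open>O'\<close>, so that
      \<open>C \<inter> L\<close> is compact and can define a subbasic set of functions.\<close>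
    obtain U C where UC: "openin Z U" "closedin Z C" "z \<in> U" "U \<subseteq> C" "C \<subseteq> O'"
      using reg O' unfolding neighbourhood_base_of_closedin[symmetric] neighbourhood_base_of by meson
    let ?V = "{g \<in> ?C. g ` (C \<inter> L) \<subseteq> {y. \<bar>y - f z\<bar> < e}}"
    have "open {y. \<bar>y - f z\<bar> < e}"
      by (intro open_Collect_less continuous_intros)
    then have "openin ?T ?V"
      using sub closed_Int_compactin[OF UC(2) L] by blast
    moreover have "f \<in> ?V" using f' O' UC by auto
    moreover have "\<bar>g z' - f z\<bar> < e" if "z' \<in> U \<inter> L" "g \<in> ?V" for z' g
      using that UC(4) by (auto simp: image_subset_iff subset_iff)
    ultimately show ?thesis using UC by (intro exI[of _ U] exI[of _ ?V]) blast
  qed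
  \<comment> \<open>Finitely many of the \<open>V f\<close> cover \<open>\<K>\<close>, and the
    corresponding \<open>U f\<close> are intersected. The bound \<open>e/2\<close> is used twice,
    since both \<open>g z'\<close> and \<open>g z\<close> are compared with
    \<open>f z\<close>.\<close>
  have equi: "\<exists>U. openin Z U \<and> z \<in> U \<and> (\<forall>z'\<in>U \<inter> L. \<forall>g\<in>\<K>. \<bar>g z' - g z\<bar> < e)"
    if L: "compactin Z L" and z: "z \<in> topspace Z" "z \<in> L" and e: "e > 0" for L z and e :: real
  proof -
    have "\<forall>f\<in>\<K>. \<exists>U V. openin Z U \<and> openin ?T V \<and> z \<in> U \<and> f \<in> V \<and>
        (\<forall>z'\<in>U \<inter> L. \<forall>g\<in>V. \<bar>g z' - f z\<bar> < e/2)"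
      using jc[OF L z(1), of _ "e/2"] e by simp
    from bchoice[OF this] obtain U where "\<forall>f\<in>\<K>. \<exists>V. openin Z (U f) \<and> openin ?T V \<and> z \<in> U f \<and> f \<in> V \<and>
        (\<forall>z'\<in>U f \<inter> L. \<forall>g\<in>V. \<bar>g z' - f z\<bar> < e/2)" by blast
    from bchoice[OF this] obtain V where V: "\<forall>f\<in>\<K>. openin Z (U f) \<and> openin ?T (V f) \<and> z \<in> U f \<and> f \<in> V f \<and>
        (\<forall>z'\<in>U f \<inter> L. \<forall>g\<in>V f. \<bar>g z' - f z\<bar> < e/2)" by blast
    then have UV: "\<And>f. f \<in> \<K> \<Longrightarrow> openin Z (U f)" "\<And>f. f \<in> \<K> \<Longrightarrow> openin ?T (V f)"
      "\<And>f. f \<in> \<K> \<Longrightarrow> z \<in> U f" "\<And>f. f \<in> \<K> \<Longrightarrow> f \<in> V f"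
      "\<And>f z' g. f \<in> \<K> \<Longrightarrow> z' \<in> U f \<inter> L \<Longrightarrow> g \<in> V f \<Longrightarrow> \<bar>g z' - f z\<bar> < e/2"
      by blast+
    have "\<exists>\<F>. finite \<F> \<and> \<F> \<subseteq> V ` \<K> \<and> \<K> \<subseteq> \<Union>\<F>"
      using UV(2,4) by (intro compactinD[OF comp]) auto
    then obtain F where F: "finite F" "F \<subseteq> \<K>" "\<K> \<subseteq> \<Union>(V ` F)"
      by (metis finite_subset_image)
    show ?thesis
    proof (intro exI[of _ "topspace Z \<inter> \<Inter>(U ` F)"] conjI ballI)
      show "openin Z (topspace Z \<inter> \<Inter>(U ` F))"
        using F UV(1) by (intro openin_Int_Inter) auto
      show "z \<in> topspace Z \<inter> \<Inter>(U ` F)" using F UV(3) z by auto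
      fix z' g assume z': "z' \<in> topspace Z \<inter> \<Inter>(U ` F) \<inter> L" and g: "g \<in> \<K>"
      with F obtain f where f: "f \<in> F" "g \<in> V f" "f \<in> \<K>" by blast
      have "\<bar>g z' - f z\<bar> < e/2" using UV(5)[OF f(3) _ f(2), of z'] z' f by auto
      moreover have "\<bar>g z - f z\<bar> < e/2" using UV(5)[OF f(3) _ f(2), of z] z UV(3) f by auto
      ultimately show "\<bar>g z' - g z\<bar> < e" by linarith
    qed
  qed
  have equi0: "\<exists>U. openin Z U \<and> z0 \<in> U \<and> (\<forall>z\<in>U. \<forall>g\<in>\<K>. \<bar>g z - g z0\<bar> < e)"
    if z0: "z0 \<in> topspace Z" and e: "0 < e" for z0 and e :: real
  proof (cases "\<K> = {}")
    case True
    then show ?thesis using z0 by (intro exI[of _ "topspace Z"]) auto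
  next
    case False
    \<comment> \<open>Truncating at 1 makes the supremum exist without knowing that \<open>\<K>\<close> is pointwise bounded.\<close>
    define h where "h z = (SUP g\<in>\<K>. min 1 \<bar>g z - g z0\<bar>)" for z
    have bdd: "bdd_above ((\<lambda>g. min 1 \<bar>g z - g z0\<bar>) ` \<K>)" for z
      by (intro bdd_aboveI2[of _ _ 1]) auto
    have up: "min 1 \<bar>g z - g z0\<bar> \<le> h z" if "g \<in> \<K>" for g z
      unfolding h_def by (rule cSUP_upper[OF that bdd])
    \<comment> \<open>A uniform bound over \<open>\<K>\<close> passes to the supremum. Exchanging
      \<open>z\<close> and \<open>z'\<close> later turns this into a bound on
      \<open>\<bar>h z' - h z\<bar>\<close>.\<close>
    have mono: "h z' \<le> h z + d" if "\<forall>g\<in>\<K>. \<bar>g z' - g z\<bar> < d" for z z' d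
      unfolding h_def[of z']
    proof (rule cSUP_least[OF False])
      fix g assume "g \<in> \<K>"
      with that up[of g z] show "min 1 \<bar>g z' - g z0\<bar> \<le> h z + d" by fastforce
    qed
    have "continuous_map (subtopology Z L) euclideanreal h" if L: "compactin Z L" for L
      unfolding continuous_map_real_iff
    proof (intro ballI allI impI)
      fix z and d :: real assume z: "z \<in> topspace (subtopology Z L)" and d: "0 < d"
      then obtain U where U: "openin Z U" "z \<in> U" "\<forall>z'\<in>U \<inter> L. \<forall>g\<in>\<K>. \<bar>g z' - g z\<bar> < d/2"
        using equi[OF L, of z "d/2"] by auto
      have "\<bar>h y - h z\<bar> < d" if "y \<in> U \<inter> L" for y
      proof -
        have "h y \<le> h z + d/2" using U that by (intro mono) auto
        moreover have "h z \<le> h y + d/2" using U that by (intro mono) (auto simp: abs_minus_commute)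
        ultimately show ?thesis using d by linarith
      qed
      then show "\<exists>U. openin (subtopology Z L) U \<and> z \<in> U \<and> (\<forall>y\<in>U. \<bar>h y - h z\<bar> < d)"
        using U z by (intro exI[of _ "U \<inter> L"]) (auto simp: openin_subtopology)
    qed
    then have "continuous_map Z euclideanreal h" using kR by (auto simp: kR_space_def)
    moreover have "h z0 = 0" using False by (simp add: h_def)
    \<comment> \<open>Below 1 the truncation has no effect, so a value of \<open>h\<close> less than
      \<open>min 1 e\<close> bounds the differences themselves.\<close>
    moreover have "min 1 e > 0" using e by simp
    ultimately obtain U where U: "openin Z U" "z0 \<in> U" "\<forall>y\<in>U. \<bar>h y - 0\<bar> < min 1 e"
      using z0 unfolding continuous_map_real_iff by metis
    have "\<bar>g z - g z0\<bar> < e" if "z \<in> U" "g \<in> \<K>" for z g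
    proof -
      have "\<bar>h z\<bar> < min 1 e" using U(3) that(1) by simp
      with up[OF that(2), of z] show ?thesis by linarith
    qed
    with U show ?thesis by blast
  qed
  show "evenly_continuous Z \<K>"
    unfolding evenly_continuous_def continuous_map_real_iff
  proof (intro ballI allI impI)
    fix p and e :: real
    assume "p \<in> topspace (prod_topology Z (subtopology ?T \<K>))" and e: "0 < e"
    then obtain z0 f0 where p: "p = (z0, f0)" and z0: "z0 \<in> topspace Z" and f0: "f0 \<in> ?C" "f0 \<in> \<K>"
      by auto
    obtain U where U: "openin Z U" "z0 \<in> U" "\<forall>z\<in>U. \<forall>g\<in>\<K>. \<bar>g z - g z0\<bar> < e/2"
      using equi0[OF z0, of "e/2"] e by auto
    let ?V = "{g \<in> ?C. g ` {z0} \<subseteq> {y. \<bar>y - f0 z0\<bar> < e/2}} \<inter> \<K>"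
    have "open {y. \<bar>y - f0 z0\<bar> < e/2}"
      by (intro open_Collect_less continuous_intros)
    then have "openin (subtopology ?T \<K>) ?V"
      using z0 by (intro openin_subtopology_Int sub) auto
    moreover have "\<bar>g z - f0 z0\<bar> < e" if "z \<in> U" "g \<in> ?V" for z g
    proof -
      have "\<bar>g z - g z0\<bar> < e/2" "\<bar>g z0 - f0 z0\<bar> < e/2" using U that by auto
      then show ?thesis by linarith
    qed
    ultimately show "\<exists>W. openin (prod_topology Z (subtopology ?T \<K>)) W \<and>
        p \<in> W \<and> (\<forall>q\<in>W. \<bar>(case q of (z, f) \<Rightarrow> f z) - (case p of (z, f) \<Rightarrow> f z)\<bar> < e)"
      using U f0 e p by (intro exI[of _ "U \<times> ?V"]) (auto simp: openin_prod_Times_iff)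
  qed
qed

section \<open>Real k-spaces: homeomorphic copies, k-spaces, products of discrete spaces\<close>

lemma kR_space_homeomorphic:
  assumes "X homeomorphic_space Y" "kR_space X"
  shows "kR_space Y"
  unfolding kR_space_def
proof (intro allI iffI impI)
  fix f :: "'b \<Rightarrow> real"
  assume f: "\<forall>K. compactin Y K \<longrightarrow> continuous_map (subtopology Y K) euclideanreal f"
  obtain h k where hk: "continuous_map X Y h" "continuous_map Y X k" "\<And>y. y \<in> topspace Y \<Longrightarrow> h (k y) = y"
    using assms(1) by (auto simp: homeomorphic_space_def homeomorphic_maps_def)
  have "continuous_map (subtopology X K) euclideanreal (f \<circ> h)" if "compactin X K" for K
  proof (rule continuous_map_compose)
    show "continuous_map (subtopology X K) (subtopology Y (h ` K)) h"
      using hk(1) by (simp add: continuous_map_from_subtopology continuous_map_in_subtopology image_mono)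
    show "continuous_map (subtopology Y (h ` K)) euclideanreal f"
      using f image_compactin[OF that hk(1)] by blast
  qed
  then have "continuous_map X euclideanreal (f \<circ> h)" using assms(2) by (auto simp: kR_space_def)
  from continuous_map_compose[OF hk(2) this]
  show "continuous_map Y euclideanreal f"
    by (rule continuous_map_eq) (use hk(3) in auto)
qed (auto intro: continuous_map_from_subtopology)

lemma k_space_imp_kR:
  assumes "k_space X" shows "kR_space X"
  unfolding kR_space_def
proof (intro allI iffI impI)
  fix f :: "'a \<Rightarrow> real"
  assume f: "\<forall>K. compactin X K \<longrightarrow> continuous_map (subtopology X K) euclideanreal f"
  show "continuous_map X euclideanreal f"
    unfolding continuous_map_closedin
  proof (intro conjI allI impI)
    fix C :: "real set" assume C: "closedin euclideanreal C"
    have "closedin (subtopology X K) (K \<inter> {x \<in> topspace X. f x \<in> C})" if K: "compactin X K" for K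
    proof -
      have "closedin (subtopology X K) {x \<in> topspace (subtopology X K). f x \<in> C}"
        using f K C closedin_continuous_map_preimage by blast
      moreover have "{x \<in> topspace (subtopology X K). f x \<in> C} = K \<inter> {x \<in> topspace X. f x \<in> C}" by auto
      ultimately show ?thesis by simp
    qed
    moreover have "{x \<in> topspace X. f x \<in> C} \<subseteq> topspace X" by auto
    ultimately show "closedin X {x \<in> topspace X. f x \<in> C}"
      using assms[unfolded k_space_def, rule_format] by simp
  qed auto
qed (auto intro: continuous_map_from_subtopology)

text \<open>Over discrete factors a basic box shrinks to singletons in its finitely many restricted
  coordinates.\<close>

lemma openin_product_discrete:
  "openin (product_topology (\<lambda>i. discrete_topology (A i)) I) W \<longleftrightarrow>
    W \<subseteq> PiE I A \<and> (\<forall>x\<in>W. \<exists>F. finite F \<and> F \<subseteq> I \<and> (\<forall>y\<in>PiE I A. (\<forall>i\<in>F. y i = x i) \<longrightarrow> y \<in> W))"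
  (is "?L \<longleftrightarrow> ?R")
proof
  assume L: ?L
  have "\<exists>F. finite F \<and> F \<subseteq> I \<and> (\<forall>y\<in>PiE I A. (\<forall>i\<in>F. y i = x i) \<longrightarrow> y \<in> W)" if "x \<in> W" for x
  proof -
    obtain U where U: "finite {i \<in> I. U i \<noteq> A i}" "\<And>i. i \<in> I \<Longrightarrow> U i \<subseteq> A i" "x \<in> PiE I U" "PiE I U \<subseteq> W"
      using L \<open>x \<in> W\<close> unfolding openin_product_topology_alt by (auto simp: PiE_iff)
    have "y \<in> W" if y: "y \<in> PiE I A" "\<forall>i\<in>{i \<in> I. U i \<noteq> A i}. y i = x i" for y
    proof -
      have "y i \<in> U i" if "i \<in> I" for i
        using y U(3) that by (cases "U i = A i") (auto simp: PiE_iff)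
      with y(1) have "y \<in> PiE I U" by (auto simp: PiE_iff)
      with U(4) show ?thesis by blast
    qed
    with U(1) show ?thesis by (intro exI[of _ "{i \<in> I. U i \<noteq> A i}"]) auto
  qed
  then show ?R using openin_subset[OF L] by auto
next
  assume R: ?R
  show ?L
    unfolding openin_product_topology_alt
  proof
    fix x assume x: "x \<in> W"
    with R obtain F where F: "finite F" "F \<subseteq> I" "\<forall>y\<in>PiE I A. (\<forall>i\<in>F. y i = x i) \<longrightarrow> y \<in> W" by blast
    have xA: "x \<in> PiE I A" using x R by blast
    let ?U = "\<lambda>i. if i \<in> F then {x i} else A i"
    have "{i \<in> I. ?U i \<noteq> topspace (discrete_topology (A i))} \<subseteq> F" by auto
    then have "finite {i \<in> I. ?U i \<noteq> topspace (discrete_topology (A i))}" using F(1) finite_subset by blast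
    moreover have "PiE I ?U \<subseteq> W"
    proof
      fix y assume y: "y \<in> PiE I ?U"
      have "y i \<in> A i" if "i \<in> I" for i using y that xA by (auto simp: PiE_iff split: if_splits)
      then have "y \<in> PiE I A" using y by (auto simp: PiE_iff)
      moreover have "\<forall>i\<in>F. y i = x i" using y F(2) by (force simp: PiE_iff)
      ultimately show "y \<in> W" using F(3) by blast
    qed
    moreover have "x \<in> PiE I ?U" using xA by (auto simp: PiE_iff)
    moreover have "\<forall>i\<in>I. openin (discrete_topology (A i)) (?U i)" using xA by (auto simp: PiE_iff)
    ultimately show "\<exists>U. finite {i \<in> I. U i \<noteq> topspace (discrete_topology (A i))} \<and>
        (\<forall>i\<in>I. openin (discrete_topology (A i)) (U i)) \<and> x \<in> PiE I U \<and> PiE I U \<subseteq> W"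
      by (intro exI[of _ ?U]) blast
  qed
qed

text \<open>If continuity fails at \<open>x\<close>, then \<open>f\<close> stays away from \<open>f x\<close> at points differing from \<open>x\<close>
  on pairwise disjoint finite sets of coordinates. Such points all lie in one product of sets
  with at most two elements, which is compact.\<close>

lemma kR_space_product_discrete:
  "kR_space (product_topology (\<lambda>i. discrete_topology (A i)) I)" (is "kR_space ?P")
  unfolding kR_space_def
proof (intro allI iffI impI)
  fix f :: "('a \<Rightarrow> 'b) \<Rightarrow> real"
  assume f: "\<forall>K. compactin ?P K \<longrightarrow> continuous_map (subtopology ?P K) euclideanreal f"
  \<comment> \<open>A product of finite subsets of the factors is compact, so continuity of
    \<open>f\<close> is available on it.\<close>
  have box: "\<exists>E. finite E \<and> E \<subseteq> I \<and> (\<forall>y\<in>PiE I D. (\<forall>i\<in>E. y i = x i) \<longrightarrow> \<bar>f y - f x\<bar> < e)"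
    if D: "\<And>i. i \<in> I \<Longrightarrow> finite (D i) \<and> D i \<subseteq> A i" and x: "x \<in> PiE I D" and e: "e > 0" for D x e
  proof -
    have "compactin ?P (PiE I D)"
      using D by (auto simp: compactin_PiE compactin_discrete_topology)
    then have c: "continuous_map (subtopology ?P (PiE I D)) euclideanreal f" using f by blast
    have DA: "PiE I D \<subseteq> PiE I A" using D by (intro PiE_mono) auto
    then have "x \<in> topspace (subtopology ?P (PiE I D))" using x by auto
    then obtain U where U: "openin (subtopology ?P (PiE I D)) U" "x \<in> U" "\<forall>y\<in>U. \<bar>f y - f x\<bar> < e"
      using c e unfolding continuous_map_real_iff by meson
    then obtain W where W: "openin ?P W" "U = W \<inter> PiE I D" by (auto simp: openin_subtopology)
    have "x \<in> W" using U(2) W(2) by simp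
    with W(1) obtain F where F: "finite F" "F \<subseteq> I" "\<forall>y\<in>PiE I A. (\<forall>i\<in>F. y i = x i) \<longrightarrow> y \<in> W"
      unfolding openin_product_discrete by meson
    have "\<bar>f y - f x\<bar> < e" if y: "y \<in> PiE I D" "\<forall>i\<in>F. y i = x i" for y
    proof -
      have "y \<in> PiE I A" using y(1) DA by (rule subsetD[rotated])
      then have "y \<in> W" using F(3) y(2) by simp
      then show ?thesis using U(3) W(2) y(1) by simp
    qed
    with F(1,2) show ?thesis by meson
  qed
  have "\<exists>F. finite F \<and> F \<subseteq> I \<and> (\<forall>y\<in>PiE I A. (\<forall>i\<in>F. y i = x i) \<longrightarrow> \<bar>f y - f x\<bar> < e)"
    if x: "x \<in> PiE I A" and e: "e > 0" for x e
  proof (rule ccontr)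
    assume neg: "\<not> ?thesis"
    \<comment> \<open>The point \<open>y'\<close> takes the values of \<open>y\<close> on a finite
      set and those of \<open>x\<close> elsewhere. Inside the compact two-point product spanned by
      \<open>x\<close> and \<open>y\<close> it is close enough to \<open>y\<close> to keep half of
      the deviation \<open>e\<close>.\<close>
    have step: "\<exists>y E. y \<in> PiE I A \<and> finite E \<and> E \<subseteq> I \<and> F \<subseteq> E \<and> \<bar>f y - f x\<bar> \<ge> e/2 \<and>
        (\<forall>i\<in>F. y i = x i) \<and> (\<forall>i\<in>I - E. y i = x i)" if F: "finite F" "F \<subseteq> I" for F
    proof -
      obtain y where y: "y \<in> PiE I A" "\<forall>i\<in>F. y i = x i" "\<bar>f y - f x\<bar> \<ge> e"
        using neg F by (meson not_less)
      obtain E where E: "finite E" "E \<subseteq> I"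
        "\<forall>y'\<in>PiE I (\<lambda>i. {x i, y i}). (\<forall>i\<in>E. y' i = y i) \<longrightarrow> \<bar>f y' - f y\<bar> < e/2"
        using box[of "\<lambda>i. {x i, y i}" y "e/2"] x y e by (auto simp: PiE_iff)
      define y' where "y' = (\<lambda>i\<in>I. if i \<in> E then y i else x i)"
      have "y' \<in> PiE I (\<lambda>i. {x i, y i})" by (auto simp: y'_def)
      moreover have "\<forall>i\<in>E. y' i = y i" using E by (auto simp: y'_def)
      ultimately have "\<bar>f y' - f y\<bar> < e/2" using E(3) by blast
      with y(3) have "\<bar>f y' - f x\<bar> \<ge> e/2" by linarith
      moreover have "y' \<in> PiE I A" using x y by (auto simp: y'_def PiE_iff)
      ultimately show ?thesis using F E y(2)
        by (intro exI[of _ y'] exI[of _ "E \<union> F"]) (auto simp: y'_def subset_iff)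
    qed
    \<comment> \<open>A state is a deviating point together with a finite set outside which it
      equals \<open>x\<close>. Its successor equals \<open>x\<close> on that set, so the sets where
      the points differ from \<open>x\<close> are pairwise disjoint.\<close>
    define P where "P s \<longleftrightarrow> fst s \<in> PiE I A \<and> finite (snd s) \<and> snd s \<subseteq> I \<and> \<bar>f (fst s) - f x\<bar> \<ge> e/2 \<and>
         (\<forall>i\<in>I - snd s. fst s i = x i)" for s
    define Q where "Q s t \<longleftrightarrow> snd s \<subseteq> snd t \<and> (\<forall>i\<in>snd s. fst t i = x i)"
      for s t :: "('a \<Rightarrow> 'b) \<times> 'a set"
    have ex: "\<exists>t. P t \<and> snd s \<subseteq> snd t \<and> (\<forall>i\<in>snd s. fst t i = x i)"
      if sfin: "finite (snd s)" "snd s \<subseteq> I" for s :: "('a \<Rightarrow> 'b) \<times> 'a set"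
    proof -
      obtain y E where "y \<in> PiE I A \<and> finite E \<and> E \<subseteq> I \<and> snd s \<subseteq> E \<and> \<bar>f y - f x\<bar> \<ge> e/2 \<and>
        (\<forall>i\<in>snd s. y i = x i) \<and> (\<forall>i\<in>I - E. y i = x i)" using step[OF sfin] by meson
      then have "P (y, E) \<and> snd s \<subseteq> snd (y, E) \<and> (\<forall>i\<in>snd s. fst (y, E) i = x i)"
        unfolding P_def fst_conv snd_conv by meson
      then show ?thesis by (rule exI)
    qed
    have "\<exists>s. \<forall>n. P (s n) \<and> Q (s n) (s (Suc n))"
    proof (rule dependent_nat_choice[of "\<lambda>_. P" "\<lambda>_. Q"])
      \<comment> \<open>The pair \<open>(x, {})\<close> is not a state, as \<open>f x\<close> does
        not deviate from itself, but \<open>ex\<close> asks only for a finite second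
        component.\<close>
      show "\<exists>s. P s" using ex[of "(x, {})"] by auto
      show "\<exists>t. P t \<and> Q s t" if "P s" for s and n :: nat
        using ex[of s] that by (simp add: P_def Q_def)
    qed
    then obtain s where PQ: "\<And>n. P (s n)" "\<And>n. Q (s n) (s (Suc n))" by blast
    have s: "\<And>n. fst (s n) \<in> PiE I A" "\<And>n. snd (s n) \<subseteq> I"
      "\<And>n. \<bar>f (fst (s n)) - f x\<bar> \<ge> e/2" "\<And>n i. i \<in> I - snd (s n) \<Longrightarrow> fst (s n) i = x i"
      "\<And>n. snd (s n) \<subseteq> snd (s (Suc n))" "\<And>n i. i \<in> snd (s n) \<Longrightarrow> fst (s (Suc n)) i = x i"
      using PQ unfolding P_def Q_def by simp_all
    define y where "y n = fst (s n)" for n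
    have mono: "snd (s m) \<subseteq> snd (s n)" if "m \<le> n" for m n
      using that
    proof (induction rule: dec_induct)
      case (step k)
      then show ?case using s(5)[of k] by simp
    qed simp
    have lt: "y n i = x i" if mn: "m < n" and i: "i \<in> I" "y m i \<noteq> x i" for m n i
    proof -
      obtain k where k: "n = Suc k" "m \<le> k" using mn by (cases n) auto
      have "i \<in> snd (s m)" using s(4)[of i m] i by (auto simp: y_def)
      then show ?thesis using mono[OF k(2)] s(6)[of i k] k(1) by (auto simp: y_def)
    qed
    have disj: "m = n" if "i \<in> I" "y m i \<noteq> x i" "y n i \<noteq> x i" for m n i
      using lt[of m n i] lt[of n m i] that by (metis nat_neq_iff)
    define D where "D i = insert (x i) (range (\<lambda>n. y n i))" for i
    have Dfin: "finite (D i) \<and> D i \<subseteq> A i" if i: "i \<in> I" for i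
    proof
      show "D i \<subseteq> A i" using s(1) x i by (auto simp: D_def y_def PiE_iff)
      show "finite (D i)"
      proof (cases "\<exists>m. y m i \<noteq> x i")
        case True
        then obtain m where "y m i \<noteq> x i" by blast
        with disj[OF i] have "D i \<subseteq> {x i, y m i}" by (auto simp: D_def)
        then show ?thesis using finite_subset by blast
      qed (auto simp: D_def)
    qed
    have "x \<in> PiE I D" using x by (auto simp: D_def PiE_iff)
    then obtain E where E: "finite E" "E \<subseteq> I" "\<forall>y\<in>PiE I D. (\<forall>i\<in>E. y i = x i) \<longrightarrow> \<bar>f y - f x\<bar> < e/2"
      using box[of D x "e/2"] Dfin e by auto
    \<comment> \<open>Each coordinate in \<open>E\<close> spoils at most one index, so some
      \<open>y n\<close> equals \<open>x\<close> on all of \<open>E\<close>.\<close>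
    have "finite {n. y n i \<noteq> x i}" if "i \<in> E" for i
    proof -
      have "{n. y n i \<noteq> x i} = {} \<or> (\<exists>m. {n. y n i \<noteq> x i} = {m})"
        using disj[of i] that E(2) by blast
      then show ?thesis by auto
    qed
    then have "finite (\<Union>i\<in>E. {n. y n i \<noteq> x i})" using E(1) by blast
    then obtain n where "n \<notin> (\<Union>i\<in>E. {n. y n i \<noteq> x i})" using ex_new_if_finite infinite_UNIV_nat by blast
    moreover have "y n \<in> PiE I D" using s(1)[of n] by (auto simp: D_def PiE_iff y_def)
    ultimately have "\<bar>f (y n) - f x\<bar> < e/2" using E(3) by blast
    with s(3)[of n] show False by (simp add: y_def)
  qed
  note fin = this
  show "continuous_map ?P euclideanreal f"
    unfolding continuous_map_real_iff
  proof (intro ballI allI impI)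
    fix x and e :: real assume "x \<in> topspace ?P" and e: "0 < e"
    then have x: "x \<in> PiE I A" by simp
    obtain F where F: "finite F" "F \<subseteq> I" "\<forall>y\<in>PiE I A. (\<forall>i\<in>F. y i = x i) \<longrightarrow> \<bar>f y - f x\<bar> < e"
      using fin[OF x e] by blast
    have "openin ?P {y \<in> PiE I A. \<forall>i\<in>F. y i = x i}"
      unfolding openin_product_discrete
    proof (intro conjI ballI)
      fix z assume z: "z \<in> {y \<in> PiE I A. \<forall>i\<in>F. y i = x i}"
      then have "\<forall>y\<in>PiE I A. (\<forall>i\<in>F. y i = z i) \<longrightarrow> y \<in> {y \<in> PiE I A. \<forall>i\<in>F. y i = x i}" by simp
      with F show "\<exists>G. finite G \<and> G \<subseteq> I \<and>
        (\<forall>y\<in>PiE I A. (\<forall>i\<in>G. y i = z i) \<longrightarrow> y \<in> {y \<in> PiE I A. \<forall>i\<in>F. y i = x i})"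
        by (intro exI[of _ F] conjI)
    qed auto
    moreover have "x \<in> {y \<in> PiE I A. \<forall>i\<in>F. y i = x i}" using x by simp
    moreover have "\<forall>y\<in>{y \<in> PiE I A. \<forall>i\<in>F. y i = x i}. \<bar>f y - f x\<bar> < e" using F(3) by simp
    ultimately show "\<exists>U. openin ?P U \<and> x \<in> U \<and> (\<forall>y\<in>U. \<bar>f y - f x\<bar> < e)"
      by (intro exI[of _ "{y \<in> PiE I A. \<forall>i\<in>F. y i = x i}"] conjI)
  qed
qed (auto intro: continuous_map_from_subtopology)

section \<open>Failure of the Ascoli property\<close>

text \<open>The indicators of the sets \<open>U i\<close> together with 0 form a compact set of functions, which is
  not evenly continuous at \<open>(z, 0)\<close>.\<close>

lemma not_Ascoli_criterion:
  assumes clopen: "\<And>i. i \<in> J \<Longrightarrow> openin Z (U i) \<and> closedin Z (U i)"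
    and a: "\<And>i. i \<in> J \<Longrightarrow> a i \<in> U i"
    and cfin: "\<And>C. compactin Z C \<Longrightarrow> finite {i \<in> J. U i \<inter> C \<noteq> {}}"
    and z: "z \<in> topspace Z"
    and cluster: "\<And>V F. openin Z V \<Longrightarrow> z \<in> V \<Longrightarrow> finite F \<Longrightarrow> \<exists>i\<in>J - F. a i \<in> V"
  shows "\<not> Ascoli_space Z"
proof
  assume Asc: "Ascoli_space Z"
  let ?T = "compact_open_topology Z euclideanreal"
  let ?C = "continuous_functions Z euclideanreal"
  define o' :: "'b \<Rightarrow> real" where "o' = (\<lambda>x\<in>topspace Z. 0)"
  define \<phi> :: "'a \<Rightarrow> 'b \<Rightarrow> real" where "\<phi> i = (\<lambda>x\<in>topspace Z. of_bool (x \<in> U i))" for i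
  have o': "o' \<in> ?C"
  proof -
    have "continuous_map Z euclideanreal (\<lambda>x. 0)" by simp
    then have "continuous_map Z euclideanreal o'" by (rule continuous_map_eq) (simp add: o'_def)
    then show ?thesis by (simp add: continuous_functions_def o'_def)
  qed
  have \<phi>: "\<phi> i \<in> ?C" if i: "i \<in> J" for i
  proof -
    have "continuous_map Z euclideanreal (\<phi> i)"
      unfolding continuous_map_real_iff
    proof (intro ballI allI impI)
      fix x and e :: real assume x: "x \<in> topspace Z" and e: "0 < e"
      show "\<exists>V. openin Z V \<and> x \<in> V \<and> (\<forall>y\<in>V. \<bar>\<phi> i y - \<phi> i x\<bar> < e)"
      proof (cases "x \<in> U i")
        case True
        then show ?thesis using clopen[OF i] x e openin_subset[of Z "U i"]
          by (intro exI[of _ "U i"]) (auto simp: \<phi>_def)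
      next
        case False
        then show ?thesis using clopen[OF i] x e
          by (intro exI[of _ "topspace Z - U i"]) (auto simp: \<phi>_def closedin_def)
      qed
    qed
    then show ?thesis by (simp add: continuous_functions_def \<phi>_def)
  qed
  \<comment> \<open>A subbasic set given by \<open>K\<close> can exclude \<open>\<phi> i\<close>
    only if \<open>U i\<close> meets \<open>K\<close>. Hence every neighbourhood of
    \<open>o'\<close> contains all but finitely many \<open>\<phi> i\<close>, which makes
    \<open>\<K>\<close> compact.\<close>
  have cof: "finite {i \<in> J. \<phi> i \<notin> O'}" if O': "openin ?T O'" and 0: "o' \<in> O'" for O'
  proof -
    have "generate_topology_on {{f \<in> ?C. f ` K \<subseteq> V} | K V. compactin Z K \<and> openin euclideanreal V} O'"
      using O' by (simp add: compact_open_topology_def openin_topology_generated_by)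
    then show ?thesis using 0
    proof induction
      case (Int p q)
      then have "finite ({i \<in> J. \<phi> i \<notin> p} \<union> {i \<in> J. \<phi> i \<notin> q})" by simp
      then show ?case by (rule rev_finite_subset) auto
    next
      case (UN \<K>)
      then obtain k where "k \<in> \<K>" "o' \<in> k" by blast
      with UN have "finite {i \<in> J. \<phi> i \<notin> k}" by blast
      then show ?case by (rule rev_finite_subset) (use \<open>k \<in> \<K>\<close> in auto)
    next
      case (Basis s)
      then obtain K V where s: "s = {f \<in> ?C. f ` K \<subseteq> V}" and K: "compactin Z K" by blast
      have "\<phi> i \<in> s" if i: "i \<in> J" "U i \<inter> K = {}" for i
      proof -
        have "\<phi> i x = o' x" if "x \<in> K" for x
          using i(2) that compactin_subset_topspace[OF K] by (auto simp: \<phi>_def o'_def)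
        then have "\<phi> i ` K = o' ` K" by simp
        then show ?thesis using Basis.prems \<phi>[OF i(1)] unfolding s by simp
      qed
      then have "{i \<in> J. \<phi> i \<notin> s} \<subseteq> {i \<in> J. U i \<inter> K \<noteq> {}}" by blast
      then show ?case using cfin[OF K] finite_subset by blast
    qed auto
  qed
  define \<K> where "\<K> = insert o' (\<phi> ` J)"
  have "compactin ?T \<K>"
    unfolding compactin_def
  proof (intro conjI allI impI)
    show "\<K> \<subseteq> topspace ?T" using o' \<phi> by (auto simp: \<K>_def)
    fix \<U> assume \<U>: "(\<forall>U\<in>\<U>. openin ?T U) \<and> \<K> \<subseteq> \<Union>\<U>"
    then obtain O' where O': "O' \<in> \<U>" "o' \<in> O'" by (auto simp: \<K>_def)
    have fin: "finite (\<phi> ` {i \<in> J. \<phi> i \<notin> O'})" using cof O' \<U> by blast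
    have "\<phi> ` {i \<in> J. \<phi> i \<notin> O'} \<subseteq> \<Union>\<U>" using \<U> by (auto simp: \<K>_def)
    with fin obtain \<F> where \<F>: "finite \<F>" "\<F> \<subseteq> \<U>" "\<phi> ` {i \<in> J. \<phi> i \<notin> O'} \<subseteq> \<Union>\<F>"
      using finite_subset_Union by meson
    have "\<K> \<subseteq> \<Union>(insert O' \<F>)"
    proof
      fix g assume "g \<in> \<K>"
      then show "g \<in> \<Union>(insert O' \<F>)"
        using O'(2) \<F>(3) by (auto simp: \<K>_def)
    qed
    with \<F> O'(1) show "\<exists>\<F>. finite \<F> \<and> \<F> \<subseteq> \<U> \<and> \<K> \<subseteq> \<Union>\<F>"
      by (intro exI[of _ "insert O' \<F>"]) simp
  qed
  then have "evenly_continuous Z \<K>" using Asc by (simp add: Ascoli_space_def)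
  then have c: "continuous_map (prod_topology Z (subtopology ?T \<K>)) euclideanreal (\<lambda>(z, f). f z)"
    by (simp add: evenly_continuous_def)
  have "(z, o') \<in> topspace (prod_topology Z (subtopology ?T \<K>))"
    using z o' by (simp add: \<K>_def)
  then have "\<exists>W. openin (prod_topology Z (subtopology ?T \<K>)) W \<and> (z, o') \<in> W \<and>
      (\<forall>q\<in>W. \<bar>(case q of (z, f) \<Rightarrow> f z) - (case (z, o') of (z, f) \<Rightarrow> f z)\<bar> < 1)"
    using c[unfolded continuous_map_real_iff, rule_format, of "(z, o')" 1] by simp
  then obtain W where W: "openin (prod_topology Z (subtopology ?T \<K>)) W" "(z, o') \<in> W"
    "\<forall>q\<in>W. \<bar>(case q of (z, f) \<Rightarrow> f z) - o' z\<bar> < 1" by auto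
  obtain V O1 where V: "openin Z V" "openin (subtopology ?T \<K>) O1" "z \<in> V" "o' \<in> O1" "V \<times> O1 \<subseteq> W"
    using W(1,2) unfolding openin_prod_topology_alt by meson
  obtain O' where O': "openin ?T O'" "O1 = O' \<inter> \<K>" using V(2) by (auto simp: openin_subtopology)
  have "finite {i \<in> J. \<phi> i \<notin> O'}" using cof O' V(4) by blast
  \<comment> \<open>Evaluation is 1 at \<open>(a i, \<phi> i)\<close>, a point of the neighbourhood
    \<open>W\<close> on which it should stay within distance 1 of the value 0 at
    \<open>(z, o')\<close>.\<close>
  then obtain i where i: "i \<in> J" "\<phi> i \<in> O'" "a i \<in> V"
    using cluster[OF V(1,3), of "{i \<in> J. \<phi> i \<notin> O'}"] by blast
  have "(a i, \<phi> i) \<in> W" using V(5) O'(2) i by (auto simp: \<K>_def)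
  with W(3) have "\<bar>\<phi> i (a i) - o' z\<bar> < 1" by force
  moreover have "\<phi> i (a i) = 1" "o' z = 0"
    using i a[OF i(1)] z V(1) openin_subset by (auto simp: \<phi>_def o'_def)
  ultimately show False by simp
qed

section \<open>Clopen neighbourhoods and sequences for the metric obstruction\<close>

lemma zero_dimensional_nbhd:
  assumes "zero_dimensional_space X" "openin X U" "x \<in> U"
  shows "\<exists>B. openin X B \<and> closedin X B \<and> x \<in> B \<and> B \<subseteq> U"
proof -
  obtain \<B> where \<B>: "\<forall>U\<in>\<B>. openin X U \<and> closedin X U" "openin X = arbitrary union_of (\<lambda>U. U \<in> \<B>)"
    using assms(1) by (auto simp: zero_dimensional_space_def)
  have "(arbitrary union_of (\<lambda>U. U \<in> \<B>)) U" using assms(2) \<B>(2) by simp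
  then obtain B where "B \<in> \<B>" "x \<in> B" "B \<subseteq> U"
    unfolding arbitrary_union_of_alt using assms(3) by meson
  with \<B>(1) show ?thesis by (intro exI[of _ B]) simp
qed

text \<open>Each single function is eventually constant along \<open>y\<close> by local constancy at
  \<open>l\<close>. The sets \<open>V N\<close> are open because a tail with its limit is compact,
  and they increase with \<open>N\<close>, so compactness of \<open>C\<close> yields one bound for
  all functions.\<close>

lemma compact_Ck2_eventually_constant:
  assumes lim: "limitin X y l sequentially" and y: "range y \<subseteq> topspace X"
    and C: "compactin (Ck2_topology X) C"
  shows "\<exists>N. \<forall>f\<in>C. \<forall>k\<ge>N. f (y k) = f l"
proof -
  define V where "V N = {f \<in> CF2 X. \<forall>k\<ge>N. f (y k) = f l}" for N :: nat
  have opn: "openin (Ck2_topology X) (V N)" for N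
    unfolding openin_Ck2
  proof (intro conjI ballI)
    fix f assume f: "f \<in> V N"
    have "compactin X (insert l (y ` {N..}))"
      by (rule compactin_sequence_with_limit[OF lim]) (use y in auto)
    moreover have "agree X f (insert l (y ` {N..})) \<subseteq> V N"
      using f by (auto simp: agree_def V_def)
    ultimately show "\<exists>K. compactin X K \<and> agree X f K \<subseteq> V N" by blast
  qed (auto simp: V_def)
  have "C \<subseteq> \<Union>(range V)"
  proof
    fix f assume "f \<in> C"
    then have f: "f \<in> CF2 X" using compactin_subset_topspace[OF C] by auto
    have l: "l \<in> topspace X" using lim by (rule limitin_topspace)
    obtain U where U: "openin X U" "l \<in> U" "U \<subseteq> {x. f x = f l}"
      using CF2_local[OF f l] by blast
    then have "eventually (\<lambda>k. y k \<in> U) sequentially" using lim by (simp add: limitin_def)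
    then obtain N where "\<forall>k\<ge>N. y k \<in> U" by (auto simp: eventually_sequentially)
    then have "f \<in> V N" using U f by (auto simp: V_def)
    then show "f \<in> \<Union>(range V)" by blast
  qed
  then obtain \<F> where \<F>: "finite \<F>" "\<F> \<subseteq> range V" "C \<subseteq> \<Union>\<F>"
    using compactinD[OF C, of "range V"] opn by blast
  then obtain F where F: "finite F" "C \<subseteq> \<Union>(V ` F)"
    by (metis finite_subset_image)
  \<comment> \<open>If \<open>F\<close> is empty then so is \<open>C\<close>, and the unspecified
    value of \<open>Max {}\<close> does no harm.\<close>
  have "f (y k) = f l" if fC: "f \<in> C" and k: "k \<ge> Max F" for f k
  proof -
    obtain N where N: "N \<in> F" "f \<in> V N" using F fC by blast
    then have "N \<le> k" using Max_ge[OF F(1) N(1)] k by linarith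
    then show ?thesis using N(2) by (simp add: V_def)
  qed
  then show ?thesis by blast
qed

context Metric_space
begin

text \<open>Infinitely many hits would give points of \<open>C\<close> whose distances to the
  \<open>s k\<close> tend to 0. A convergent subsequence of these points would force a subsequence
  of \<open>s\<close> to converge.\<close>

lemma mball_hits_finite:
  assumes s: "range s \<subseteq> M" "\<And>l r. strict_mono r \<Longrightarrow> \<not> limitin mtopology (s \<circ> r) l sequentially"
    and C: "compactin mtopology C"
  shows "finite {k. mball (s k) (inverse (real (Suc k))) \<inter> C \<noteq> {}}"
proof (rule ccontr)
  assume "infinite {k. mball (s k) (inverse (real (Suc k))) \<inter> C \<noteq> {}}"
  from infinite_enumerate[OF this] obtain r :: "nat \<Rightarrow> nat" where r: "strict_mono r"
    "\<And>n. mball (s (r n)) (inverse (real (Suc (r n)))) \<inter> C \<noteq> {}"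
    by (simp only: mem_Collect_eq) meson
  then have "\<forall>n. \<exists>c. c \<in> mball (s (r n)) (inverse (real (Suc (r n)))) \<inter> C" by blast
  then obtain c where c: "\<And>n. c n \<in> mball (s (r n)) (inverse (real (Suc (r n))))" "\<And>n. c n \<in> C"
    by (metis IntD1 IntD2)
  then have "range c \<subseteq> C" by blast
  then obtain l q where lq: "l \<in> C" "strict_mono q" "limitin mtopology (c \<circ> q) l sequentially"
    using C unfolding compactin_sequentially by meson
  have "limitin mtopology (s \<circ> (r \<circ> q)) l sequentially"
    unfolding limit_metric_sequentially
  proof (intro conjI allI impI)
    show l: "l \<in> M" using lq(3) limitin_mspace by blast
    fix e :: real assume e: "0 < e"
    then obtain N1 where N1: "\<forall>n\<ge>N1. (c \<circ> q) n \<in> M \<and> d ((c \<circ> q) n) l < e/2"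
      using lq(3) unfolding limit_metric_sequentially by (meson half_gt_zero)
    obtain N2 where N2: "inverse (real (Suc N2)) < e/2" using reals_Archimedean[of "e/2"] e by auto
    show "\<exists>N. \<forall>n\<ge>N. (s \<circ> (r \<circ> q)) n \<in> M \<and> d ((s \<circ> (r \<circ> q)) n) l < e"
    proof (intro exI[of _ "max N1 N2"] allI impI)
      fix n assume n: "n \<ge> max N1 N2"
      have "n \<le> r (q n)"
        using seq_suble[OF r(1), of "q n"] seq_suble[OF lq(2), of n] by linarith
      then have "inverse (real (Suc (r (q n)))) \<le> inverse (real (Suc N2))"
        using n by (intro le_imp_inverse_le) auto
      moreover have "d (s (r (q n))) (c (q n)) < inverse (real (Suc (r (q n))))"
        using c(1)[of "q n"] by simp
      moreover have "d (c (q n)) l < e/2" using N1 n unfolding o_def by (meson max.boundedE)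
      moreover have "s (r (q n)) \<in> M" "c (q n) \<in> M"
        using s(1) c(1)[of "q n"] by auto
      ultimately have "s (r (q n)) \<in> M \<and> d (s (r (q n))) l < e"
        using N2 triangle[of "s (r (q n))" "c (q n)" l] l by linarith
      then show "(s \<circ> (r \<circ> q)) n \<in> M \<and> d ((s \<circ> (r \<circ> q)) n) l < e" by simp
    qed
  qed
  moreover have "strict_mono (r \<circ> q)" using r(1) lq(2) by (simp add: strict_mono_o)
  ultimately show False using s(2) by blast
qed

text \<open>The finite set \<open>E \<inter> M\<close> is compact, so by
  \<open>mball_hits_finite\<close> the sequence meets it only finitely often and a shift of the
  index avoids it.\<close>

lemma noncompact_sequence:
  assumes S: "closedin mtopology S" "\<not> compactin mtopology S" and E: "finite E"
  obtains s :: "nat \<Rightarrow> 'a" where "range s \<subseteq> S - E"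
    "\<And>l r. strict_mono r \<Longrightarrow> \<not> limitin mtopology (s \<circ> r) l sequentially"
proof -
  have SM: "S \<subseteq> M" using closedin_subset[OF S(1)] by simp
  then obtain s :: "nat \<Rightarrow> 'a" where s: "range s \<subseteq> S"
    "\<not> (\<exists>l r. l \<in> S \<and> strict_mono r \<and> limitin mtopology (s \<circ> r) l sequentially)"
    using S(2) unfolding compactin_sequentially by meson
  have no: "\<not> limitin mtopology (s \<circ> r) l sequentially" if r: "strict_mono r" for l r
  proof
    assume L: "limitin mtopology (s \<circ> r) l sequentially"
    then have "l \<in> S"
      by (rule limitin_closedin[OF _ S(1)]) (use s(1) in \<open>auto intro: always_eventually\<close>)
    then show False using s(2) L r by blast
  qed
  have "finite {k. mball (s k) (inverse (real (Suc k))) \<inter> (E \<inter> M) \<noteq> {}}"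
    by (rule mball_hits_finite) (use s(1) SM no E in \<open>auto intro: finite_imp_compactin\<close>)
  moreover have "{k. s k \<in> E} \<subseteq> {k. mball (s k) (inverse (real (Suc k))) \<inter> (E \<inter> M) \<noteq> {}}"
  proof
    fix k assume k: "k \<in> {k. s k \<in> E}"
    have "s k \<in> M" using s(1) SM by auto
    then have "s k \<in> mball (s k) (inverse (real (Suc k))) \<inter> (E \<inter> M)" using k by simp
    then show "k \<in> {k. mball (s k) (inverse (real (Suc k))) \<inter> (E \<inter> M) \<noteq> {}}" by blast
  qed
  ultimately have "finite {k. s k \<in> E}" by (rule rev_finite_subset)
  then obtain N where N: "\<forall>k\<in>{k. s k \<in> E}. k < N" using finite_nat_set_iff_bounded by blast
  show thesis
  proof (rule that[of "\<lambda>k. s (k + N)"])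
    show "range (\<lambda>k. s (k + N)) \<subseteq> S - E" using N s(1) by force
    fix l and r :: "nat \<Rightarrow> nat" assume r: "strict_mono r"
    then have "strict_mono (\<lambda>k. r k + N)" by (simp add: strict_mono_def)
    from no[OF this, of l] show "\<not> limitin mtopology ((\<lambda>k. s (k + N)) \<circ> r) l sequentially"
      by (simp add: o_def)
  qed
qed

lemma limitin_inverse_bound:
  assumes "l \<in> M" "\<And>n. y n \<in> M" "\<And>n. d (y n) l \<le> inverse (real (Suc n))"
  shows "limitin mtopology y l sequentially"
  unfolding limit_metric_sequentially
proof (intro conjI assms(1) allI impI)
  fix e :: real assume "0 < e"
  then obtain N where N: "inverse (real (Suc N)) < e" using reals_Archimedean by blast
  have "d (y n) l < e" if "n \<ge> N" for n
  proof -
    have "inverse (real (Suc n)) \<le> inverse (real (Suc N))"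
      using that by (intro le_imp_inverse_le) auto
    with N assms(3)[of n] show ?thesis by linarith
  qed
  then show "\<exists>N. \<forall>n\<ge>N. y n \<in> M \<and> d (y n) l < e" using assms(2) by blast
qed

text \<open>The obstruction combines sequences \<open>y n k \<longlonglongrightarrow> z n\<close> at non-isolated points \<open>z n\<close> without cluster point
  and a metric fan \<open>x n k\<close> at the point \<open>x0\<close> without compact neighbourhood. A compact set of functions
  is eventually constant along convergent sequences, which bounds \<open>k\<close> for each \<open>n\<close> by means of \<open>y n\<close>
  and bounds \<open>n\<close> by means of \<open>x n (k n) \<longlonglongrightarrow> x0\<close>.\<close>

lemma not_Ascoli_Ck2:
  assumes zd: "zero_dimensional_space mtopology"
    and nlc: "\<not> locally_compact_space mtopology"
    and nc: "\<not> compactin mtopology (derived_space_set mtopology)"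
  shows "\<not> Ascoli_space (Ck2_topology mtopology)"
proof -
  let ?X = mtopology
  let ?r = "\<lambda>n. inverse (real (Suc n))"
  obtain x0 where x0: "x0 \<in> M" and bad: "\<And>U K. openin ?X U \<Longrightarrow> compactin ?X K \<Longrightarrow> x0 \<in> U \<Longrightarrow> \<not> U \<subseteq> K"
    using nlc unfolding locally_compact_space_def by auto
  have "closedin ?X (derived_space_set ?X)"
    by (intro closedin_derived_set_of_gen Hausdorff_imp_t1_space Hausdorff_space_mtopology)
  then obtain z :: "nat \<Rightarrow> 'a" where z: "range z \<subseteq> derived_space_set ?X - {}"
    and zno: "\<And>l r. strict_mono r \<Longrightarrow> \<not> limitin ?X (z \<circ> r) l sequentially"
    using noncompact_sequence[OF _ nc, of "{}"] by blast
  have zM: "z n \<in> M" for n using z derived_set_of_subset_topspace[of ?X M] by auto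
  \<comment> \<open>Avoiding \<open>x0\<close> and \<open>z n\<close> leaves room for a clopen
    neighbourhood of \<open>x n k\<close> that misses both. The balls are closed because
    \<open>noncompact_sequence\<close> asks for a closed set.\<close>
  have "\<exists>s :: nat \<Rightarrow> 'a. range s \<subseteq> mcball x0 (?r n) - {x0, z n} \<and>
      (\<forall>l r. strict_mono r \<longrightarrow> \<not> limitin ?X (s \<circ> r) l sequentially)" for n
  proof -
    have "\<not> compactin ?X (mcball x0 (?r n))"
      using bad[of "mball x0 (?r n)" "mcball x0 (?r n)"] x0 by (auto simp: mball_subset_mcball)
    then obtain s :: "nat \<Rightarrow> 'a" where s: "range s \<subseteq> mcball x0 (?r n) - {x0, z n}"
        "\<And>l r. strict_mono r \<Longrightarrow> \<not> limitin ?X (s \<circ> r) l sequentially"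
      using noncompact_sequence[of "mcball x0 (?r n)" "{x0, z n}"] by auto
    show ?thesis by (intro exI[of _ s] conjI allI impI s)
  qed
  then obtain x :: "nat \<Rightarrow> nat \<Rightarrow> 'a" where x: "\<And>n. range (x n) \<subseteq> mcball x0 (?r n) - {x0, z n}"
      and xno: "\<And>n l r. strict_mono r \<Longrightarrow> \<not> limitin ?X (x n \<circ> r) l sequentially"
    by meson
  have fin_cl: "closedin ?X S" if "finite S" "S \<subseteq> M" for S
    using that Hausdorff_imp_t1_space[OF Hausdorff_space_mtopology] by (simp add: t1_space_closedin_finite)
  \<comment> \<open>The radius serves twice: it tends to 0 in \<open>k\<close>, which gives
    convergence to \<open>z n\<close>, and it never exceeds \<open>?r n\<close>, which confines the
    whole sequence to a ball shrinking with \<open>n\<close>.\<close>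
  have "\<exists>y. y \<in> mball (z n) (?r (n + k)) \<and> y \<noteq> z n \<and> y \<noteq> x0" for n k
  proof -
    \<comment> \<open>Removing \<open>{x0} - {z n}\<close> leaves a neighbourhood of
      \<open>z n\<close> even if \<open>z n = x0\<close>.\<close>
    have "openin ?X (mball (z n) (?r (n + k)) - ({x0} - {z n}))"
      by (intro openin_diff openin_mball fin_cl) (use x0 in auto)
    moreover have "z n \<in> mball (z n) (?r (n + k)) - ({x0} - {z n})" using zM by simp
    moreover have "z n \<in> derived_space_set ?X" using z by auto
    ultimately obtain t where "t \<noteq> z n" "t \<in> mball (z n) (?r (n + k)) - ({x0} - {z n})"
      unfolding in_derived_set_of by meson
    then show ?thesis by (intro exI[of _ t]) auto
  qed
  then obtain y where y: "\<And>n k. y n k \<in> mball (z n) (?r (n + k))" "\<And>n k. y n k \<noteq> z n" "\<And>n k. y n k \<noteq> x0"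
    by metis
  have xk: "x n k \<in> mcball x0 (?r n)" "x n k \<noteq> x0" "x n k \<noteq> z n" for n k
    using subsetD[OF x[of n] rangeI[of "x n" k]] by auto
  have xM: "x n k \<in> M" for n k using xk(1)[of n k] by simp
  have yM: "y n k \<in> M" for n k using y(1)[of n k] by simp
  have "\<exists>P. openin ?X P \<and> closedin ?X P \<and> y n k \<in> P \<and> P \<subseteq> mball (z n) (?r n) - {x0, z n}" for n k
  proof -
    have "?r (n + k) \<le> ?r n" by (intro le_imp_inverse_le) auto
    then have "y n k \<in> mball (z n) (?r n)" using subsetD[OF mball_subset_concentric y(1)] by blast
    then have mem: "y n k \<in> mball (z n) (?r n) - {x0, z n}" using y(2,3)[of n k] by simp
    have "openin ?X (mball (z n) (?r n) - {x0, z n})"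
      by (intro openin_diff openin_mball fin_cl) (use x0 zM in auto)
    from zero_dimensional_nbhd[OF zd this mem] show ?thesis .
  qed
  then obtain P where P: "\<And>n k. openin ?X (P n k) \<and> closedin ?X (P n k) \<and> y n k \<in> P n k \<and>
      P n k \<subseteq> mball (z n) (?r n) - {x0, z n}" by meson
  have "\<exists>Q. openin ?X Q \<and> closedin ?X Q \<and> x n k \<in> Q \<and> Q \<subseteq> mball (x n k) (?r k) - {x0, z n}" for n k
  proof -
    have mem: "x n k \<in> mball (x n k) (?r k) - {x0, z n}" using xk[of n k] xM by auto
    have "openin ?X (mball (x n k) (?r k) - {x0, z n})"
      by (intro openin_diff openin_mball fin_cl) (use x0 zM in auto)
    from zero_dimensional_nbhd[OF zd this mem] show ?thesis .
  qed
  then obtain Q where Q: "\<And>n k. openin ?X (Q n k) \<and> closedin ?X (Q n k) \<and> x n k \<in> Q n k \<and>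
      Q n k \<subseteq> mball (x n k) (?r k) - {x0, z n}" by meson
  define a :: "nat \<times> nat \<Rightarrow> 'a \<Rightarrow> int" where
    "a = (\<lambda>(n, k). \<lambda>t\<in>topspace ?X. of_bool (t \<in> P n k \<union> Q n k))"
  \<comment> \<open>The four points fix the pattern 1 at \<open>y n k\<close> and
    \<open>x n k\<close>, 0 at their intended limits \<open>z n\<close> and \<open>x0\<close>. A
    compact set of functions can show it for finitely many pairs only.\<close>
  define U where "U = (\<lambda>(n, k). agree ?X (a (n, k)) {y n k, z n, x n k, x0})"
  have aC: "a p \<in> CF2 ?X" for p
  proof (cases p)
    case (Pair n k)
    have "openin ?X (P n k \<union> Q n k)" "closedin ?X (P n k \<union> Q n k)"
      using P[of n k] Q[of n k] by auto
    then show ?thesis unfolding Pair a_def prod.case by (rule indicator_in_CF2)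
  qed
  have vals: "f (y n k) = 1 \<and> f (z n) = 0 \<and> f (x n k) = 1 \<and> f x0 = 0" if "f \<in> U (n, k)" for f n k
  proof -
    have "f t = a (n, k) t" if "t \<in> {y n k, z n, x n k, x0}" for t
      using \<open>f \<in> U (n, k)\<close> that by (auto simp: U_def agree_def)
    moreover have "a (n, k) t = of_bool (t \<in> P n k \<union> Q n k)" if "t \<in> M" for t
      using that by (simp add: a_def)
    moreover have "y n k \<in> P n k \<union> Q n k" "x n k \<in> P n k \<union> Q n k" "z n \<notin> P n k \<union> Q n k" "x0 \<notin> P n k \<union> Q n k"
      using P[of n k] Q[of n k] by auto
    ultimately show ?thesis using xM[of n k] yM[of n k] zM[of n] x0 by (simp del: Un_iff)
  qed
  show ?thesis
  proof (rule not_Ascoli_criterion[where J = UNIV and U = U and a = a and z = "\<lambda>t\<in>topspace ?X. 0"])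
    fix p :: "nat \<times> nat"
    obtain n k where p: "p = (n, k)" by (cases p)
    have sub: "{y n k, z n, x n k, x0} \<subseteq> topspace ?X" using xM yM zM x0 by simp
    then have "compactin ?X {y n k, z n, x n k, x0}" by (intro finite_imp_compactin) auto
    then show "openin (Ck2_topology ?X) (U p) \<and> closedin (Ck2_topology ?X) (U p)"
      unfolding p U_def prod.case using openin_Ck2_agree[OF aC] closedin_Ck2_agree[OF sub] by blast
    show "a p \<in> U p" using aC by (simp add: p U_def agree_def)
  next
    fix C assume C: "compactin (Ck2_topology ?X) C"
    have fin2: "finite {k. U (n, k) \<inter> C \<noteq> {}}" for n
    proof -
      have "limitin ?X (y n) (z n) sequentially"
      proof (rule limitin_inverse_bound)
        fix k
        have "?r (n + k) \<le> ?r k" by (intro le_imp_inverse_le) auto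
        moreover have "d (z n) (y n k) < ?r (n + k)" using y(1)[of n k] unfolding in_mball by blast
        ultimately show "d (y n k) (z n) \<le> ?r k" unfolding commute[of "y n k"] by linarith
      qed (use yM zM in auto)
      then obtain N where N: "\<forall>f\<in>C. \<forall>k\<ge>N. f (y n k) = f (z n)"
        using compact_Ck2_eventually_constant[OF _ _ C] yM by fastforce
      have "k < N" if hit: "U (n, k) \<inter> C \<noteq> {}" for k
      proof (rule ccontr)
        assume "\<not> k < N"
        moreover obtain f where f: "f \<in> U (n, k)" "f \<in> C" using hit by blast
        ultimately have "f (y n k) = f (z n)" using N by simp
        with vals[OF f(1)] show False by linarith
      qed
      then have "{k. U (n, k) \<inter> C \<noteq> {}} \<subseteq> {..<N}" by blast
      then show ?thesis using finite_subset by blast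
    qed
    have fin1: "finite {n. \<exists>k. U (n, k) \<inter> C \<noteq> {}}"
    proof (rule ccontr)
      assume "infinite {n. \<exists>k. U (n, k) \<inter> C \<noteq> {}}"
      from infinite_enumerate[OF this] obtain r :: "nat \<Rightarrow> nat"
        where r: "strict_mono r" "\<And>n. \<exists>k. U (r n, k) \<inter> C \<noteq> {}"
        by (simp only: mem_Collect_eq) meson
      then obtain \<kappa> where \<kappa>: "\<And>n. U (r n, \<kappa> n) \<inter> C \<noteq> {}" by metis
      \<comment> \<open>The second indices are arbitrary here: the whole sequence \<open>x n\<close>
        lies within distance \<open>?r n\<close> of \<open>x0\<close>.\<close>
      have "limitin ?X (\<lambda>j. x (r j) (\<kappa> j)) x0 sequentially"
      proof (rule limitin_inverse_bound)
        fix j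
        have "?r (r j) \<le> ?r j" using seq_suble[OF r(1), of j] by (intro le_imp_inverse_le) auto
        moreover have "x (r j) (\<kappa> j) \<in> mcball x0 (?r (r j))" using xk(1) .
        ultimately show "d (x (r j) (\<kappa> j)) x0 \<le> ?r j"
          unfolding in_mcball commute[of "x (r j) (\<kappa> j)"] by linarith
      qed (use xM x0 in auto)
      then obtain N where N: "\<forall>f\<in>C. \<forall>j\<ge>N. f (x (r j) (\<kappa> j)) = f x0"
        using compact_Ck2_eventually_constant[OF _ _ C] xM by fastforce
      obtain f where f: "f \<in> U (r N, \<kappa> N)" "f \<in> C" using \<kappa>[of N] by blast
      then have "f (x (r N) (\<kappa> N)) = f x0" using N by simp
      with vals[OF f(1)] show False by linarith
    qed
    have "{p \<in> UNIV. U p \<inter> C \<noteq> {}} \<subseteq>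
        Sigma {n. \<exists>k. U (n, k) \<inter> C \<noteq> {}} (\<lambda>n. {k. U (n, k) \<inter> C \<noteq> {}})" by auto
    moreover have "finite (Sigma {n. \<exists>k. U (n, k) \<inter> C \<noteq> {}} (\<lambda>n. {k. U (n, k) \<inter> C \<noteq> {}}))"
      using fin1 fin2 by (rule finite_SigmaI)
    ultimately show "finite {p \<in> UNIV. U p \<inter> C \<noteq> {}}" by (rule finite_subset)
  next
    have "(\<lambda>t\<in>topspace ?X. of_bool (t \<in> {})) \<in> CF2 ?X" by (rule indicator_in_CF2) auto
    then show "(\<lambda>t\<in>topspace ?X. 0) \<in> topspace (Ck2_topology ?X)" by simp
  next
    fix V and F :: "(nat \<times> nat) set"
    assume V: "openin (Ck2_topology ?X) V" "(\<lambda>t\<in>topspace ?X. 0) \<in> V" and F: "finite F"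
    then obtain K where K: "compactin ?X K" "agree ?X (\<lambda>t\<in>topspace ?X. 0) K \<subseteq> V"
      unfolding openin_Ck2 by meson
    have "finite ({n. mball (z n) (?r n) \<inter> K \<noteq> {}} \<union> fst ` F)"
      using mball_hits_finite[OF _ zno K(1)] zM F by blast
    then obtain n where n: "n \<notin> {n. mball (z n) (?r n) \<inter> K \<noteq> {}} \<union> fst ` F"
      using ex_new_if_finite[OF infinite_UNIV_nat] by meson
    have "finite {k. mball (x n k) (?r k) \<inter> K \<noteq> {}}"
      using mball_hits_finite[OF _ xno K(1)] xM by blast
    then obtain k where k: "k \<notin> {k. mball (x n k) (?r k) \<inter> K \<noteq> {}}"
      using ex_new_if_finite[OF infinite_UNIV_nat] by meson
    have KM: "K \<subseteq> M" using compactin_subset_topspace[OF K(1)] by simp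
    have "a (n, k) t = (\<lambda>t\<in>topspace ?X. 0) t" if t: "t \<in> K" for t
    proof -
      have "t \<notin> P n k" "t \<notin> Q n k" using P[of n k] Q[of n k] n k t by auto
      then show ?thesis using t KM by (auto simp: a_def)
    qed
    then have "a (n, k) \<in> V" using K(2) aC by (auto simp: agree_def)
    moreover have "(n, k) \<notin> F" using n by force
    ultimately show "\<exists>i\<in>UNIV - F. a i \<in> V" by blast
  qed
qed

end

section \<open>The group of two-valued functions\<close>

lemma carrier_Ck2_group [simp]: "carrier (Ck2_group X) = CF2 X"
  by (simp add: Ck2_group_def)

lemma one_Ck2_group [simp]: "\<one>\<^bsub>Ck2_group X\<^esub> = (\<lambda>x\<in>topspace X. 0)"
  by (simp add: Ck2_group_def)

lemma mult_Ck2_group [simp]: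
  "f \<otimes>\<^bsub>Ck2_group X\<^esub> g = (\<lambda>x\<in>topspace X. (f x + g x) mod 2)"
  by (simp add: Ck2_group_def)

lemma zero_in_CF2: "(\<lambda>x\<in>topspace X. 0) \<in> CF2 X"
  using indicator_in_CF2[of X "{}"] by simp

lemma add_in_CF2:
  assumes f: "f \<in> CF2 X" and g: "g \<in> CF2 X"
  shows "(\<lambda>x\<in>topspace X. (f x + g x) mod 2) \<in> CF2 X"
proof -
  define h where "h = (\<lambda>x\<in>topspace X. (f x + g x) mod 2)"
  have h: "h x = (f x + g x) mod 2" if "x \<in> topspace X" for x using that by (simp add: h_def)
  have "h \<in> CF2 X"
  proof (rule CF2I)
    show "h \<in> extensional (topspace X)" unfolding h_def by (rule restrict_extensional)
    fix x assume x: "x \<in> topspace X"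
    show "h x \<in> {0, 1}" using h[OF x] by auto
    obtain U V where UV: "openin X U" "x \<in> U" "U \<subseteq> {y. f y = f x}" "openin X V" "x \<in> V" "V \<subseteq> {y. g y = g x}"
      using CF2_local[OF f x] CF2_local[OF g x] by meson
    have "U \<inter> V \<subseteq> {y. h y = h x}"
    proof
      fix y assume y: "y \<in> U \<inter> V"
      then have "y \<in> topspace X" using openin_subset[OF UV(1)] by auto
      moreover have "f y = f x" "g y = g x" using UV(3,6) y by auto
      ultimately show "y \<in> {y. h y = h x}" using h x by simp
    qed
    then show "\<exists>U. openin X U \<and> x \<in> U \<and> U \<subseteq> {y. h y = h x}"
      using UV by (intro exI[of _ "U \<inter> V"]) auto
  qed
  then show ?thesis by (simp only: h_def)
qed

lemma add_self_CF2:
  fixes f :: "'a \<Rightarrow> int"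
  shows "(\<lambda>x\<in>topspace X. (f x + f x) mod 2) = (\<lambda>x\<in>topspace X. 0)"
  by (intro restrict_ext) presburger

lemma comm_group_Ck2: "comm_group (Ck2_group X)"
proof (rule comm_groupI)
  fix f g h assume fgh: "f \<in> carrier (Ck2_group X)" "g \<in> carrier (Ck2_group X)" "h \<in> carrier (Ck2_group X)"
  show "f \<otimes>\<^bsub>Ck2_group X\<^esub> g \<in> carrier (Ck2_group X)" using fgh add_in_CF2 by simp
  show "(f \<otimes>\<^bsub>Ck2_group X\<^esub> g) \<otimes>\<^bsub>Ck2_group X\<^esub> h = f \<otimes>\<^bsub>Ck2_group X\<^esub> (g \<otimes>\<^bsub>Ck2_group X\<^esub> h)"
    unfolding mult_Ck2_group by (intro restrict_ext) (simp add: mod_add_left_eq mod_add_right_eq add.assoc)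
  show "f \<otimes>\<^bsub>Ck2_group X\<^esub> g = g \<otimes>\<^bsub>Ck2_group X\<^esub> f"
    unfolding mult_Ck2_group by (simp only: add.commute)
next
  show "\<one>\<^bsub>Ck2_group X\<^esub> \<in> carrier (Ck2_group X)" using zero_in_CF2 by simp
next
  fix f assume f: "f \<in> carrier (Ck2_group X)"
  show "\<one>\<^bsub>Ck2_group X\<^esub> \<otimes>\<^bsub>Ck2_group X\<^esub> f = f"
  proof (rule CF2_ext[of _ X])
    show "\<one>\<^bsub>Ck2_group X\<^esub> \<otimes>\<^bsub>Ck2_group X\<^esub> f \<in> CF2 X"
      unfolding mult_Ck2_group one_Ck2_group
      by (rule add_in_CF2[OF zero_in_CF2]) (use f in simp)
    show "f \<in> CF2 X" using f by simp
    fix x assume x: "x \<in> topspace X"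
    have "f x \<in> {0, 1}" using f x CF2_01 by simp
    then show "(\<one>\<^bsub>Ck2_group X\<^esub> \<otimes>\<^bsub>Ck2_group X\<^esub> f) x = f x" using x by auto
  qed
  show "\<exists>g\<in>carrier (Ck2_group X). g \<otimes>\<^bsub>Ck2_group X\<^esub> f = \<one>\<^bsub>Ck2_group X\<^esub>"
    using f add_self_CF2[of f X] by (intro bexI[of _ f]) simp_all
qed

lemma group_Ck2: "group (Ck2_group X)"
  using comm_group_Ck2 by (rule comm_group.axioms)

lemma inv_Ck2: "f \<in> CF2 X \<Longrightarrow> inv\<^bsub>Ck2_group X\<^esub> f = f"
  using add_self_CF2[of f X] by (intro group.inv_equality[OF group_Ck2]) simp_all

lemma Ck2_vanishing_eq: "Ck2_vanishing X = {f \<in> CF2 X. \<forall>x\<in>derived_space_set X. f x = 0}"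
  by (simp add: Ck2_vanishing_def)

lemma subgroup_Ck2_vanishing: "subgroup (Ck2_vanishing X) (Ck2_group X)"
proof (rule group.subgroupI[OF group_Ck2])
  have sub: "derived_space_set X \<subseteq> topspace X" by (rule derived_set_of_subset_topspace)
  show "Ck2_vanishing X \<subseteq> carrier (Ck2_group X)" by (auto simp: Ck2_vanishing_eq)
  have "(\<lambda>x\<in>topspace X. 0) \<in> Ck2_vanishing X"
    using zero_in_CF2 sub by (auto simp: Ck2_vanishing_eq)
  then show "Ck2_vanishing X \<noteq> {}" by auto
  show "inv\<^bsub>Ck2_group X\<^esub> f \<in> Ck2_vanishing X" if "f \<in> Ck2_vanishing X" for f
    using that inv_Ck2[of f X] by (simp add: Ck2_vanishing_eq)
  show "f \<otimes>\<^bsub>Ck2_group X\<^esub> g \<in> Ck2_vanishing X" if "f \<in> Ck2_vanishing X" "g \<in> Ck2_vanishing X" for f g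
    using that add_in_CF2[of f X g] sub by (auto simp: Ck2_vanishing_eq)
qed

lemma openin_Ck2_vanishing:
  assumes "compactin X (derived_space_set X)"
  shows "openin (Ck2_topology X) (Ck2_vanishing X)"
proof -
  have "Ck2_vanishing X = agree X (\<lambda>x\<in>topspace X. 0) (derived_space_set X)"
    using compactin_subset_topspace[OF assms] by (auto simp: Ck2_vanishing_eq agree_def)
  then show ?thesis using openin_Ck2_agree[OF zero_in_CF2 assms] by simp
qed

text \<open>Closedness lets the subgroup inherit the k-space property of the whole group.\<close>

lemma closedin_Ck2_vanishing: "closedin (Ck2_topology X) (Ck2_vanishing X)"
proof -
  have sub: "derived_space_set X \<subseteq> topspace X" by (rule derived_set_of_subset_topspace)
  then have "Ck2_vanishing X = agree X (\<lambda>x\<in>topspace X. 0) (derived_space_set X)"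
    by (auto simp: Ck2_vanishing_eq agree_def)
  then show ?thesis using closedin_Ck2_agree[OF sub] by simp
qed

section \<open>Discrete topological groups and a criterion for homeomorphisms\<close>

lemma discrete_topological_group:
  assumes "group G" and T: "T = discrete_topology (carrier G)"
  shows "topological_group G T"
proof -
  interpret group G by fact
  show ?thesis
    unfolding topological_group_def T
    by (auto simp: prod_topology_discrete_topology[symmetric] group_axioms)
qed

lemma homeomorphic_map_openinI:
  assumes "bij_betw \<phi> (topspace S) (topspace T)"
    and "\<And>W. openin S W \<Longrightarrow> openin T (\<phi> ` W)"
    and "\<And>V. openin T V \<Longrightarrow> openin S {x \<in> topspace S. \<phi> x \<in> V}"
  shows "homeomorphic_map S T \<phi>"
proof (rule bijective_open_imp_homeomorphic_map)
  show "continuous_map S T \<phi>"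
    using assms(1,3) by (auto simp: continuous_map_def bij_betw_def)
qed (use assms in \<open>auto simp: open_map_def bij_betw_def\<close>)

section \<open>Compact derived set: the k-space property\<close>

text \<open>Isolates what the metric contributes: \<open>D\<close> stands for the derived set, and
  \<open>A n\<close> with \<open>n > 0\<close> for its neighbourhood of radius 1/n. Putting
  \<open>A 0\<close> equal to the whole space makes the shells cover the complement of
  \<open>D\<close>, and gives the induction for the k-property a trivial start.\<close>

locale shrinking_nbhds =
  fixes X :: "'a topology" and D :: "'a set" and A :: "nat \<Rightarrow> 'a set"
  assumes compact_D: "compactin X D"
    and isolated: "\<And>x. x \<in> topspace X \<Longrightarrow> x \<notin> D \<Longrightarrow> openin X {x}"
    and A_0: "A 0 = topspace X"
    and open_A: "\<And>n. openin X (A n)"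
    and A_Suc: "\<And>n. A (Suc n) \<subseteq> A n"
    and D_A: "\<And>n. D \<subseteq> A n"
    and shrink: "\<And>U. openin X U \<Longrightarrow> D \<subseteq> U \<Longrightarrow> \<exists>n. A n \<subseteq> U"
    and Inter_A: "(\<Inter>n. A n) \<subseteq> D"
begin

lemma A_mono: "m \<le> n \<Longrightarrow> A n \<subseteq> A m"
  using A_Suc by (rule lift_Suc_antimono_le)

lemma A_sub: "A n \<subseteq> topspace X"
  using open_A by (rule openin_subset)

lemma D_sub: "D \<subseteq> topspace X"
  using compact_D by (rule compactin_subset_topspace)

text \<open>\<open>K - A n\<close> is compact and consists of isolated points, so its cover by
  singletons forces finiteness.\<close>

lemma finite_compact_diff:
  assumes K: "compactin X K" shows "finite (K - A n)"
proof -
  have "closedin X (topspace X - A n)" using open_A by blast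
  with K have c: "compactin X (K \<inter> (topspace X - A n))" by (rule compact_Int_closedin)
  have eq: "K \<inter> (topspace X - A n) = K - A n" using compactin_subset_topspace[OF K] by auto
  have "openin X U" if "U \<in> (\<lambda>x. {x}) ` (K - A n)" for U
    using that isolated compactin_subset_topspace[OF K] D_A[of n] by auto
  moreover have "K - A n \<subseteq> \<Union>((\<lambda>x. {x}) ` (K - A n))" by auto
  ultimately obtain \<F> where \<F>: "finite \<F>" "\<F> \<subseteq> (\<lambda>x. {x}) ` (K - A n)" "K - A n \<subseteq> \<Union>\<F>"
    using compactinD[OF c[unfolded eq], of "(\<lambda>x. {x}) ` (K - A n)"] by meson
  have "finite (\<Union>\<F>)" using \<F>(1,2) by (intro finite_Union) auto
  then show ?thesis using \<F>(3) by (rule rev_finite_subset)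
qed

text \<open>A finite subfamily covering \<open>D\<close> already covers some \<open>A n\<close>,
  which leaves finitely many points of \<open>P\<close>. This is the converse of
  \<open>finite_compact_diff\<close>.\<close>

lemma compact_Un_locally_finite:
  assumes P: "P \<subseteq> topspace X" "\<And>n. finite (P - A n)"
  shows "compactin X (D \<union> P)"
  unfolding compactin_def
proof (intro conjI allI impI)
  show "D \<union> P \<subseteq> topspace X" using D_sub P(1) by simp
  fix \<U> assume \<U>: "(\<forall>U\<in>\<U>. openin X U) \<and> D \<union> P \<subseteq> \<Union>\<U>"
  then obtain \<F> where \<F>: "finite \<F>" "\<F> \<subseteq> \<U>" "D \<subseteq> \<Union>\<F>"
    using compactinD[OF compact_D, of \<U>] by auto
  have "openin X (\<Union>\<F>)" using \<U> \<F>(2) by (intro openin_Union) auto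
  then obtain n where n: "A n \<subseteq> \<Union>\<F>" using shrink \<F>(3) by meson
  have "P - A n \<subseteq> \<Union>\<U>" using \<U> by auto
  from finite_subset_Union[OF P(2) this] obtain \<G> where \<G>: "finite \<G>" "\<G> \<subseteq> \<U>" "P - A n \<subseteq> \<Union>\<G>"
    by metis
  show "\<exists>\<F>. finite \<F> \<and> \<F> \<subseteq> \<U> \<and> D \<union> P \<subseteq> \<Union>\<F>"
    using \<F> \<G> n by (intro exI[of _ "\<F> \<union> \<G>"]) auto
qed

lemma agree_near_D:
  assumes "f \<in> CF2 X" "g \<in> CF2 X" "\<And>x. x \<in> D \<Longrightarrow> f x = g x"
  shows "\<exists>n. \<forall>x\<in>A n. f x = g x"
proof -
  have "D \<subseteq> {x \<in> topspace X. f x = g x}" using assms(3) D_sub by auto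
  then obtain n where "A n \<subseteq> {x \<in> topspace X. f x = g x}"
    using shrink[OF openin_CF2_eq[OF assms(1,2)]] by meson
  then show ?thesis by (intro exI[of _ n]) auto
qed

text \<open>Points off \<open>D\<close> are isolated, so continuity is at stake only at points of
  \<open>D\<close>, where \<open>f\<close> equals \<open>g\<close> nearby. The values outside
  \<open>A n\<close> are therefore free.\<close>

lemma CF2_modify:
  assumes g: "g \<in> CF2 X" and f: "f \<in> extensional (topspace X)" "\<And>x. x \<in> topspace X \<Longrightarrow> f x \<in> {0, 1}"
    and fg: "\<And>x. x \<in> A n \<Longrightarrow> f x = g x"
  shows "f \<in> CF2 X"
proof (rule CF2I[OF f])
  fix x assume x: "x \<in> topspace X"
  show "\<exists>U. openin X U \<and> x \<in> U \<and> U \<subseteq> {y. f y = f x}"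
  proof (cases "x \<in> D")
    case True
    then have xA: "x \<in> A n" using D_A[of n] by auto
    obtain U where U: "openin X U" "x \<in> U" "U \<subseteq> {y. g y = g x}" using CF2_local[OF g x] by meson
    have "U \<inter> A n \<subseteq> {y. f y = f x}"
    proof
      fix y assume "y \<in> U \<inter> A n"
      then have "g y = g x" "f y = g y" using U(3) fg by auto
      then show "y \<in> {y. f y = f x}" using fg[OF xA] by simp
    qed
    then show ?thesis using U(1,2) xA open_A[of n] by (intro exI[of _ "U \<inter> A n"]) auto
  next
    case False
    then show ?thesis using isolated[OF x] by (intro exI[of _ "{x}"]) auto
  qed
qed auto

text \<open>With the values outside \<open>A n\<close> free, the set is the image of a power of the
  two-point space. The gluing map \<open>\<psi>\<close> is continuous because a compact
  \<open>K\<close> sees only the finitely many coordinates in \<open>K - A n\<close>.\<close>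

lemma compactin_agree:
  assumes g: "g \<in> CF2 X"
  shows "compactin (Ck2_topology X) (agree X g (A n))"
proof -
  let ?E = "topspace X - A n"
  let ?P = "product_topology (\<lambda>_. Z2_topology) ?E"
  define \<psi> where "\<psi> h = (\<lambda>x\<in>topspace X. if x \<in> A n then g x else h x)" for h
  have \<psi>_A: "\<psi> h x = g x" if "x \<in> A n" for h x using that A_sub[of n] by (auto simp: \<psi>_def)
  have \<psi>_E: "\<psi> h x = h x" if "x \<in> ?E" for h x using that by (auto simp: \<psi>_def)
  have \<psi>_CF: "\<psi> h \<in> CF2 X" if h: "h \<in> PiE ?E (\<lambda>_. {0, 1})" for h
  proof (rule CF2_modify[OF g])
    show "\<psi> h \<in> extensional (topspace X)" unfolding \<psi>_def by (rule restrict_extensional)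
    show "\<psi> h x \<in> {0, 1}" if "x \<in> topspace X" for x
    proof (cases "x \<in> A n")
      case True
      then show ?thesis using CF2_01[OF g that] by (simp add: \<psi>_A)
    next
      case False
      then have x: "x \<in> ?E" using that by simp
      then show ?thesis using PiE_mem[OF h x] by (simp only: \<psi>_E)
    qed
  qed (rule \<psi>_A)
  have "continuous_map ?P (Ck2_topology X) \<psi>"
    unfolding continuous_map_def
  proof (intro conjI allI impI)
    show "\<psi> \<in> topspace ?P \<rightarrow> topspace (Ck2_topology X)"
      using \<psi>_CF by (auto simp: carrier_Z2)
    fix W assume W: "openin (Ck2_topology X) W"
    show "openin ?P {h \<in> topspace ?P. \<psi> h \<in> W}"
      unfolding openin_product_discrete
    proof (intro conjI ballI)
      fix h assume h: "h \<in> {h \<in> topspace ?P. \<psi> h \<in> W}"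
      then obtain K where K: "compactin X K" "agree X (\<psi> h) K \<subseteq> W"
        using W unfolding openin_Ck2 by auto
      have sub: "K - A n \<subseteq> ?E" using compactin_subset_topspace[OF K(1)] by auto
      show "\<exists>F. finite F \<and> F \<subseteq> ?E \<and> (\<forall>h'\<in>PiE ?E (\<lambda>_. carrier Z2). (\<forall>x\<in>F. h' x = h x) \<longrightarrow>
          h' \<in> {h \<in> topspace ?P. \<psi> h \<in> W})"
      proof (intro exI[of _ "K - A n"] conjI ballI impI)
        fix h' assume h': "h' \<in> PiE ?E (\<lambda>_. carrier Z2)" "\<forall>x\<in>K - A n. h' x = h x"
        have "\<psi> h' x = \<psi> h x" if "x \<in> K" for x
        proof (cases "x \<in> A n")
          case True
          then show ?thesis by (simp add: \<psi>_A)
        next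
          case False
          then have "x \<in> K - A n" "x \<in> ?E" using that sub by auto
          then show ?thesis using h'(2) by (simp only: \<psi>_E)
        qed
        then have "\<psi> h' \<in> agree X (\<psi> h) K"
          using \<psi>_CF[of h'] h'(1) by (simp add: agree_def carrier_Z2)
        then show "h' \<in> {h \<in> topspace ?P. \<psi> h \<in> W}" using K(2) h'(1) by auto
      qed (use finite_compact_diff[OF K(1)] sub in auto)
    qed auto
  qed
  moreover have "compact_space ?P"
    by (simp add: compact_space_product_topology compact_space_discrete_topology carrier_Z2)
  ultimately have "compactin (Ck2_topology X) (\<psi> ` topspace ?P)"
    by (simp add: compact_space_def image_compactin)
  moreover have "\<psi> ` topspace ?P = agree X g (A n)"
  proof (intro equalityI subsetI)
    fix f assume "f \<in> \<psi> ` topspace ?P"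
    then show "f \<in> agree X g (A n)" using \<psi>_CF \<psi>_A by (auto simp: agree_def carrier_Z2)
  next
    fix f assume f: "f \<in> agree X g (A n)"
    then have fC: "f \<in> CF2 X" and fg: "\<And>x. x \<in> A n \<Longrightarrow> f x = g x" by (auto simp: agree_def)
    have m: "restrict f ?E \<in> PiE ?E (\<lambda>_. {0, 1})"
      using CF2_01[OF fC] by (simp add: PiE_iff)
    have "\<psi> (restrict f ?E) = f"
    proof (rule CF2_ext[OF \<psi>_CF[OF m] fC])
      fix x assume "x \<in> topspace X"
      then show "\<psi> (restrict f ?E) x = f x" using fg by (simp add: \<psi>_def)
    qed
    moreover have "restrict f ?E \<in> topspace ?P" using m by (simp only: carrier_Z2 topspace_product_topology topspace_discrete_topology)
    ultimately show "f \<in> \<psi> ` topspace ?P" by (metis image_eqI)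
  qed
  ultimately show ?thesis by simp
qed

text \<open>The inductive step is the tube lemma: \<open>agree X g (A n \<union> P)\<close> is compact.\<close>

lemma tube_step:
  assumes g: "g \<in> CF2 X"
    and W: "\<And>C. compactin (Ck2_topology X) C \<Longrightarrow> openin (subtopology (Ck2_topology X) C) (C \<inter> W)"
    and P: "P \<subseteq> topspace X - A n" "agree X g (A n \<union> P) \<subseteq> W"
  shows "\<exists>F. finite F \<and> F \<subseteq> A n - A (Suc n) \<and> agree X g (A (Suc n) \<union> (P \<union> F)) \<subseteq> W"
proof -
  let ?Q = "agree X g (A (Suc n))" and ?L = "agree X g (A n \<union> P)"
  \<comment> \<open>\<open>W\<close> is known to be open only relative to compact sets.
    \<open>O'\<close> is an open set with the same trace on \<open>?Q\<close>, and membership in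
    \<open>W\<close> is recovered at the end from membership in both \<open>O'\<close> and
    \<open>?Q\<close>.\<close>
  obtain O' where O': "openin (Ck2_topology X) O'" "?Q \<inter> W = O' \<inter> ?Q"
    using W[OF compactin_agree[OF g, of "Suc n"]] unfolding openin_subtopology by meson
  have "?L \<subseteq> ?Q" using A_Suc[of n] by (auto simp: agree_def)
  then have LO: "?L \<subseteq> O'" using P(2) O'(2) by auto
  have "closedin (Ck2_topology X) ?L"
    by (rule closedin_Ck2_agree) (use A_sub P in auto)
  moreover have "?L \<subseteq> agree X g (A n)" by (auto simp: agree_def)
  ultimately have cL: "compactin (Ck2_topology X) ?L"
    using compactin_agree[OF g, of n] closed_compactin by meson
  have "\<forall>f\<in>?L. \<exists>K. compactin X K \<and> agree X f K \<subseteq> O'"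
    using LO O'(1) unfolding openin_Ck2 by auto
  from bchoice[OF this] obtain K where K: "\<forall>f\<in>?L. compactin X (K f) \<and> agree X f (K f) \<subseteq> O'" ..
  have LC: "f \<in> CF2 X" if "f \<in> ?L" for f using that by (simp add: agree_def)
  have "openin (Ck2_topology X) V" if V: "V \<in> (\<lambda>f. agree X f (K f)) ` ?L" for V
  proof -
    obtain f where "f \<in> ?L" "V = agree X f (K f)" using V by auto
    then show ?thesis using openin_Ck2_agree[OF LC] K by simp
  qed
  moreover have "?L \<subseteq> \<Union>((\<lambda>f. agree X f (K f)) ` ?L)" using LC by (auto simp: agree_def)
  ultimately obtain \<F> where \<F>: "finite \<F>" "\<F> \<subseteq> (\<lambda>f. agree X f (K f)) ` ?L" "?L \<subseteq> \<Union>\<F>"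
    using compactinD[OF cL, of "(\<lambda>f. agree X f (K f)) ` ?L"] by meson
  obtain F where F: "finite F" "F \<subseteq> ?L" "\<F> = (\<lambda>f. agree X f (K f)) ` F"
    using finite_subset_image[OF \<F>(1,2)] by auto
  \<comment> \<open>These are the points of the finitely many \<open>K f\<close> in the new shell.
    On \<open>A (Suc n)\<close> agreement with \<open>g\<close> is required anyway, and off
    \<open>A n\<close> the cover of \<open>?L\<close> takes care of all values.\<close>
  define G where "G = (\<Union>f\<in>F. K f \<inter> A n - A (Suc n))"
  have "finite (K f \<inter> A n - A (Suc n))" if "f \<in> F" for f
    using finite_compact_diff[of "K f" "Suc n"] K F(2) that by (auto intro: rev_finite_subset)
  then have "finite G" unfolding G_def using F(1) by (intro finite_UN_I) auto
  moreover have "G \<subseteq> A n - A (Suc n)" by (auto simp: G_def)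
  moreover have "agree X g (A (Suc n) \<union> (P \<union> G)) \<subseteq> W"
  proof
    fix h assume h: "h \<in> agree X g (A (Suc n) \<union> (P \<union> G))"
    then have hC: "h \<in> CF2 X" and hg: "\<And>x. x \<in> A (Suc n) \<union> (P \<union> G) \<Longrightarrow> h x = g x"
      by (simp_all add: agree_def)
    \<comment> \<open>Overwriting \<open>h\<close> by \<open>g\<close> on \<open>A n\<close> moves
      it into \<open>?L\<close>, hence into one of the covering sets; it changes no value at the
      points of \<open>K f\<close> outside \<open>A n\<close>.\<close>
    define h' where "h' = (\<lambda>x\<in>topspace X. if x \<in> A n then g x else h x)"
    have h'A: "h' x = g x" if "x \<in> A n" for x using that A_sub[of n] by (auto simp: h'_def)
    have h'E: "h' x = h x" if "x \<in> topspace X - A n" for x using that by (simp add: h'_def)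
    have "h' \<in> CF2 X"
    proof (rule CF2_modify[OF g _ _ h'A])
      show "h' \<in> extensional (topspace X)" unfolding h'_def by (rule restrict_extensional)
      show "h' x \<in> {0, 1}" if "x \<in> topspace X" for x
        using CF2_01[OF g that] CF2_01[OF hC that] that by (simp add: h'_def)
    qed
    moreover have "h' x = g x" if "x \<in> P" for x
      using h'E[of x] hg[of x] that P(1) by auto
    ultimately have "h' \<in> ?L" using h'A by (auto simp: agree_def)
    then obtain f where f: "f \<in> F" "h' \<in> agree X f (K f)" using \<F>(3) F(3) by auto
    have fL: "f \<in> ?L" using f(1) F(2) by auto
    have fg: "f x = g x" if "x \<in> A n" for x using fL that by (simp add: agree_def)
    have "h x = f x" if x: "x \<in> K f" for x
    proof (cases "x \<in> A n")
      case False
      have "x \<in> topspace X" using K fL x compactin_subset_topspace by blast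
      then have "h x = h' x" using h'E[of x] False by simp
      then show ?thesis using f(2) x by (simp add: agree_def)
    next
      case True
      then have "x \<in> A (Suc n) \<union> (P \<union> G)" using x f(1) by (auto simp: G_def)
      then show ?thesis using hg fg[OF True] by simp
    qed
    then have "h \<in> agree X f (K f)" using hC by (simp add: agree_def)
    then have "h \<in> O'" using K fL by auto
    moreover have "h \<in> ?Q" using h by (simp add: agree_def)
    ultimately show "h \<in> W" using O'(2) by auto
  qed
  ultimately show ?thesis by (intro exI[of _ G] conjI)
qed

text \<open>Finite sets \<open>s n\<close> grow by points of the shell
  \<open>A n - A (Suc n)\<close>, keeping \<open>agree X g (A n \<union> s n) \<subseteq> W\<close>.
  Their union with \<open>D\<close> is compact, and a function agreeing with \<open>g\<close> there
  agrees with \<open>g\<close> on some \<open>A n\<close>, which puts it into the set of stage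
  \<open>n\<close>.\<close>

lemma k_space_Ck2: "k_space (Ck2_topology X)"
  unfolding k_space_open
proof (intro allI impI, elim conjE)
  fix W assume "W \<subseteq> topspace (Ck2_topology X)"
    and W0: "\<forall>C. compactin (Ck2_topology X) C \<longrightarrow> openin (subtopology (Ck2_topology X) C) (C \<inter> W)"
  then have WC: "W \<subseteq> CF2 X" by simp
  have W: "openin (subtopology (Ck2_topology X) C) (C \<inter> W)" if "compactin (Ck2_topology X) C" for C
    using W0 that by simp
  show "openin (Ck2_topology X) W"
    unfolding openin_Ck2
  proof (intro conjI ballI WC)
    fix g assume gW: "g \<in> W"
    then have g: "g \<in> CF2 X" using WC by auto
    define I where "I n P \<longleftrightarrow> finite P \<and> P \<subseteq> topspace X - A n \<and> agree X g (A n \<union> P) \<subseteq> W" for n P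
    define R where "R n P P' \<longleftrightarrow> P \<subseteq> P' \<and> P' - P \<subseteq> A n" for n :: nat and P P' :: "'a set"
    have "\<exists>s. \<forall>n. I n (s n) \<and> R n (s n) (s (Suc n))"
    proof (rule dependent_nat_choice)
      \<comment> \<open>\<open>A 0\<close> is the whole space, so at the start only \<open>g\<close>
        itself has to lie in \<open>W\<close>.\<close>
      have "f = g" if "f \<in> agree X g (A 0 \<union> {})" for f
        using that g by (intro CF2_ext[of f X g]) (auto simp: agree_def A_0)
      then have "I 0 {}" using gW by (auto simp: I_def)
      then show "\<exists>P. I 0 P" ..
    next
      fix P n assume P: "I n P"
      then obtain F where F: "finite F" "F \<subseteq> A n - A (Suc n)" "agree X g (A (Suc n) \<union> (P \<union> F)) \<subseteq> W"
        using tube_step[OF g W, of P n] unfolding I_def by auto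
      have "P \<union> F \<subseteq> topspace X - A (Suc n)"
        using P F(2) A_Suc[of n] A_sub[of n] unfolding I_def by auto
      then have "I (Suc n) (P \<union> F)" using P F unfolding I_def by simp
      moreover have "R n P (P \<union> F)" using F(2) unfolding R_def by auto
      ultimately show "\<exists>P'. I (Suc n) P' \<and> R n P P'" by (intro exI[of _ "P \<union> F"] conjI)
    qed
    then obtain s where s: "\<And>n. I n (s n)" "\<And>n. R n (s n) (s (Suc n))" by auto
    \<comment> \<open>Points added from stage \<open>n\<close> on lie in \<open>A n\<close>, so
      outside \<open>A n\<close> the union of all \<open>s m\<close> is contained in the finite set
      \<open>s n\<close>.\<close>
    have tail: "s m - A n \<subseteq> s n" for m n
    proof (induction m)
      case 0
      then show ?case using s(1)[of 0] by (auto simp: I_def A_0)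
    next
      case (Suc m)
      show ?case
      proof (cases "n \<le> m")
        case True
        have "s (Suc m) - s m \<subseteq> A m" using s(2)[of m] by (simp add: R_def)
        then show ?thesis using A_mono[OF True] Suc by auto
      next
        case False
        then have "Suc m \<le> n" by simp
        then have "s (Suc m) \<subseteq> s n"
          by (rule lift_Suc_mono_le[rotated]) (use s(2) in \<open>auto simp: R_def\<close>)
        then show ?thesis by auto
      qed
    qed
    define P where "P = (\<Union>n. s n)"
    have "P \<subseteq> topspace X" using s(1) by (auto simp: P_def I_def)
    moreover have "finite (P - A n)" for n
    proof -
      have "P - A n \<subseteq> s n" using tail by (auto simp: P_def)
      then show ?thesis using s(1)[of n] by (auto simp: I_def intro: finite_subset)
    qed
    ultimately have "compactin X (D \<union> P)" by (rule compact_Un_locally_finite)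
    moreover have "agree X g (D \<union> P) \<subseteq> W"
    proof
      fix h assume h: "h \<in> agree X g (D \<union> P)"
      then have hC: "h \<in> CF2 X" and hg: "\<And>x. x \<in> D \<union> P \<Longrightarrow> h x = g x" by (simp_all add: agree_def)
      then obtain n where "\<forall>x\<in>A n. h x = g x" using agree_near_D[OF hC g] by auto
      then have "h \<in> agree X g (A n \<union> s n)" using hC hg by (auto simp: agree_def P_def)
      then show "h \<in> W" using s(1)[of n] by (auto simp: I_def)
    qed
    ultimately show "\<exists>K. compactin X K \<and> agree X g K \<subseteq> W" by meson
  qed
qed

end

section \<open>Compact derived set: the box sum\<close>

lemma carrier_Z2_power [simp]: "carrier (Z2_power_group \<kappa>) = PiE (Field \<kappa>) (\<lambda>_. {0, 1})"
  by (simp add: Z2_power_group_def carrier_Z2)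

lemma one_Z2_power [simp]: "\<one>\<^bsub>Z2_power_group \<kappa>\<^esub> = (\<lambda>x\<in>Field \<kappa>. 0)"
  by (simp add: Z2_power_group_def)

lemma mult_Z2_power [simp]:
  "f \<otimes>\<^bsub>Z2_power_group \<kappa>\<^esub> g = (\<lambda>x\<in>Field \<kappa>. (f x + g x) mod 2)"
  by (simp add: Z2_power_group_def)

lemma group_Z2_power: "group (Z2_power_group \<kappa>)"
  by (simp add: Z2_power_group_def)

lemma openin_Z2_power:
  "openin (Z2_power_topology \<kappa>) W \<longleftrightarrow> W \<subseteq> PiE (Field \<kappa>) (\<lambda>_. {0, 1}) \<and>
     (\<forall>f\<in>W. \<exists>F. finite F \<and> F \<subseteq> Field \<kappa> \<and>
       (\<forall>g\<in>PiE (Field \<kappa>) (\<lambda>_. {0, 1}). (\<forall>x\<in>F. g x = f x) \<longrightarrow> g \<in> W))"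
  unfolding Z2_power_topology_def openin_product_discrete carrier_Z2 ..

lemma carrier_sum_Z2_power:
  "carrier (sum_group UNIV (\<lambda>n. Z2_power_group (\<kappa> n))) =
     {h. (\<forall>n. h n \<in> PiE (Field (\<kappa> n)) (\<lambda>_. {0, 1})) \<and> finite {n. h n \<noteq> (\<lambda>x\<in>Field (\<kappa> n). 0)}}"
  by (subst carrier_sum_group[OF group_Z2_power]) (auto simp: PiE_UNIV_domain)

text \<open>A neighbourhood of 0 in a power of Z(2) prescribes the value 0 on a finite set of
  coordinates; translating by \<open>g\<close> prescribes the values of \<open>g\<close> there. In
  the box topology these finite sets are chosen independently in all factors.\<close>

lemma openin_box_sum_Z2_power:
  fixes \<kappa> :: "'i \<Rightarrow> 'k rel"
  defines "S \<equiv> carrier (sum_group UNIV (\<lambda>n. Z2_power_group (\<kappa> n)))"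
  shows "openin (box_sum_topology UNIV (\<lambda>n. Z2_power_group (\<kappa> n)) (\<lambda>n. Z2_power_topology (\<kappa> n))) V \<longleftrightarrow>
    V \<subseteq> S \<and> (\<forall>g\<in>V. \<exists>F. (\<forall>n. finite (F n) \<and> F n \<subseteq> Field (\<kappa> n)) \<and>
      (\<forall>h\<in>S. (\<forall>n. \<forall>x\<in>F n. h n x = g n x) \<longrightarrow> h \<in> V))"
  (is "openin ?B V \<longleftrightarrow> ?R")
proof -
  let ?E = "\<lambda>n. PiE (Field (\<kappa> n)) (\<lambda>_. {0, 1}) :: ('k \<Rightarrow> int) set"
  let ?P = "product_group UNIV (\<lambda>n. Z2_power_group (\<kappa> n))"
  let ?BB = "box_group_topology UNIV (\<lambda>n. Z2_power_group (\<kappa> n)) (\<lambda>n. Z2_power_topology (\<kappa> n))"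
  have S: "h n \<in> ?E n" if "h \<in> S" for h n
    using that unfolding S_def carrier_sum_Z2_power by blast
  have coset: "g <#\<^bsub>?P\<^esub> PiE UNIV U = {\<lambda>n. \<lambda>x\<in>Field (\<kappa> n). (g n x + u n x) mod 2 |u. \<forall>n. u n \<in> U n}" for g U
  proof -
    have "g \<otimes>\<^bsub>?P\<^esub> u = (\<lambda>n. \<lambda>x\<in>Field (\<kappa> n). (g n x + u n x) mod 2)" for u
      by (simp add: restrict_def)
    then show ?thesis unfolding l_coset_def PiE_UNIV_domain Pi_iff by auto
  qed
  show ?thesis
  proof
    assume "openin ?B V"
    then obtain W where W: "openin ?BB W" "V = W \<inter> S"
      unfolding box_sum_topology_def openin_subtopology S_def by blast
    have "\<exists>F. (\<forall>n. finite (F n) \<and> F n \<subseteq> Field (\<kappa> n)) \<and>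
      (\<forall>h\<in>S. (\<forall>n. \<forall>x\<in>F n. h n x = g n x) \<longrightarrow> h \<in> V)" if g: "g \<in> V" for g
    proof -
      have "g \<in> W" "g \<in> S" using g W(2) by auto
      from bspec[OF conjunct2[OF W(1)[unfolded openin_box_group_topology]] this(1)]
      obtain U where "(\<forall>n\<in>UNIV. openin (Z2_power_topology (\<kappa> n)) (U n) \<and>
          (\<lambda>x\<in>Field (\<kappa> n). 0) \<in> U n) \<and> g <#\<^bsub>?P\<^esub> PiE UNIV U \<subseteq> W"
        unfolding one_Z2_power by (rule exE)
      then have U: "\<And>n. openin (Z2_power_topology (\<kappa> n)) (U n)"
          "\<And>n. (\<lambda>x\<in>Field (\<kappa> n). 0) \<in> U n" "g <#\<^bsub>?P\<^esub> PiE UNIV U \<subseteq> W"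
        by simp_all
      have "\<forall>n. \<exists>F. finite F \<and> F \<subseteq> Field (\<kappa> n) \<and> (\<forall>u\<in>?E n. (\<forall>x\<in>F. u x = 0) \<longrightarrow> u \<in> U n)"
      proof
        fix n
        obtain F where F: "finite F" "F \<subseteq> Field (\<kappa> n)"
          "\<forall>u\<in>?E n. (\<forall>x\<in>F. u x = (\<lambda>x\<in>Field (\<kappa> n). 0) x) \<longrightarrow> u \<in> U n"
          using U(1)[of n] U(2)[of n] unfolding openin_Z2_power by meson
        have "(\<lambda>x\<in>Field (\<kappa> n). 0) x = (0::int)" if "x \<in> F" for x
          using F(2) that by auto
        with F show "\<exists>F. finite F \<and> F \<subseteq> Field (\<kappa> n) \<and> (\<forall>u\<in>?E n. (\<forall>x\<in>F. u x = 0) \<longrightarrow> u \<in> U n)"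
          by (intro exI[of _ F]) simp
      qed
      from choice[OF this] obtain F where F: "\<And>n. finite (F n) \<and> F n \<subseteq> Field (\<kappa> n) \<and>
          (\<forall>u\<in>?E n. (\<forall>x\<in>F n. u x = 0) \<longrightarrow> u \<in> U n)" by auto
      have "h \<in> V" if h: "h \<in> S" and hg: "\<forall>n. \<forall>x\<in>F n. h n x = g n x" for h
      proof -
        \<comment> \<open>In exponent 2 the sum is also the difference, so \<open>u\<close>
          translates \<open>g\<close> to \<open>h\<close> and vanishes where the two agree.\<close>
        define u where "u n = (\<lambda>x\<in>Field (\<kappa> n). (h n x + g n x) mod 2)" for n
        have "u n \<in> U n" for n
        proof -
          have "u n \<in> ?E n" by (auto simp: u_def)
          moreover have "u n x = 0" if "x \<in> F n" for x
          proof -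
            have "x \<in> Field (\<kappa> n)" using F[of n] that by auto
            moreover have "h n x = g n x" using hg that by simp
            ultimately show ?thesis by (simp add: u_def)
          qed
          ultimately show ?thesis using F[of n] by simp
        qed
        then have "(\<lambda>n. \<lambda>x\<in>Field (\<kappa> n). (g n x + u n x) mod 2) \<in> W" using U(3) unfolding coset by auto
        moreover have "(\<lambda>n. \<lambda>x\<in>Field (\<kappa> n). (g n x + u n x) mod 2) = h"
        proof
          fix n
          show "(\<lambda>x\<in>Field (\<kappa> n). (g n x + u n x) mod 2) = h n"
          proof (rule extensionalityI[of _ "Field (\<kappa> n)"])
            show "h n \<in> extensional (Field (\<kappa> n))" using S[OF h, of n] by (simp add: PiE_iff)
            fix x assume x: "x \<in> Field (\<kappa> n)"
            have "h n x \<in> {0, 1}" "g n x \<in> {0, 1}"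
              using PiE_mem[OF S[OF h] x] PiE_mem[OF S[OF \<open>g \<in> S\<close>] x] by auto
            then show "(\<lambda>x\<in>Field (\<kappa> n). (g n x + u n x) mod 2) x = h n x"
              using x by (auto simp: u_def)
          qed auto
        qed
        ultimately show ?thesis using W(2) h by simp
      qed
      with F show ?thesis by (intro exI[of _ F]) simp
    qed
    with W(2) show ?R by simp
  next
    assume R: ?R
    then have VS: "V \<subseteq> S" ..
    have "\<forall>g\<in>V. \<exists>F. (\<forall>n. finite (F n) \<and> F n \<subseteq> Field (\<kappa> n)) \<and>
      (\<forall>h\<in>S. (\<forall>n. \<forall>x\<in>F n. h n x = g n x) \<longrightarrow> h \<in> V)" using R ..
    from bchoice[OF this] obtain F where F: "\<And>g n. g \<in> V \<Longrightarrow> finite (F g n) \<and> F g n \<subseteq> Field (\<kappa> n)"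
      "\<And>g h. g \<in> V \<Longrightarrow> h \<in> S \<Longrightarrow> (\<And>n x. x \<in> F g n \<Longrightarrow> h n x = g n x) \<Longrightarrow> h \<in> V" by metis
    \<comment> \<open>\<open>V\<close> lies in the direct sum and must be the trace of an open set
      of the full product. \<open>W\<close> applies the conditions that describe \<open>V\<close> to
      sequences of arbitrary support.\<close>
    define W where "W = {h. (\<forall>n. h n \<in> ?E n) \<and> (\<exists>g\<in>V. \<forall>n. \<forall>x\<in>F g n. h n x = g n x)}"
    have "openin ?BB W"
      unfolding openin_box_group_topology
    proof (intro conjI ballI)
      show "W \<subseteq> carrier ?P" by (auto simp: W_def PiE_UNIV_domain)
      fix h assume "h \<in> W"
      then obtain g where h: "\<And>n. h n \<in> ?E n" and g: "g \<in> V" and hg: "\<And>n x. x \<in> F g n \<Longrightarrow> h n x = g n x"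
        unfolding W_def by blast
      define U where "U n = {u \<in> ?E n. \<forall>x\<in>F g n. u x = 0}" for n
      have "openin (Z2_power_topology (\<kappa> n)) (U n)" for n
        unfolding openin_Z2_power
      proof (intro conjI ballI)
        fix u assume "u \<in> U n"
        then show "\<exists>G. finite G \<and> G \<subseteq> Field (\<kappa> n) \<and> (\<forall>v\<in>?E n. (\<forall>x\<in>G. v x = u x) \<longrightarrow> v \<in> U n)"
          using F(1)[OF g, of n] by (intro exI[of _ "F g n"]) (simp add: U_def)
      qed (auto simp: U_def)
      moreover have "(\<lambda>x\<in>Field (\<kappa> n). 0) \<in> U n" for n
        using F(1)[OF g, of n] by (auto simp: U_def)
      moreover have "h <#\<^bsub>?P\<^esub> PiE UNIV U \<subseteq> W"
      proof
        fix k assume "k \<in> h <#\<^bsub>?P\<^esub> PiE UNIV U"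
        then obtain u where u: "\<And>n. u n \<in> U n" "k = (\<lambda>n. \<lambda>x\<in>Field (\<kappa> n). (h n x + u n x) mod 2)"
          unfolding coset by blast
        have kE: "k n \<in> ?E n" for n by (auto simp: u(2))
        have kg: "k n x = g n x" if "x \<in> F g n" for n x
        proof -
          have x: "x \<in> Field (\<kappa> n)" using F(1)[OF g, of n] that by auto
          have "u n x = 0" using u(1)[of n] that by (simp add: U_def)
          moreover have "h n x \<in> {0, 1}" using PiE_mem[OF h x] .
          ultimately have "k n x = h n x" using x by (auto simp: u(2))
          then show ?thesis using hg[OF that] by simp
        qed
        from kE kg g show "k \<in> W" unfolding W_def by blast
      qed
      ultimately show "\<exists>U. (\<forall>i\<in>UNIV. openin (Z2_power_topology (\<kappa> i)) (U i) \<and> \<one>\<^bsub>Z2_power_group (\<kappa> i)\<^esub> \<in> U i) \<and>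
          h <#\<^bsub>?P\<^esub> PiE UNIV U \<subseteq> W"
        by (intro exI[of _ U]) simp
    qed
    moreover have "V = W \<inter> S"
    proof (intro equalityI subsetI)
      fix g assume "g \<in> V"
      then show "g \<in> W \<inter> S" using VS S unfolding W_def by blast
    next
      fix h assume "h \<in> W \<inter> S"
      then obtain g where "g \<in> V" "\<forall>n. \<forall>x\<in>F g n. h n x = g n x" "h \<in> S" unfolding W_def by blast
      then show "h \<in> V" using F(2) by blast
    qed
    ultimately show "openin ?B V" unfolding box_sum_topology_def openin_subtopology S_def by blast
  qed
qed

lemma topspace_box_sum_Z2_power:
  "topspace (box_sum_topology UNIV (\<lambda>n. Z2_power_group (\<kappa> n)) (\<lambda>n. Z2_power_topology (\<kappa> n))) =
     carrier (sum_group UNIV (\<lambda>n. Z2_power_group (\<kappa> n)))" (is "topspace ?B = ?S")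
proof
  show "topspace ?B \<subseteq> ?S"
    using openin_topspace[of ?B] unfolding openin_box_sum_Z2_power by (rule conjunct1)
  have "openin ?B ?S"
    unfolding openin_box_sum_Z2_power by (auto intro!: exI[of _ "\<lambda>n. {}"])
  then show "?S \<subseteq> topspace ?B" by (rule openin_subset)
qed

section \<open>Decomposition of functions along the shells\<close>

context shrinking_nbhds
begin

definition shell :: "nat \<Rightarrow> 'a set" where "shell n = A n - A (Suc n)"

text \<open>Meaningful off \<open>D\<close> only: points of \<open>D\<close> lie in every
  \<open>A n\<close>, so for them no such \<open>n\<close> exists.\<close>

definition level :: "'a \<Rightarrow> nat" where "level x = (LEAST n. x \<notin> A (Suc n))"

lemma level_shell: "x \<in> shell n \<Longrightarrow> level x = n"
  unfolding level_def shell_def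
proof (rule Least_equality)
  fix m assume x: "x \<in> A n - A (Suc n)" and m: "x \<notin> A (Suc m)"
  show "n \<le> m"
  proof (rule ccontr)
    assume "\<not> n \<le> m"
    then have "A n \<subseteq> A (Suc m)" by (intro A_mono) simp
    with x m show False by auto
  qed
qed auto

lemma shell_level:
  assumes x: "x \<in> topspace X" "x \<notin> D" shows "x \<in> shell (level x)"
proof -
  obtain m where m: "x \<notin> A m" using Inter_A x(2) by auto
  \<comment> \<open>Since \<open>A 0\<close> is the whole space, the index \<open>m\<close> is a
    successor, as the definition of \<open>level\<close> requires.\<close>
  obtain k where "x \<notin> A (Suc k)" using m A_0 x(1) by (cases m) auto
  then have out: "x \<notin> A (Suc (level x))" unfolding level_def by (rule LeastI)
  have "x \<in> A (level x)"
  proof (cases "level x")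
    case 0
    then show ?thesis using A_0 x by simp
  next
    case (Suc j)
    then have "j < level x" by simp
    then show ?thesis using not_less_Least[of j "\<lambda>n. x \<notin> A (Suc n)"] Suc unfolding level_def by simp
  qed
  with out show ?thesis by (simp add: shell_def)
qed

lemma shell_sub: "shell n \<subseteq> topspace X - D"
  using A_sub[of n] D_A[of "Suc n"] by (auto simp: shell_def)

definition vanishing :: "('a \<Rightarrow> int) set" where "vanishing = {f \<in> CF2 X. \<forall>x\<in>D. f x = 0}"

text \<open>The cardinal \<open>card_of (shell n)\<close> has field \<open>shell n\<close>, so
  restrictions to the shells are directly elements of the powers of Z(2).\<close>

definition shell_map :: "('a \<Rightarrow> int) \<Rightarrow> nat \<Rightarrow> 'a \<Rightarrow> int" where
  "shell_map f = (\<lambda>n. restrict f (shell n))"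

lemma openin_subtopology_vanishing:
  "openin (subtopology (Ck2_topology X) vanishing) W \<longleftrightarrow>
     W \<subseteq> vanishing \<and> (\<forall>f\<in>W. \<exists>K. compactin X K \<and> agree X f K \<subseteq> W)"
proof -
  have "vanishing = agree X (\<lambda>x\<in>topspace X. 0) D" using D_sub by (auto simp: vanishing_def agree_def)
  then have "openin (Ck2_topology X) vanishing" using openin_Ck2_agree[OF zero_in_CF2 compact_D] by simp
  then have "openin (subtopology (Ck2_topology X) vanishing) W \<longleftrightarrow> openin (Ck2_topology X) W \<and> W \<subseteq> vanishing"
    by (rule openin_open_subtopology)
  then show ?thesis unfolding openin_Ck2 by (auto simp: vanishing_def)
qed

text \<open>Finite support of the image means vanishing on some \<open>A N\<close>.
  \<open>agree_near_D\<close>, applied to \<open>f\<close> and 0, yields such an \<open>N\<close>;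
  conversely \<open>CF2_modify\<close> makes any choice of values on the finitely many remaining
  shells continuous.\<close>

lemma bij_betw_shell_map:
  "bij_betw shell_map vanishing (carrier (sum_group UNIV (\<lambda>n. Z2_power_group (card_of (shell n)))))"
  (is "bij_betw shell_map vanishing ?S")
proof -
  have S: "h \<in> ?S \<longleftrightarrow> (\<forall>n. h n \<in> PiE (shell n) (\<lambda>_. {0, 1})) \<and> finite {n. h n \<noteq> (\<lambda>x\<in>shell n. 0)}" for h
    unfolding carrier_sum_Z2_power Field_card_of by simp
  have inj: "inj_on shell_map vanishing"
  proof (rule inj_onI)
    fix f g assume fg: "f \<in> vanishing" "g \<in> vanishing" "shell_map f = shell_map g"
    show "f = g"
    proof (rule CF2_ext[of _ X])
      fix x assume x: "x \<in> topspace X"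
      show "f x = g x"
      proof (cases "x \<in> D")
        case True
        then show ?thesis using fg by (simp add: vanishing_def)
      next
        case False
        then have xs: "x \<in> shell (level x)" using shell_level x by simp
        have "shell_map f (level x) x = shell_map g (level x) x" using fg(3) by simp
        then show ?thesis using xs by (simp add: shell_map_def)
      qed
    qed (use fg in \<open>auto simp: vanishing_def\<close>)
  qed
  have "shell_map f \<in> ?S" if f: "f \<in> vanishing" for f
    unfolding S
  proof
    have fC: "f \<in> CF2 X" using f by (simp add: vanishing_def)
    show "\<forall>n. shell_map f n \<in> PiE (shell n) (\<lambda>_. {0, 1})"
      using CF2_01[OF fC] shell_sub by (fastforce simp: shell_map_def)
    have "f x = (\<lambda>x\<in>topspace X. 0) x" if "x \<in> D" for x
      using f D_sub that by (auto simp: vanishing_def)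
    from agree_near_D[OF fC zero_in_CF2 this]
    obtain N where N: "\<forall>x\<in>A N. f x = (\<lambda>x\<in>topspace X. 0) x" by (rule exE)
    have "n < N" if n: "shell_map f n \<noteq> (\<lambda>x\<in>shell n. 0)" for n
    proof (rule ccontr)
      assume "\<not> n < N"
      then have sub: "A n \<subseteq> A N" by (intro A_mono) simp
      have "f x = 0" if "x \<in> shell n" for x
      proof -
        have "x \<in> A N" using that sub by (auto simp: shell_def)
        then show ?thesis using N A_sub[of N] by auto
      qed
      then have "shell_map f n = (\<lambda>x\<in>shell n. 0)" unfolding shell_map_def by (intro restrict_ext)
      with n show False ..
    qed
    then have "{n. shell_map f n \<noteq> (\<lambda>x\<in>shell n. 0)} \<subseteq> {..<N}" by auto
    then show "finite {n. shell_map f n \<noteq> (\<lambda>x\<in>shell n. 0)}" using finite_subset by blast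
  qed
  moreover have "h \<in> shell_map ` vanishing" if "h \<in> ?S" for h
  proof -
    have h: "\<And>n. h n \<in> PiE (shell n) (\<lambda>_. {0, 1})" "finite {n. h n \<noteq> (\<lambda>x\<in>shell n. 0)}"
      using that unfolding S by auto
    obtain N where N: "\<forall>n\<in>{n. h n \<noteq> (\<lambda>x\<in>shell n. 0)}. n < N"
      using h(2) finite_nat_set_iff_bounded by blast
    define f where "f = (\<lambda>x\<in>topspace X. if x \<in> D then 0 else h (level x) x)"
    have fD: "f x = 0" if "x \<in> D" for x using that D_sub by (auto simp: f_def)
    have fs: "f x = h n x" if "x \<in> shell n" for x n
    proof -
      have "x \<in> topspace X" "x \<notin> D" using shell_sub that by auto
      then show ?thesis using level_shell[OF that] by (simp add: f_def)
    qed
    have "f \<in> CF2 X"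
    proof (rule CF2_modify[OF zero_in_CF2])
      show "f \<in> extensional (topspace X)" unfolding f_def by (rule restrict_extensional)
      show "f x \<in> {0, 1}" if x: "x \<in> topspace X" for x
      proof (cases "x \<in> D")
        case False
        then have xs: "x \<in> shell (level x)" using shell_level x by simp
        then show ?thesis using PiE_mem[OF h(1) xs] fs[OF xs] by simp
      qed (simp add: fD)
      fix x assume x: "x \<in> A N"
      then have xt: "x \<in> topspace X" using A_sub[of N] by auto
      have "f x = 0"
      proof (cases "x \<in> D")
        case False
        then have xs: "x \<in> shell (level x)" using shell_level xt by simp
        have "N \<le> level x"
        proof (rule ccontr)
          assume "\<not> N \<le> level x"
          then have "A N \<subseteq> A (Suc (level x))" by (intro A_mono) simp
          with x xs show False by (auto simp: shell_def)
        qed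
        then have "h (level x) = (\<lambda>x\<in>shell (level x). 0)" using N by force
        then show ?thesis using fs[OF xs] xs by simp
      qed (simp add: fD)
      then show "f x = (\<lambda>x\<in>topspace X. 0) x" using xt by simp
    qed
    then have "f \<in> vanishing" using fD by (simp add: vanishing_def)
    moreover have "shell_map f = h"
    proof
      fix n
      show "shell_map f n = h n"
      proof (rule extensionalityI[of _ "shell n"])
        show "h n \<in> extensional (shell n)" using h(1)[of n] by (simp add: PiE_iff)
        show "shell_map f n \<in> extensional (shell n)" unfolding shell_map_def by (rule restrict_extensional)
        show "shell_map f n x = h n x" if "x \<in> shell n" for x using that fs by (simp add: shell_map_def)
      qed
    qed
    ultimately show ?thesis by blast
  qed
  ultimately have "shell_map ` vanishing = ?S" by auto
  with inj show ?thesis by (simp add: bij_betw_def)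
qed

text \<open>A compact \<open>K\<close> yields the finite sets \<open>K \<inter> shell n\<close>, and
  finite sets \<open>F n\<close> in the shells yield the compact set
  \<open>D \<union> (\<Union>n. F n)\<close>. On \<open>D\<close> all functions concerned vanish, so
  nothing has to be compared there.\<close>

lemma homeomorphic_map_shell_map:
  "homeomorphic_map (subtopology (Ck2_topology X) vanishing)
     (box_sum_topology UNIV (\<lambda>n. Z2_power_group (card_of (shell n)))
        (\<lambda>n. Z2_power_topology (card_of (shell n)))) shell_map"
  (is "homeomorphic_map ?T ?B shell_map")
proof (rule homeomorphic_map_openinI)
  let ?S = "carrier (sum_group UNIV (\<lambda>n. Z2_power_group (card_of (shell n))))"
  have HC: "vanishing \<subseteq> CF2 X" by (auto simp: vanishing_def)
  then have tT: "topspace ?T = vanishing" by auto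
  have im: "shell_map ` vanishing = ?S" using bij_betw_shell_map by (simp add: bij_betw_def)
  show "bij_betw shell_map (topspace ?T) (topspace ?B)"
    unfolding tT topspace_box_sum_Z2_power by (rule bij_betw_shell_map)
  fix W assume "openin ?T W"
  then have W: "W \<subseteq> vanishing" "\<forall>f\<in>W. \<exists>K. compactin X K \<and> agree X f K \<subseteq> W"
    unfolding openin_subtopology_vanishing by auto
  show "openin ?B (shell_map ` W)"
    unfolding openin_box_sum_Z2_power Field_card_of
  proof (intro conjI ballI)
    show "shell_map ` W \<subseteq> ?S" using W(1) im by auto
    fix g assume "g \<in> shell_map ` W"
    then obtain f where f: "f \<in> W" "g = shell_map f" by auto
    obtain K where K: "compactin X K" "agree X f K \<subseteq> W" using W(2) f(1) by auto
    show "\<exists>F. (\<forall>n. finite (F n) \<and> F n \<subseteq> shell n) \<and>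
        (\<forall>h\<in>?S. (\<forall>n. \<forall>x\<in>F n. h n x = g n x) \<longrightarrow> h \<in> shell_map ` W)"
    proof (intro exI[of _ "\<lambda>n. K \<inter> shell n"] conjI allI ballI impI)
      fix n
      show "K \<inter> shell n \<subseteq> shell n" by auto
      show "finite (K \<inter> shell n)"
        using finite_compact_diff[OF K(1), of "Suc n"] by (rule rev_finite_subset) (auto simp: shell_def)
    next
      fix h assume "h \<in> ?S" and hg: "\<forall>n. \<forall>x\<in>K \<inter> shell n. h n x = g n x"
      then obtain f' where f': "f' \<in> vanishing" "h = shell_map f'" using im by blast
      have "f' x = f x" if x: "x \<in> K" for x
      proof (cases "x \<in> D")
        case True
        then show ?thesis using f' f(1) W(1) by (auto simp: vanishing_def)
      next
        case False
        have "x \<in> topspace X" using x compactin_subset_topspace[OF K(1)] by auto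
        then have xs: "x \<in> shell (level x)" using shell_level False by simp
        then have "h (level x) x = g (level x) x" using hg x by simp
        then show ?thesis using xs by (simp add: f'(2) f(2) shell_map_def)
      qed
      then have "f' \<in> agree X f K" using f'(1) HC by (auto simp: agree_def)
      then show "h \<in> shell_map ` W" using K(2) f'(2) by auto
    qed
  qed
next
  fix V assume "openin ?B V"
  then have V: "\<forall>g\<in>V. \<exists>F. (\<forall>n. finite (F n) \<and> F n \<subseteq> shell n) \<and>
        (\<forall>h\<in>carrier (sum_group UNIV (\<lambda>n. Z2_power_group (card_of (shell n)))).
          (\<forall>n. \<forall>x\<in>F n. h n x = g n x) \<longrightarrow> h \<in> V)"
    unfolding openin_box_sum_Z2_power Field_card_of by (rule conjunct2)
  have im: "shell_map f \<in> carrier (sum_group UNIV (\<lambda>n. Z2_power_group (card_of (shell n))))" if "f \<in> vanishing" for f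
    using bij_betw_shell_map that by (rule bij_betwE[rule_format])
  have tT: "topspace ?T = vanishing" by (auto simp: vanishing_def)
  show "openin ?T {f \<in> topspace ?T. shell_map f \<in> V}"
    unfolding openin_subtopology_vanishing tT
  proof (intro conjI ballI)
    fix f assume f: "f \<in> {f \<in> vanishing. shell_map f \<in> V}"
    then obtain F where F: "\<And>n. finite (F n)" "\<And>n. F n \<subseteq> shell n"
      "\<And>h. h \<in> carrier (sum_group UNIV (\<lambda>n. Z2_power_group (card_of (shell n)))) \<Longrightarrow>
          (\<And>n x. x \<in> F n \<Longrightarrow> h n x = shell_map f n x) \<Longrightarrow> h \<in> V"
      using V by (metis (no_types, lifting) mem_Collect_eq)
    have "compactin X (D \<union> (\<Union>n. F n))"
    proof (rule compact_Un_locally_finite)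
      show "(\<Union>n. F n) \<subseteq> topspace X" using F(2) shell_sub by blast
      fix n
      have "(\<Union>m. F m) - A n \<subseteq> (\<Union>m<n. F m)"
      proof
        fix x assume "x \<in> (\<Union>m. F m) - A n"
        then obtain m where m: "x \<in> F m" "x \<notin> A n" by auto
        have "x \<in> A m" using m(1) F(2)[of m] by (auto simp: shell_def)
        then have "m < n" using m(2) A_mono[of n m] by (meson not_le subsetD)
        then show "x \<in> (\<Union>m<n. F m)" using m(1) by auto
      qed
      moreover have "finite (\<Union>m<n. F m)" using F(1) by simp
      ultimately show "finite ((\<Union>m. F m) - A n)" by (rule finite_subset)
    qed
    moreover have "agree X f (D \<union> (\<Union>n. F n)) \<subseteq> {f \<in> vanishing. shell_map f \<in> V}"
    proof
      fix f' assume f': "f' \<in> agree X f (D \<union> (\<Union>n. F n))"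
      then have vanishing: "f' \<in> vanishing" using f by (auto simp: agree_def vanishing_def)
      have "shell_map f' n x = shell_map f n x" if x: "x \<in> F n" for n x
      proof -
        have "f' x = f x" using f' x by (auto simp: agree_def)
        then show ?thesis by (simp add: shell_map_def restrict_def)
      qed
      then have "shell_map f' \<in> V" by (rule F(3)[OF im[OF vanishing]])
      with vanishing show "f' \<in> {f \<in> vanishing. shell_map f \<in> V}" by simp
    qed
    ultimately show "\<exists>K. compactin X K \<and> agree X f K \<subseteq> {f \<in> vanishing. shell_map f \<in> V}" by meson
  qed auto
qed

lemma iso_shell_map:
  "shell_map \<in> iso ((Ck2_group X)\<lparr>carrier := vanishing\<rparr>) (sum_group UNIV (\<lambda>n. Z2_power_group (card_of (shell n))))"
proof (rule isoI)
  show "shell_map \<in> hom ((Ck2_group X)\<lparr>carrier := vanishing\<rparr>) (sum_group UNIV (\<lambda>n. Z2_power_group (card_of (shell n))))"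
  proof (rule homI)
    fix f assume "f \<in> carrier ((Ck2_group X)\<lparr>carrier := vanishing\<rparr>)"
    then show "shell_map f \<in> carrier (sum_group UNIV (\<lambda>n. Z2_power_group (card_of (shell n))))"
      using bij_betwE[OF bij_betw_shell_map] by simp
  next
    fix f g
    show "shell_map (f \<otimes>\<^bsub>(Ck2_group X)\<lparr>carrier := vanishing\<rparr>\<^esub> g) = shell_map f \<otimes>\<^bsub>sum_group UNIV (\<lambda>n. Z2_power_group (card_of (shell n)))\<^esub> shell_map g"
    proof (intro ext)
      fix n x
      have "shell n \<subseteq> topspace X" using shell_sub by auto
      then show "shell_map (f \<otimes>\<^bsub>(Ck2_group X)\<lparr>carrier := vanishing\<rparr>\<^esub> g) n x =
          (shell_map f \<otimes>\<^bsub>sum_group UNIV (\<lambda>n. Z2_power_group (card_of (shell n)))\<^esub> shell_map g) n x"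
        by (auto simp: shell_map_def restrict_def Field_card_of)
    qed
  qed
qed (use bij_betw_shell_map in simp)

end

section \<open>Compact open partitions\<close>

lemma restrict_in_CF2:
  assumes f: "f \<in> CF2 X" and K: "K \<subseteq> topspace X"
  shows "restrict f K \<in> CF2 (subtopology X K)"
proof (rule CF2I)
  have top: "topspace (subtopology X K) = K" using K by auto
  show "restrict f K \<in> extensional (topspace (subtopology X K))" unfolding top by (rule restrict_extensional)
  fix x assume "x \<in> topspace (subtopology X K)"
  then have x: "x \<in> K" "x \<in> topspace X" by auto
  show "restrict f K x \<in> {0, 1}" using CF2_01[OF f x(2)] x(1) by simp
  obtain U where U: "openin X U" "x \<in> U" "U \<subseteq> {y. f y = f x}" using CF2_local[OF f x(2)] by meson
  have "K \<inter> U \<subseteq> {y. restrict f K y = restrict f K x}"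
  proof
    fix y assume y: "y \<in> K \<inter> U"
    then have "f y = f x" using U(3) by auto
    then show "y \<in> {y. restrict f K y = restrict f K x}" using x(1) y by simp
  qed
  then show "\<exists>U. openin (subtopology X K) U \<and> x \<in> U \<and> U \<subseteq> {y. restrict f K y = restrict f K x}"
    using U x by (intro exI[of _ "K \<inter> U"]) (auto intro: openin_subtopology_Int2)
qed

text \<open>The pieces serve as their own indices, which fits the index type of the product in the
  theorem.\<close>

locale compact_open_partition =
  fixes X :: "'a topology" and I :: "'a set set"
  assumes compact: "\<And>K. K \<in> I \<Longrightarrow> compactin X K"
    and opn: "\<And>K. K \<in> I \<Longrightarrow> openin X K"
    and disj: "\<And>K L. K \<in> I \<Longrightarrow> L \<in> I \<Longrightarrow> K \<noteq> L \<Longrightarrow> K \<inter> L = {}"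
    and cover: "\<Union>I = topspace X"
begin

abbreviation C :: "'a set \<Rightarrow> ('a \<Rightarrow> int) set" where "C K \<equiv> CF2 (subtopology X K)"

definition piece_map :: "('a \<Rightarrow> int) \<Rightarrow> 'a set \<Rightarrow> 'a \<Rightarrow> int" where
  "piece_map f = (\<lambda>K\<in>I. restrict f K)"

lemma topspace_piece: "K \<in> I \<Longrightarrow> topspace (subtopology X K) = K"
  using compactin_subset_topspace[OF compact] by auto

lemma piece:
  assumes "x \<in> topspace X" obtains K where "K \<in> I" "x \<in> K"
  using assms cover by blast

lemma piece_map_val: "K \<in> I \<Longrightarrow> x \<in> K \<Longrightarrow> piece_map f K x = f x"
  by (simp add: piece_map_def)

text \<open>The pieces are open and disjoint, so continuous functions on them glue.\<close>

lemma bij_betw_piece_map: "bij_betw piece_map (CF2 X) (PiE I C)"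
proof -
  have inj: "inj_on piece_map (CF2 X)"
  proof (rule inj_onI)
    fix f g assume fg: "f \<in> CF2 X" "g \<in> CF2 X" "piece_map f = piece_map g"
    show "f = g"
    proof (rule CF2_ext[OF fg(1,2)])
      fix x assume "x \<in> topspace X"
      then obtain K where "K \<in> I" "x \<in> K" by (rule piece)
      then show "f x = g x" using piece_map_val[of K x f] piece_map_val[of K x g] fg(3) by simp
    qed
  qed
  have into: "piece_map f \<in> PiE I C" if "f \<in> CF2 X" for f
    unfolding piece_map_def using restrict_in_CF2[OF that] compactin_subset_topspace[OF compact]
    by (intro restrict_PiE_iff[THEN iffD2] ballI) blast
  have "h \<in> piece_map ` CF2 X" if h: "h \<in> PiE I C" for h
  proof -
    have "\<forall>x\<in>topspace X. \<exists>K. K \<in> I \<and> x \<in> K" using cover by auto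
    from bchoice[OF this] obtain c where c: "\<And>x. x \<in> topspace X \<Longrightarrow> c x \<in> I \<and> x \<in> c x" by auto
    define f where "f = (\<lambda>x\<in>topspace X. h (c x) x)"
    have hC: "h K \<in> C K" if "K \<in> I" for K using PiE_mem[OF h that] .
    have fK: "f x = h K x" if K: "K \<in> I" "x \<in> K" for x K
    proof -
      have x: "x \<in> topspace X" using K cover by auto
      then have "c x = K" using c[OF x] disj[of "c x" K] K by auto
      then show ?thesis using x by (simp add: f_def)
    qed
    have "f \<in> CF2 X"
    proof (rule CF2I)
      show "f \<in> extensional (topspace X)" unfolding f_def by (rule restrict_extensional)
      fix x assume "x \<in> topspace X"
      then obtain K where K: "K \<in> I" "x \<in> K" by (rule piece)
      then have x: "x \<in> topspace (subtopology X K)" by (simp only: topspace_piece)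
      show "f x \<in> {0, 1}" using CF2_01[OF hC[OF K(1)] x] fK[OF K] by simp
      obtain U where U: "openin (subtopology X K) U" "x \<in> U" "U \<subseteq> {y. h K y = h K x}"
        using CF2_local[OF hC[OF K(1)] x] by meson
      have UK: "U \<subseteq> K" "openin X U"
        using U(1) openin_open_subtopology[OF opn[OF K(1)]] by auto
      have "U \<subseteq> {y. f y = f x}"
      proof
        fix y assume y: "y \<in> U"
        then have "h K y = h K x" using U(3) by auto
        then show "y \<in> {y. f y = f x}" using fK[OF K] fK[OF K(1), of y] UK(1) y by auto
      qed
      then show "\<exists>U. openin X U \<and> x \<in> U \<and> U \<subseteq> {y. f y = f x}" using UK(2) U(2) by meson
    qed
    moreover have "piece_map f = h"
    proof (rule extensionalityI[of _ I])
      show "piece_map f \<in> extensional I" unfolding piece_map_def by (rule restrict_extensional)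
      show "h \<in> extensional I" using h by (simp add: PiE_iff)
      fix K assume K: "K \<in> I"
      show "piece_map f K = h K"
      proof (rule CF2_ext[of _ "subtopology X K"])
        show "piece_map f K \<in> C K" using PiE_mem[OF into[OF \<open>f \<in> CF2 X\<close>] K] .
        show "piece_map f K x = h K x" if "x \<in> topspace (subtopology X K)" for x
          using that piece_map_val[OF K] fK[OF K] by (simp only: topspace_piece[OF K])
      qed (rule hC[OF K])
    qed
    ultimately show ?thesis by (metis image_eqI)
  qed
  with into have "piece_map ` CF2 X = PiE I C" by auto
  with inj show ?thesis by (simp add: bij_betw_def)
qed

text \<open>A compact set is covered by finitely many pieces, and a finite union of pieces is
  compact. Fixing the values on a compact set and fixing finitely many components therefore give the
  same topology; the factors are discrete because each piece is itself compact.\<close>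

lemma homeomorphic_map_piece_map:
  "homeomorphic_map (Ck2_topology X) (product_topology (\<lambda>K. discrete_topology (C K)) I) piece_map"
  (is "homeomorphic_map _ ?P piece_map")
proof (rule homeomorphic_map_openinI)
  show "bij_betw piece_map (topspace (Ck2_topology X)) (topspace ?P)" using bij_betw_piece_map by simp
  have im: "piece_map ` CF2 X = PiE I C" using bij_betw_piece_map by (simp add: bij_betw_def)
  fix W assume W: "openin (Ck2_topology X) W"
  then have WC: "W \<subseteq> CF2 X" unfolding openin_Ck2 by (rule conjunct1)
  show "openin ?P (piece_map ` W)"
    unfolding openin_product_discrete
  proof (intro conjI ballI)
    show "piece_map ` W \<subseteq> PiE I C" using image_mono[OF WC, of piece_map] im by simp
    fix h assume "h \<in> piece_map ` W"
    then obtain f where f: "f \<in> W" "h = piece_map f" by auto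
    obtain L where L: "compactin X L" "agree X f L \<subseteq> W"
      using bspec[OF conjunct2[OF W[unfolded openin_Ck2]] f(1)] by (elim exE conjE)
    have "L \<subseteq> \<Union>I" using compactin_subset_topspace[OF L(1)] cover by simp
    then obtain J where J: "finite J" "J \<subseteq> I" "L \<subseteq> \<Union>J"
      using compactinD[OF L(1), of I] opn by meson
    have "h' \<in> piece_map ` W" if h': "h' \<in> PiE I C" "\<forall>K\<in>J. h' K = h K" for h'
    proof -
      obtain f' where f': "f' \<in> CF2 X" "h' = piece_map f'" using h'(1) im by (metis imageE)
      have "f' x = f x" if "x \<in> L" for x
      proof -
        obtain K where K: "K \<in> J" "x \<in> K" using J(3) \<open>x \<in> L\<close> by auto
        then have "piece_map f' K x = piece_map f K x" using h'(2) f'(2) f(2) by simp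
        then show ?thesis using piece_map_val[of K x] K J(2) by auto
      qed
      then have "f' \<in> agree X f L" using f'(1) by (simp add: agree_def)
      then show ?thesis using L(2) f'(2) by auto
    qed
    with J show "\<exists>J. finite J \<and> J \<subseteq> I \<and> (\<forall>h'\<in>PiE I C. (\<forall>K\<in>J. h' K = h K) \<longrightarrow> h' \<in> piece_map ` W)"
      by (intro exI[of _ J]) simp
  qed
next
  fix V assume V: "openin ?P V"
  show "openin (Ck2_topology X) {f \<in> topspace (Ck2_topology X). piece_map f \<in> V}"
    unfolding openin_Ck2 topspace_Ck2
  proof (intro conjI ballI)
    fix f assume f: "f \<in> {f \<in> CF2 X. piece_map f \<in> V}"
    then have "piece_map f \<in> V" by simp
    then obtain J where J: "finite J" "J \<subseteq> I" "\<forall>h\<in>PiE I C. (\<forall>K\<in>J. h K = piece_map f K) \<longrightarrow> h \<in> V"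
      using bspec[OF conjunct2[OF V[unfolded openin_product_discrete]]] by (metis (no_types, lifting))
    have "compactin X (\<Union>J)" using J(1,2) compact by (intro compactin_Union) auto
    moreover have "agree X f (\<Union>J) \<subseteq> {f \<in> CF2 X. piece_map f \<in> V}"
    proof
      fix g assume "g \<in> agree X f (\<Union>J)"
      then have g: "g \<in> CF2 X" "\<forall>x\<in>\<Union>J. g x = f x" unfolding agree_def by blast+
      have "piece_map g K = piece_map f K" if K: "K \<in> J" for K
      proof -
        have "restrict g K = restrict f K" using g(2) K by (intro restrict_ext) auto
        then show ?thesis using K J(2) by (auto simp: piece_map_def)
      qed
      moreover have "piece_map g \<in> PiE I C" using bij_betw_piece_map g(1) by (metis bij_betwE)
      ultimately show "g \<in> {f \<in> CF2 X. piece_map f \<in> V}" using J(3) g(1) by simp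
    qed
    ultimately show "\<exists>L. compactin X L \<and> agree X f L \<subseteq> {f \<in> CF2 X. piece_map f \<in> V}" by meson
  qed auto
qed

lemma iso_piece_map: "piece_map \<in> iso (Ck2_group X) (product_group I (\<lambda>K. Ck2_group (subtopology X K)))"
proof (rule isoI)
  show "piece_map \<in> hom (Ck2_group X) (product_group I (\<lambda>K. Ck2_group (subtopology X K)))"
  proof (rule homI)
    fix f assume "f \<in> carrier (Ck2_group X)"
    then show "piece_map f \<in> carrier (product_group I (\<lambda>K. Ck2_group (subtopology X K)))"
      using bij_betwE[OF bij_betw_piece_map] by simp
  next
    fix f g
    show "piece_map (f \<otimes>\<^bsub>Ck2_group X\<^esub> g) = piece_map f \<otimes>\<^bsub>product_group I (\<lambda>K. Ck2_group (subtopology X K))\<^esub> piece_map g"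
    proof
      fix K
      show "piece_map (f \<otimes>\<^bsub>Ck2_group X\<^esub> g) K =
        (piece_map f \<otimes>\<^bsub>product_group I (\<lambda>K. Ck2_group (subtopology X K))\<^esub> piece_map g) K"
      proof (cases "K \<in> I")
        case True
        then have "K \<subseteq> topspace X" using cover by auto
        then show ?thesis using topspace_piece[OF True] True
          by (auto simp: piece_map_def restrict_def fun_eq_iff)
      qed (simp add: piece_map_def)
    qed
  qed
qed (use bij_betw_piece_map in simp)

lemma kR_space_Ck2: "kR_space (Ck2_topology X)"
  using kR_space_homeomorphic[OF _ kR_space_product_discrete]
    homeomorphic_map_imp_homeomorphic_space[OF homeomorphic_map_piece_map] homeomorphic_space_sym by metis

end

section \<open>The groups of the compact pieces are countable and Polish\<close>

lemma Polish_abelian_group_countable_discrete: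
  assumes "comm_group G" "countable (carrier G)"
  shows "Polish_abelian_group G (discrete_topology (carrier G))"
  unfolding Polish_abelian_group_def
  using assms discrete_topological_group[OF comm_group.axioms(2)[OF assms(1)] refl]
  by (simp add: separable_space_discrete_topology completely_metrizable_space_discrete_topology)

text \<open>By a Lebesgue number every continuous two-valued function on \<open>K\<close> lies in
  some \<open>S n\<close>, meaning that it takes equal values at points closer than 1/(n+1). Such a
  function is determined by its values on a finite net of that mesh, so each \<open>S n\<close> is
  finite.\<close>

lemma (in Metric_space) countable_CF2:
  assumes K: "compactin mtopology K"
  shows "countable (CF2 (subtopology mtopology K))"
proof -
  let ?Y = "subtopology mtopology K" and ?r = "\<lambda>n. inverse (real (Suc n))"
  have KM: "K \<subseteq> M" using compactin_subset_topspace[OF K] by simp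
  have top: "topspace ?Y = K" using KM by auto
  define S where "S n = {f \<in> CF2 ?Y. \<forall>x\<in>K. \<forall>y\<in>K. d x y < ?r n \<longrightarrow> f x = f y}" for n
  have fin: "finite (S n)" for n
  proof -
    have "K \<subseteq> \<Union>((\<lambda>x. mball x (?r n)) ` K)" using KM by auto
    then obtain \<F> where \<F>: "finite \<F>" "\<F> \<subseteq> (\<lambda>x. mball x (?r n)) ` K" "K \<subseteq> \<Union>\<F>"
      using compactinD[OF K, of "(\<lambda>x. mball x (?r n)) ` K"] by (metis (no_types, lifting) imageE openin_mball)
    obtain F where F: "finite F" "F \<subseteq> K" "\<F> = (\<lambda>x. mball x (?r n)) ` F"
      using finite_subset_image[OF \<F>(1,2)] by auto
    have "inj_on (\<lambda>f. restrict f F) (S n)"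
    proof (rule inj_onI)
      fix f g assume f: "f \<in> S n" and g: "g \<in> S n" and eq: "restrict f F = restrict g F"
      show "f = g"
      proof (rule CF2_ext[of _ ?Y])
        fix x assume "x \<in> topspace ?Y"
        then have x: "x \<in> K" by simp
        then obtain y where y: "y \<in> F" "x \<in> mball y (?r n)" using \<F>(3) F(3) by auto
        then have "d y x < ?r n" "y \<in> K" using F(2) by auto
        then have "f y = f x" "g y = g x" using f g x unfolding S_def by blast+
        moreover have "f y = g y" using fun_cong[OF eq, of y] y(1) by simp
        ultimately show "f x = g x" by simp
      qed (use f g in \<open>auto simp: S_def\<close>)
    qed
    moreover have "(\<lambda>f. restrict f F) ` S n \<subseteq> PiE F (\<lambda>_. {0, 1})"
    proof (rule image_subsetI)
      fix f assume "f \<in> S n"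
      then have "f \<in> CF2 ?Y" by (simp add: S_def)
      then have "f x \<in> {0, 1}" if "x \<in> F" for x using CF2_01[of f ?Y x] that F(2) unfolding top by auto
      then show "restrict f F \<in> PiE F (\<lambda>_. {0, 1})" by (simp add: PiE_iff)
    qed
    moreover have "finite (PiE F (\<lambda>_. {0, 1::int}))" using F(1) by (intro finite_PiE) auto
    ultimately show ?thesis by (meson finite_imageD finite_subset)
  qed
  have "CF2 ?Y \<subseteq> (\<Union>n. S n)"
  proof
    fix f assume f: "f \<in> CF2 ?Y"
    \<comment> \<open>Open sets of the whole space on whose trace in \<open>K\<close> the function
      is constant, as \<open>lebesgue_number\<close> works with open sets of the ambient
      space.\<close>
    define \<C> where "\<C> = {U. openin mtopology U \<and> (\<forall>x\<in>U \<inter> K. \<forall>y\<in>U \<inter> K. f x = f y)}"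
    have "K \<subseteq> \<Union>\<C>"
    proof
      fix x assume x: "x \<in> K"
      obtain U where U: "openin ?Y U" "x \<in> U" "U \<subseteq> {y. f y = f x}"
        using CF2_local[OF f, of x] x unfolding top by meson
      obtain T where T: "openin mtopology T" "U = T \<inter> K" using U(1) unfolding openin_subtopology by blast
      have "f y = f x" if "y \<in> T \<inter> K" for y using U(3) that T(2) by auto
      then have "T \<in> \<C>" using T(1) unfolding \<C>_def by simp
      then show "x \<in> \<Union>\<C>" using U(2) T(2) by auto
    qed
    moreover have "openin mtopology U" if "U \<in> \<C>" for U using that by (simp add: \<C>_def)
    ultimately obtain e where e: "e > 0" "\<forall>x\<in>K. \<exists>U\<in>\<C>. mball x e \<subseteq> U"
      using lebesgue_number[OF K] by meson
    obtain n where n: "?r n < e" using reals_Archimedean[OF e(1)] by auto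
    have "f x = f y" if xy: "x \<in> K" "y \<in> K" "d x y < ?r n" for x y
    proof -
      obtain U where U: "U \<in> \<C>" "mball x e \<subseteq> U" using e(2) xy(1) by auto
      have "x \<in> M" "y \<in> M" using xy KM by auto
      then have "x \<in> mball x e" "y \<in> mball x e" using e(1) n xy(3) by auto
      then have "x \<in> U \<inter> K" "y \<in> U \<inter> K" using U(2) xy by auto
      then show ?thesis using U(1) unfolding \<C>_def by blast
    qed
    then have "f \<in> S n" using f by (simp add: S_def)
    then show "f \<in> (\<Union>n. S n)" by blast
  qed
  moreover have "countable (\<Union>n. S n)" using fin by (simp add: countable_finite)
  ultimately show ?thesis by (rule countable_subset)
qed

section \<open>Locally compact zero-dimensional metric spaces\<close>

context Metric_space
begin

text \<open>Capping the radius at 1 keeps the supremum finite when all closed balls are compact.\<close>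

definition compact_radius :: "'a \<Rightarrow> real" where
  "compact_radius x = Sup {r. 0 < r \<and> r \<le> 1 \<and> compactin mtopology (mcball x r)}"

lemma compact_radius_props:
  assumes lc: "locally_compact_space mtopology" and x: "x \<in> M"
  shows "0 < compact_radius x"
    and "s < compact_radius x \<Longrightarrow> compactin mtopology (mcball x s)"
    and "0 < r \<Longrightarrow> r \<le> 1 \<Longrightarrow> compactin mtopology (mcball x r) \<Longrightarrow> r \<le> compact_radius x"
    and "compact_radius x \<le> 1"
proof -
  let ?S = "{r. 0 < r \<and> r \<le> 1 \<and> compactin mtopology (mcball x r)}"
  have bdd: "bdd_above ?S" by (rule bdd_aboveI[of _ 1]) simp
  obtain U K where U: "openin mtopology U" "compactin mtopology K" "x \<in> U" "U \<subseteq> K"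
    using lc x unfolding locally_compact_space_def topspace_mtopology by meson
  obtain r where r: "r > 0" "mcball x r \<subseteq> U" using U(1,3) unfolding openin_mtopology_mcball by meson
  have "mcball x (min r 1) \<subseteq> K" using r(2) U(4) mcball_subset_concentric[of "min r 1" r x] by auto
  then have "compactin mtopology (mcball x (min r 1))" using closed_compactin[OF U(2)] by simp
  then have rS: "min r 1 \<in> ?S" using r(1) by simp
  have "min r 1 \<le> compact_radius x" unfolding compact_radius_def by (rule cSup_upper[OF rS bdd])
  then show "0 < compact_radius x" using r(1) by linarith
  show "compact_radius x \<le> 1"
    unfolding compact_radius_def by (rule cSup_least) (use rS in blast, simp)
  show "r \<le> compact_radius x" if "0 < r" "r \<le> 1" "compactin mtopology (mcball x r)" for r
    unfolding compact_radius_def using that by (intro cSup_upper[OF _ bdd]) simp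
  show "compactin mtopology (mcball x s)" if s: "s < compact_radius x" for s
  proof -
    obtain t where t: "t \<in> ?S" "s < t" using less_cSupD[of ?S s] rS s unfolding compact_radius_def by blast
    then have "mcball x s \<subseteq> mcball x t" by (intro mcball_subset_concentric) simp
    then show ?thesis using closed_compactin[of mtopology "mcball x t" "mcball x s"] t(1) by simp
  qed
qed

text \<open>The radius is 1-Lipschitz: a ball around \<open>y\<close> whose radius is smaller by
  \<open>d x y\<close> is a closed subset of a compact ball around \<open>x\<close>.\<close>

lemma compact_radius_le:
  assumes lc: "locally_compact_space mtopology" and x: "x \<in> M" and y: "y \<in> M"
  shows "compact_radius x \<le> compact_radius y + d x y"
proof (rule ccontr)
  assume "\<not> ?thesis"
  then have lt: "compact_radius y + d x y < compact_radius x" by simp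
  \<comment> \<open>The midpoint lies strictly below the radius at \<open>x\<close>, so the ball is
    compact even if the supremum is not attained.\<close>
  define s where "s = (compact_radius y + d x y + compact_radius x) / 2"
  have s: "compact_radius y + d x y < s" "s < compact_radius x" using lt by (auto simp: s_def)
  have "compactin mtopology (mcball x s)" by (rule compact_radius_props(2)[OF lc x s(2)])
  moreover have "mcball y (s - d x y) \<subseteq> mcball x s"
    using x by (intro mcball_subset) (simp_all add: commute)
  ultimately have "compactin mtopology (mcball y (s - d x y))"
    using closed_compactin[of mtopology "mcball x s" "mcball y (s - d x y)"] by simp
  moreover have "0 < s - d x y" using s(1) compact_radius_props(1)[OF lc y] by linarith
  moreover have "s - d x y \<le> 1"
    using s(2) compact_radius_props(4)[OF lc x] nonneg[of x y] by linarith
  ultimately have "s - d x y \<le> compact_radius y" by (intro compact_radius_props(3)[OF lc y])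
  with s(1) show False by linarith
qed

text \<open>Both radii enter to make the relation symmetric. With the factor 1/4 a ball of a quarter
  of the radius, followed by one step, stays inside a compact ball.\<close>

definition near :: "'a \<Rightarrow> 'a \<Rightarrow> bool" where
  "near x y \<longleftrightarrow> x \<in> M \<and> y \<in> M \<and> d x y < compact_radius x / 4 \<and> d x y < compact_radius y / 4"

lemma symp_near: "symp near"
  by (rule sympI) (auto simp: near_def commute)

definition chained :: "'a \<Rightarrow> 'a set" where
  "chained x = {y. near\<^sup>*\<^sup>* x y}"

lemma chained_refl: "x \<in> chained x"
  by (simp add: chained_def)

lemma chained_eq:
  assumes "y \<in> chained x" shows "chained y = chained x"
proof -
  have xy: "near\<^sup>*\<^sup>* x y" using assms by (simp add: chained_def)
  then have yx: "near\<^sup>*\<^sup>* y x" using symp_near by (metis sympD symp_rtranclp)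
  show ?thesis
    unfolding chained_def using rtranclp_trans[OF xy] rtranclp_trans[OF yx] by blast
qed

lemma chained_subset: "x \<in> M \<Longrightarrow> chained x \<subseteq> M"
proof
  fix y assume "x \<in> M" "y \<in> chained x"
  then have "near\<^sup>*\<^sup>* x y" by (simp add: chained_def)
  then show "y \<in> M" using \<open>x \<in> M\<close> by cases (auto simp: near_def)
qed

text \<open>Within an eighth of the radius at \<open>y\<close>, the radius at \<open>z\<close> is
  still at least 7/8 of it, so the distance is below a quarter of both radii and \<open>z\<close> is
  one step away.\<close>

lemma openin_chained:
  assumes lc: "locally_compact_space mtopology" and x: "x \<in> M"
  shows "openin mtopology (chained x)"
  unfolding openin_mtopology
proof (intro conjI allI impI chained_subset x)
  fix y assume y: "y \<in> chained x"
  then have yM: "y \<in> M" using chained_subset[OF x] by auto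
  have pos: "0 < compact_radius y" by (rule compact_radius_props(1)[OF lc yM])
  have "mball y (compact_radius y / 8) \<subseteq> chained x"
  proof
    fix z assume "z \<in> mball y (compact_radius y / 8)"
    then have z: "z \<in> M" "d y z < compact_radius y / 8" by auto
    have "compact_radius y \<le> compact_radius z + d y z" by (rule compact_radius_le[OF lc yM z(1)])
    then have "near y z" using z yM pos unfolding near_def by linarith
    then show "z \<in> chained x" using y by (simp add: chained_def)
  qed
  then show "\<exists>r>0. mball y r \<subseteq> chained x" using pos by (intro exI[of _ "compact_radius y / 8"]) simp
qed

text \<open>Finitely many balls of a quarter of the radius cover \<open>K\<close>. At a point
  \<open>k\<close> of such a ball the radius is at most 5/4 of that at the centre, so a step from
  \<open>k\<close> ends within 1/4 + 5/16 < 3/4 of the centre's radius, inside a compact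
  ball.\<close>

lemma near_compact:
  assumes lc: "locally_compact_space mtopology" and K: "compactin mtopology K"
  shows "\<exists>L. compactin mtopology L \<and> (\<forall>k\<in>K. \<forall>y. near k y \<longrightarrow> y \<in> L)"
proof -
  let ?B = "\<lambda>x. mball x (compact_radius x / 4)" and ?C = "\<lambda>x. mcball x (3 / 4 * compact_radius x)"
  have KM: "K \<subseteq> M" using compactin_subset_topspace[OF K] by simp
  have pos: "0 < compact_radius x" if "x \<in> M" for x using compact_radius_props(1)[OF lc that] .
  have "K \<subseteq> \<Union>(?B ` K)" using KM pos by fastforce
  moreover have "openin mtopology U" if "U \<in> ?B ` K" for U using that by auto
  ultimately obtain \<F> where \<F>: "finite \<F>" "\<F> \<subseteq> ?B ` K" "K \<subseteq> \<Union>\<F>"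
    using compactinD[OF K, of "?B ` K"] by meson
  obtain F where F: "finite F" "F \<subseteq> K" "\<F> = ?B ` F" using finite_subset_image[OF \<F>(1,2)] by auto
  have "compactin mtopology (?C x)" if "x \<in> F" for x
  proof (rule compact_radius_props(2)[OF lc])
    show "x \<in> M" using that F(2) KM by auto
    then show "3 / 4 * compact_radius x < compact_radius x" using pos by simp
  qed
  then have "compactin mtopology (\<Union>(?C ` F))" using F(1) by (intro compactin_Union) auto
  moreover have "y \<in> \<Union>(?C ` F)" if k: "k \<in> K" and ky: "near k y" for k y
  proof -
    obtain x where x: "x \<in> F" "k \<in> ?B x" using \<F>(3) F(3) k by auto
    have M: "x \<in> M" "k \<in> M" "y \<in> M" and dxk: "d x k < compact_radius x / 4"
      and dky: "d k y < compact_radius k / 4" using x(2) ky by (auto simp: near_def)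
    have "compact_radius k \<le> compact_radius x + d k x" by (rule compact_radius_le[OF lc M(2,1)])
    moreover have "d x y \<le> d x k + d k y" by (rule triangle[OF M])
    ultimately have "d x y \<le> 3 / 4 * compact_radius x"
      using dxk dky pos[OF M(1)] commute[of k x] by linarith
    then show ?thesis using x(1) M by auto
  qed
  ultimately show ?thesis by (intro exI[of _ "\<Union>(?C ` F)"] conjI ballI allI impI)
qed

text \<open>Whatever is reached from \<open>x\<close> in \<open>n\<close> steps lies in the
  \<open>n\<close>-th iterate of the compact enlargement given by
  \<open>near_compact\<close>.\<close>

lemma chained_sigma_compact:
  assumes lc: "locally_compact_space mtopology" and x: "x \<in> M"
  shows "\<exists>C :: nat \<Rightarrow> 'a set. (\<forall>n. compactin mtopology (C n)) \<and> chained x \<subseteq> (\<Union>n. C n)"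
proof -
  have "\<forall>K\<in>{K. compactin mtopology K}. \<exists>L. compactin mtopology L \<and> (\<forall>k\<in>K. \<forall>y. near k y \<longrightarrow> y \<in> L)"
    using near_compact[OF lc] by simp
  from bchoice[OF this] obtain nxt where nxt: "\<And>K. compactin mtopology K \<Longrightarrow> compactin mtopology (nxt K)"
    "\<And>K k y. compactin mtopology K \<Longrightarrow> k \<in> K \<Longrightarrow> near k y \<Longrightarrow> y \<in> nxt K" by auto
  define C where "C n = (nxt ^^ n) {x}" for n
  have C: "compactin mtopology (C n)" for n
    by (induction n) (use x nxt(1) in \<open>auto simp: C_def\<close>)
  have "\<exists>n. y \<in> C n" if "near\<^sup>*\<^sup>* x y" for y
    using that
  proof induction
    case base
    then show ?case by (intro exI[of _ 0]) (simp add: C_def)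
  next
    case (step y z)
    then obtain n where "y \<in> C n" by auto
    then have "z \<in> C (Suc n)" using nxt(2)[OF C _ step(2)] by (simp add: C_def)
    then show ?case ..
  qed
  then show ?thesis using C by (intro exI[of _ C]) (auto simp: chained_def)
qed

text \<open>A class is closed, its complement being a union of other open classes. Hence each
  \<open>C n \<inter> chained x\<close> is compact, and finitely many compact open neighbourhoods
  inside the class cover it.\<close>

lemma chained_compact_open_cover:
  assumes zd: "zero_dimensional_space mtopology" and lc: "locally_compact_space mtopology" and x: "x \<in> M"
  shows "\<exists>B :: nat \<Rightarrow> 'a set. (\<forall>n. compactin mtopology (B n) \<and> openin mtopology (B n)) \<and> (\<Union>n. B n) = chained x"
proof -
  let ?E = "chained x"
  have oE: "openin mtopology ?E" by (rule openin_chained[OF lc x])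
  have "M - ?E = (\<Union>y\<in>M - ?E. chained y)"
  proof (intro equalityI subsetI)
    fix y assume "y \<in> M - ?E"
    then show "y \<in> (\<Union>y\<in>M - ?E. chained y)" using chained_refl by blast
  next
    fix z assume "z \<in> (\<Union>y\<in>M - ?E. chained y)"
    then obtain y where y: "y \<in> M" "y \<notin> ?E" "z \<in> chained y" by blast
    have "z \<notin> ?E"
    proof
      assume "z \<in> ?E"
      then have "chained y = ?E" using chained_eq[of z x] chained_eq[OF y(3)] by simp
      then show False using chained_refl[of y] y(2) by simp
    qed
    then show "z \<in> M - ?E" using chained_subset[OF y(1)] y(3) by auto
  qed
  moreover have "openin mtopology (\<Union>y\<in>M - ?E. chained y)"
    using openin_chained[OF lc] by (intro openin_Union) auto
  ultimately have cE: "closedin mtopology ?E"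
    unfolding closedin_def topspace_mtopology using chained_subset[OF x] by simp
  have loc: "\<exists>B. compactin mtopology B \<and> openin mtopology B \<and> y \<in> B \<and> B \<subseteq> ?E" if y: "y \<in> ?E" for y
  proof -
    have yM: "y \<in> M" using y chained_subset[OF x] by auto
    obtain U K where U: "openin mtopology U" "compactin mtopology K" "y \<in> U" "U \<subseteq> K"
      using lc yM unfolding locally_compact_space_def topspace_mtopology by meson
    have "openin mtopology (U \<inter> ?E)" "y \<in> U \<inter> ?E" using U(1,3) oE y by auto
    from zero_dimensional_nbhd[OF zd this]
    obtain B where B: "openin mtopology B" "closedin mtopology B" "y \<in> B" "B \<subseteq> U \<inter> ?E"
      by (elim exE conjE)
    have "compactin mtopology B" using closed_compactin[OF U(2) _ B(2)] B(4) U(4) by auto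
    then show ?thesis using B by (intro exI[of _ B]) auto
  qed
  obtain C :: "nat \<Rightarrow> 'a set" where C: "\<And>n. compactin mtopology (C n)" "?E \<subseteq> (\<Union>n. C n)"
    using chained_sigma_compact[OF lc x] by auto
  have "\<exists>B. (compactin mtopology B \<and> openin mtopology B) \<and> C n \<inter> ?E \<subseteq> B \<and> B \<subseteq> ?E" for n
  proof -
    let ?\<U> = "{B. compactin mtopology B \<and> openin mtopology B \<and> B \<subseteq> ?E}"
    have "compactin mtopology (C n \<inter> ?E)" using C(1) cE by (rule compact_Int_closedin)
    moreover have "C n \<inter> ?E \<subseteq> \<Union>?\<U>" using loc by blast
    ultimately obtain \<F> where \<F>: "finite \<F>" "\<F> \<subseteq> ?\<U>" "C n \<inter> ?E \<subseteq> \<Union>\<F>"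
      using compactinD[of mtopology "C n \<inter> ?E" ?\<U>] by (metis (no_types, lifting) mem_Collect_eq)
    have "compactin mtopology (\<Union>\<F>)" using \<F>(1,2) by (intro compactin_Union) auto
    moreover have "openin mtopology (\<Union>\<F>)" using \<F>(2) by (intro openin_Union) auto
    moreover have "\<Union>\<F> \<subseteq> ?E" using \<F>(2) by auto
    ultimately show ?thesis using \<F>(3) by (intro exI[of _ "\<Union>\<F>"] conjI)
  qed
  from choice[OF allI[OF this]] obtain B where B: "\<forall>n. (compactin mtopology (B n) \<and> openin mtopology (B n)) \<and>
      C n \<inter> ?E \<subseteq> B n \<and> B n \<subseteq> ?E" by (rule exE)
  have "(\<Union>n. B n) = ?E"
  proof (intro equalityI subsetI)
    fix y assume y: "y \<in> ?E"
    then obtain n where "y \<in> C n" using C(2) by auto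
    then have "y \<in> B n" using B y by auto
    then show "y \<in> (\<Union>n. B n)" by auto
  qed (use B in auto)
  with B show ?thesis by (intro exI[of _ B]) simp
qed

text \<open>Within one class the compact open sets form a sequence, so each loses only finitely many
  predecessors and stays compact and open. Distinct classes are disjoint.\<close>

lemma compact_open_partition_exists:
  assumes zd: "zero_dimensional_space mtopology" and lc: "locally_compact_space mtopology"
  shows "\<exists>I. (\<forall>K\<in>I. compactin mtopology K \<and> openin mtopology K) \<and>
    (\<forall>K\<in>I. \<forall>L\<in>I. K \<noteq> L \<longrightarrow> K \<inter> L = {}) \<and> \<Union>I = M"
proof -
  have "\<forall>E\<in>chained ` M. \<exists>B :: nat \<Rightarrow> 'a set.
      (\<forall>n. compactin mtopology (B n) \<and> openin mtopology (B n)) \<and> (\<Union>n. B n) = E"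
    using chained_compact_open_cover[OF zd lc] by auto
  from bchoice[OF this] obtain B where "\<forall>E\<in>chained ` M.
      (\<forall>n :: nat. compactin mtopology (B E n) \<and> openin mtopology (B E n)) \<and> (\<Union>n. B E n) = E"
    by (rule exE)
  then have B: "\<And>E n. E \<in> chained ` M \<Longrightarrow> compactin mtopology (B E n)"
    "\<And>E n. E \<in> chained ` M \<Longrightarrow> openin mtopology (B E n)"
    "\<And>E. E \<in> chained ` M \<Longrightarrow> (\<Union>n. B E n) = E" by (simp_all only:)
  define P where "P E n = disjointed (B E) n" for E n
  have UP: "(\<Union>n. P E n) = E" if "E \<in> chained ` M" for E
    using B(3)[OF that] by (simp add: P_def UN_disjointed_eq)
  have PE: "P E n \<subseteq> E" if "E \<in> chained ` M" for E n using UP[OF that] by auto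
  \<comment> \<open>The empty set may occur among the pieces; its function group is trivial.\<close>
  define I where "I = {P E n |E n. E \<in> chained ` M}"
  have "compactin mtopology (P E n) \<and> openin mtopology (P E n)" if E: "E \<in> chained ` M" for E n
  proof
    have eq: "P E n = B E n - (\<Union>i\<in>{0..<n}. B E i)" by (simp add: P_def disjointed_def)
    have cl: "closedin mtopology (B E i)" for i
      using compactin_imp_closedin[OF Hausdorff_space_mtopology B(1)[OF E]] .
    then have "closedin mtopology (\<Union>i\<in>{0..<n}. B E i)" by (intro closedin_Union) auto
    then show "openin mtopology (P E n)" unfolding eq by (intro openin_diff B(2)[OF E])
    have "openin mtopology (\<Union>i\<in>{0..<n}. B E i)" using B(2)[OF E] by (intro openin_Union) auto
    then have "closedin mtopology (P E n)" unfolding eq by (intro closedin_diff cl)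
    then show "compactin mtopology (P E n)"
      by (intro closed_compactin[OF B(1)[OF E, of n]]) (auto simp: eq)
  qed
  then have "\<forall>K\<in>I. compactin mtopology K \<and> openin mtopology K" by (auto simp: I_def)
  moreover have "K \<inter> L = {}" if K: "K \<in> I" and L: "L \<in> I" and ne: "K \<noteq> L" for K L
  proof -
    obtain E n where E: "E \<in> chained ` M" "K = P E n" using K unfolding I_def by blast
    obtain E' m where E': "E' \<in> chained ` M" "L = P E' m" using L unfolding I_def by blast
    show ?thesis
    proof (cases "E = E'")
      case True
      then have "n \<noteq> m" using ne E E' by auto
      then show ?thesis using disjoint_family_disjointed[of "B E"] True
        unfolding E(2) E'(2) P_def disjoint_family_on_def by simp
    next
      case False
      have "E \<inter> E' = {}"
      proof (rule ccontr)
        assume "E \<inter> E' \<noteq> {}"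
        then obtain z where z: "z \<in> E" "z \<in> E'" by auto
        obtain x y where xy: "E = chained x" "E' = chained y" using E(1) E'(1) by auto
        have "E = E'" using chained_eq[of z x] chained_eq[of z y] z unfolding xy by simp
        then show False using False by simp
      qed
      then show ?thesis using PE[OF E(1), of n] PE[OF E'(1), of m] E(2) E'(2) by auto
    qed
  qed
  moreover have "\<Union>I = M"
  proof (intro equalityI subsetI)
    fix x assume "x \<in> \<Union>I"
    then obtain E n where "E \<in> chained ` M" "x \<in> P E n" unfolding I_def by auto
    then show "x \<in> M" using PE chained_subset by blast
  next
    fix x assume x: "x \<in> M"
    then have E: "chained x \<in> chained ` M" by simp
    then obtain n where "x \<in> P (chained x) n" using UP[OF E] chained_refl[of x] by auto
    then show "x \<in> \<Union>I" using E unfolding I_def by blast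
  qed
  ultimately show ?thesis by (intro exI[of _ I]) simp
qed

end

text \<open>Compactness of the derived set makes neighbourhoods of fixed radius cofinal among its
  open neighbourhoods.\<close>

lemma (in Metric_space) shrinking_nbhds_derived:
  assumes D: "compactin mtopology (derived_space_set mtopology)"
  defines "A \<equiv> \<lambda>n. case n of 0 \<Rightarrow> M
    | Suc m \<Rightarrow> \<Union>a\<in>derived_space_set mtopology. mball a (inverse (real (Suc m)))"
  shows "shrinking_nbhds mtopology (derived_space_set mtopology) A"
proof -
  let ?D = "derived_space_set mtopology"
  have DM: "?D \<subseteq> M" using compactin_subset_topspace[OF D] by simp
  have shrink: "\<exists>n. A n \<subseteq> U" if U: "openin mtopology U" "?D \<subseteq> U" for U
  proof -
    \<comment> \<open>A Lebesgue number for the cover by the single set \<open>U\<close> is a radius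
      that works at all points of the derived set at once.\<close>
    have "\<exists>e>0. \<forall>x\<in>?D. \<exists>V\<in>{U}. mball x e \<subseteq> V"
      by (rule lebesgue_number[OF D]) (use U in auto)
    then obtain e where e: "e > 0" "\<forall>x\<in>?D. mball x e \<subseteq> U" by auto
    obtain n where n: "inverse (real (Suc n)) < e" using reals_Archimedean[OF e(1)] by auto
    have "mball a (inverse (real (Suc n))) \<subseteq> U" if "a \<in> ?D" for a
      using e(2) that mball_subset_concentric[of "inverse (real (Suc n))" e a] n
      by (meson less_imp_le order_trans)
    then have "A (Suc n) \<subseteq> U" unfolding A_def nat.case by (rule UN_least)
    then show ?thesis ..
  qed
  show ?thesis
  proof
    show "openin mtopology {x}" if x: "x \<in> topspace mtopology" "x \<notin> ?D" for x
    proof -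
      obtain T where T: "x \<in> T" "openin mtopology T" "\<forall>y. y \<noteq> x \<longrightarrow> \<not> (y \<in> topspace mtopology \<and> y \<in> T)"
        using x unfolding in_derived_set_of by meson
      have "T = {x}" using T openin_subset[OF T(2)] by auto
      then show ?thesis using T(2) by simp
    qed
    show "A 0 = topspace mtopology" by (simp add: A_def)
    show "openin mtopology (A n)" for n by (cases n) (auto simp: A_def)
    show "A (Suc n) \<subseteq> A n" for n
    proof (cases n)
      case 0
      then show ?thesis by (auto simp: A_def)
    next
      case (Suc m)
      have "inverse (real (Suc (Suc m))) \<le> inverse (real (Suc m))" by (intro le_imp_inverse_le) auto
      then show ?thesis unfolding A_def Suc nat.case by (intro UN_mono mball_subset_concentric subset_refl)
    qed
    show "?D \<subseteq> A n" for n
    proof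
      fix a assume a: "a \<in> ?D"
      then have "a \<in> M" using DM by auto
      then show "a \<in> A n" using a by (cases n) (auto simp: A_def intro!: bexI[of _ a])
    qed
    show "(\<Inter>n. A n) \<subseteq> ?D"
    proof
      fix x assume x: "x \<in> (\<Inter>n. A n)"
      show "x \<in> ?D"
      proof (rule ccontr)
        assume "x \<notin> ?D"
        have "x \<in> A 0" using x by blast
        then have "x \<in> M" by (simp add: A_def)
        \<comment> \<open>The open set \<open>M - {x}\<close> contains the derived set and hence
          some \<open>A n\<close>, which contradicts that \<open>x\<close> lies in all of
          them.\<close>
        then have "closedin mtopology {x}"
          using Hausdorff_imp_t1_space[OF Hausdorff_space_mtopology] by (simp add: t1_space_closedin_finite)
        then have "openin mtopology (M - {x})" by (auto simp: closedin_def)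
        moreover have "?D \<subseteq> M - {x}" using DM \<open>x \<notin> ?D\<close> by auto
        ultimately obtain n where "A n \<subseteq> M - {x}" using shrink by meson
        then show False using x by auto
      qed
    qed
  qed (rule D, erule (1) shrink)
qed

theorem theorem3p3:
  fixes M :: "'a set" and d :: "'a \<Rightarrow> 'a \<Rightarrow> real" and X :: "'a topology"
  assumes "Metric_space M d" and "X = Metric_space.mtopology M d"
    and "zero_dimensional_space X"
  shows
    "(Ascoli_space (Ck2_topology X) \<longleftrightarrow> kR_space (Ck2_topology X)) \<and>
     (kR_space (Ck2_topology X) \<longleftrightarrow>
        locally_compact_space X \<or>
        (\<not> locally_compact_space X \<and> compactin X (derived_space_set X))) \<and>
     (locally_compact_space X \<longrightarrow>
        (\<exists>(I :: 'a set set) (G :: 'a set \<Rightarrow> ('a \<Rightarrow> int) monoid) T.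
           (\<forall>i\<in>I. Polish_abelian_group (G i) (T i)) \<and>
           topologically_isomorphic (Ck2_group X) (Ck2_topology X)
             (product_group I G) (product_topology T I))) \<and>
     (\<not> locally_compact_space X \<and> compactin X (derived_space_set X) \<longrightarrow>
        subgroup (Ck2_vanishing X) (Ck2_group X) \<and>
        openin (Ck2_topology X) (Ck2_vanishing X) \<and>
        k_space (subtopology (Ck2_topology X) (Ck2_vanishing X)) \<and>
        (\<exists>\<kappa> :: nat \<Rightarrow> 'a rel.
           (\<forall>n. Card_order (\<kappa> n)) \<and>
           topologically_isomorphic
             ((Ck2_group X)\<lparr>carrier := Ck2_vanishing X\<rparr>)
             (subtopology (Ck2_topology X) (Ck2_vanishing X))
             (sum_group UNIV (\<lambda>n. Z2_power_group (\<kappa> n)))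
             (box_sum_topology UNIV (\<lambda>n. Z2_power_group (\<kappa> n)) (\<lambda>n. Z2_power_topology (\<kappa> n)))))"
proof -
  interpret Metric_space M d by fact
  have X: "X = mtopology" by fact
  have zd: "zero_dimensional_space mtopology" using assms(3) X by simp
  let ?D = "derived_space_set X"
  \<comment> \<open>The implications run in a cycle: the real k-property gives the Ascoli property,
    the latter gives (3a) or (3b) by the obstruction, and each alternative gives back the real
    k-property together with its structural description.\<close>
  have Ascoli_imp: "locally_compact_space X \<or> compactin X ?D" if "Ascoli_space (Ck2_topology X)"
    using not_Ascoli_Ck2[OF zd] that X by blast
  have kR_imp: "Ascoli_space (Ck2_topology X)" if "kR_space (Ck2_topology X)"
    using regular_Ck2 Hausdorff_Ck2 that by (rule kR_imp_Ascoli)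
  have lc: "kR_space (Ck2_topology X) \<and> (\<exists>(I :: 'a set set) (G :: 'a set \<Rightarrow> ('a \<Rightarrow> int) monoid) T.
           (\<forall>i\<in>I. Polish_abelian_group (G i) (T i)) \<and>
           topologically_isomorphic (Ck2_group X) (Ck2_topology X)
             (product_group I G) (product_topology T I))" if "locally_compact_space X"
  proof -
    from compact_open_partition_exists[OF zd] that X
    obtain I where I: "(\<forall>K\<in>I. compactin X K \<and> openin X K) \<and>
        (\<forall>K\<in>I. \<forall>L\<in>I. K \<noteq> L \<longrightarrow> K \<inter> L = {}) \<and> \<Union>I = M" by auto
    then interpret P: compact_open_partition X I
      by unfold_locales (use X in auto)
    let ?G = "\<lambda>K. Ck2_group (subtopology X K)" and ?T = "\<lambda>K. discrete_topology (P.C K)"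
    have "Polish_abelian_group (?G K) (?T K)" if "K \<in> I" for K
      using Polish_abelian_group_countable_discrete[OF comm_group_Ck2, of "subtopology X K"]
        countable_CF2[of K] P.compact[OF that] X by simp
    moreover have "topologically_isomorphic (Ck2_group X) (Ck2_topology X) (product_group I ?G) (product_topology ?T I)"
      unfolding topologically_isomorphic_def
      using P.iso_piece_map P.homeomorphic_map_piece_map by (intro exI[of _ P.piece_map] conjI)
    ultimately show ?thesis using P.kR_space_Ck2
      by (intro conjI exI[of _ I] exI[of _ ?G] exI[of _ ?T] ballI)
  qed
  have cd: "kR_space (Ck2_topology X) \<and> k_space (subtopology (Ck2_topology X) (Ck2_vanishing X)) \<and>
      (\<exists>\<kappa> :: nat \<Rightarrow> 'a rel.
           (\<forall>n. Card_order (\<kappa> n)) \<and>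
           topologically_isomorphic
             ((Ck2_group X)\<lparr>carrier := Ck2_vanishing X\<rparr>)
             (subtopology (Ck2_topology X) (Ck2_vanishing X))
             (sum_group UNIV (\<lambda>n. Z2_power_group (\<kappa> n)))
             (box_sum_topology UNIV (\<lambda>n. Z2_power_group (\<kappa> n)) (\<lambda>n. Z2_power_topology (\<kappa> n))))"
    if D: "compactin X ?D"
  proof -
    obtain A where "shrinking_nbhds X ?D A"
      using shrinking_nbhds_derived D X by blast
    then interpret S: shrinking_nbhds X ?D A .
    have H: "Ck2_vanishing X = S.vanishing" by (simp add: Ck2_vanishing_eq S.vanishing_def)
    have "\<forall>n. Card_order (card_of (S.shell n))" by (simp add: card_of_Card_order)
    moreover have "topologically_isomorphic ((Ck2_group X)\<lparr>carrier := Ck2_vanishing X\<rparr>)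
             (subtopology (Ck2_topology X) (Ck2_vanishing X))
             (sum_group UNIV (\<lambda>n. Z2_power_group (card_of (S.shell n))))
             (box_sum_topology UNIV (\<lambda>n. Z2_power_group (card_of (S.shell n)))
               (\<lambda>n. Z2_power_topology (card_of (S.shell n))))"
      unfolding topologically_isomorphic_def H
      using S.iso_shell_map S.homeomorphic_map_shell_map by (intro exI[of _ S.shell_map] conjI)
    \<comment> \<open>The k-property was proved for the whole group and descends to a closed
      subspace.\<close>
    moreover have "k_space (subtopology (Ck2_topology X) (Ck2_vanishing X))"
      using S.k_space_Ck2 closedin_Ck2_vanishing by (rule k_space_closed_subtopology)
    ultimately show ?thesis using k_space_imp_kR[OF S.k_space_Ck2]
      by (intro conjI exI[of _ "\<lambda>n. card_of (S.shell n)"])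
  qed
  show ?thesis
    using Ascoli_imp kR_imp lc cd subgroup_Ck2_vanishing[of X] openin_Ck2_vanishing[of X] by meson
qed

end
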